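(* Let $n,r\ge 1$. The Hilbert–Poincaré series of $H^*(\mathrm{Quot}_2(\mathcal{O}_{\mathbb{A}^n}^{\oplus r}))$ agrees with the Hilbert–Poincaré series of the graded ring $\mathbb{Z}[x_1,x_2]/(x_2^r)$, where $x_i$ has degree $2i$ for $i=1,2$, in degrees $\le 2\cdot(n+r-2)$.
   Context: The base field is $\mathbb{C}$ and $H^*$ is singular cohomology with integral coefficients. $\mathrm{Quot}_2(\mathcal{O}_{\mathbb{A}^n}^{\oplus r})$ is the Quot scheme of points parametrizing equivalence classes of surjections $\mathcal{O}_{\mathbb{A}^n}^{\oplus r}\twoheadrightarrow \mathcal{F}$ with $\mathcal{F}$ of finite length $2$. The Hilbert–Poincaré series of a graded abelian group $\bigoplus_i G^i$ is $\sum_i \mathrm{rk}_{\mathbb{Z}}(G^i)t^i$. *)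

theory Defs
  imports
    "HOL-Homology.Homology"
    "HOL-Algebra.Algebraic_Closure_Type"
    "HOL-Computational_Algebra.Formal_Power_Series"
    "HOL-Library.Extended_Nat"
begin

section \<open>Hilbert--Poincare series of graded abelian groups\<close>

text \<open>The rank is the supremum of the cardinalities of the finite \<open>\<int>\<close>-linearly independent
  subsets; it is an extended natural number because the groups are not assumed to have finite rank.\<close>

definition int_independent :: "('g, 'm) monoid_scheme \<Rightarrow> 'g set \<Rightarrow> bool" where
  "int_independent G S \<longleftrightarrow> finite S \<and> S \<subseteq> carrier G \<and>
     (\<forall>c :: 'g \<Rightarrow> int. finprod G (\<lambda>x. x [^]\<^bsub>G\<^esub> c x) S = \<one>\<^bsub>G\<^esub> \<longrightarrow> (\<forall>x\<in>S. c x = 0))"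

definition abelian_rank :: "('g, 'm) monoid_scheme \<Rightarrow> enat" where
  "abelian_rank G = (SUP S\<in>{S. int_independent G S}. enat (card S))"

definition hilbert_poincare_series :: "(nat \<Rightarrow> ('g, 'm) monoid_scheme) \<Rightarrow> enat fps" where
  "hilbert_poincare_series G = Abs_fps (\<lambda>i. abelian_rank (G i))"

section \<open>Singular cohomology with integral coefficients\<close>

definition cochain_group :: "nat \<Rightarrow> 'a topology \<Rightarrow> ('a chain \<Rightarrow> int) monoid" where
  "cochain_group p T =
     \<lparr>carrier = hom (chain_group p T) integer_group \<inter> extensional (singular_chain_set p T),
      monoid.mult = (\<lambda>f g. \<lambda>c\<in>singular_chain_set p T. f c + g c),
      one = (\<lambda>c\<in>singular_chain_set p T. 0)\<rparr>"

definition cochain_coboundary :: "nat \<Rightarrow> 'a topology \<Rightarrow> ('a chain \<Rightarrow> int) \<Rightarrow> 'a chain \<Rightarrow> int" where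
  "cochain_coboundary p T f = (\<lambda>c\<in>singular_chain_set (Suc p) T. f (chain_boundary (Suc p) c))"

definition cocycle_set :: "nat \<Rightarrow> 'a topology \<Rightarrow> ('a chain \<Rightarrow> int) set" where
  "cocycle_set p T =
     kernel (cochain_group p T) (cochain_group (Suc p) T) (cochain_coboundary p T)"

definition coboundary_set :: "nat \<Rightarrow> 'a topology \<Rightarrow> ('a chain \<Rightarrow> int) set" where
  "coboundary_set p T =
     (case p of 0 \<Rightarrow> {\<one>\<^bsub>cochain_group 0 T\<^esub>}
      | Suc q \<Rightarrow> cochain_coboundary q T ` carrier (cochain_group q T))"

definition singular_cohomology_group ::
    "nat \<Rightarrow> 'a topology \<Rightarrow> ('a chain \<Rightarrow> int) set monoid" where
  "singular_cohomology_group p T =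
     subgroup_generated (cochain_group p T) (cocycle_set p T) Mod coboundary_set p T"

section \<open>Polynomial rings in several variables\<close>

text \<open>Elements of the type below are polynomials with coefficients in \<open>'a\<close> in variables indexed by
  \<open>'n\<close>; the ring structure is the convolution product from \<^theory>\<open>HOL-Library.Poly_Mapping\<close>.\<close>

type_synonym ('n, 'a) mpoly = "('n \<Rightarrow>\<^sub>0 nat) \<Rightarrow>\<^sub>0 'a"

definition mconst :: "'a \<Rightarrow> ('n, 'a::zero) mpoly" where
  "mconst a = Poly_Mapping.single 0 a"

definition mvar :: "'n \<Rightarrow> ('n, 'a::zero_neq_one) mpoly" where
  "mvar i = Poly_Mapping.single (Poly_Mapping.single i 1) 1"

definition mono_eval :: "('n \<Rightarrow> 'a) \<Rightarrow> ('n \<Rightarrow>\<^sub>0 nat) \<Rightarrow> 'a::comm_ring_1" where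
  "mono_eval p m = (\<Prod>i\<in>Poly_Mapping.keys m. p i ^ Poly_Mapping.lookup m i)"

definition mpoly_eval :: "('n \<Rightarrow> 'a) \<Rightarrow> ('n, 'a) mpoly \<Rightarrow> 'a::comm_ring_1" where
  "mpoly_eval p f = (\<Sum>m\<in>Poly_Mapping.keys f. Poly_Mapping.lookup f m * mono_eval p m)"

section \<open>The Quot functor\<close>

text \<open>
  Let \<open>P\<close> be a commutative ring (the type \<open>'a\<close>), \<open>I\<close> an ideal of \<open>P\<close> and \<open>A = P/I\<close>.  Two surjections
  from \<open>A[x\<^sub>i | i \<in> 'n]\<^sup>r\<close> are equivalent iff they have the same kernel, and submodules of
  \<open>A[x]\<^sup>r\<close> are the same as submodules \<open>K\<close> of \<open>P[x]\<^sup>r\<close> that contain \<open>I \<cdot> P[x]\<^sup>r\<close>.  So an \<open>A\<close>-point of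
  \<open>Quot\<^sub>d(\<O>\<^sup>r)\<close> is such a \<open>K\<close> for which the quotient \<open>F = P[x]\<^sup>r/K\<close> is locally free
  of rank \<open>d\<close> as an \<open>A\<close>-module.  The exponent is the type \<open>'r\<close>.

  \<open>free_on_basic_open d I K f\<close> says that the localization \<open>F\<^sub>f\<close> is a free \<open>A\<^sub>f\<close>-module of rank \<open>d\<close>,
  with denominators cleared: after multiplication by a unit of \<open>A\<^sub>f\<close>, the elements of a basis come
  from \<open>P[x]\<^sup>r\<close>.  Local freeness asks that the elements \<open>f\<close> with this property generate the unit ideal
  of \<open>A\<close>.
\<close>

definition free_on_basic_open ::
    "nat \<Rightarrow> 'a::comm_ring_1 set \<Rightarrow> (('n, 'a) mpoly ^ 'r) set \<Rightarrow> 'a \<Rightarrow> bool" where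
  "free_on_basic_open d I K f \<longleftrightarrow>
     (\<exists>b :: nat \<Rightarrow> ('n, 'a) mpoly ^ 'r.
        (\<forall>w. \<exists>N a. mconst (f ^ N) *s w - (\<Sum>j<d. mconst (a j) *s b j) \<in> K) \<and>
        (\<forall>a. (\<Sum>j<d. mconst (a j) *s b j) \<in> K \<longrightarrow> (\<forall>j<d. \<exists>N. f ^ N * a j \<in> I)))"

definition quot_functor ::
    "nat \<Rightarrow> 'a::comm_ring_1 set \<Rightarrow> (('n::finite, 'a) mpoly ^ 'r::finite) set set" where
  "quot_functor d I =
     {K. module.subspace (*s) K \<and> (\<forall>a\<in>I. \<forall>w. mconst a *s w \<in> K) \<and>
         genideal ring_of_type_algebra (I \<union> {f. free_on_basic_open d I K f}) = UNIV}"

section \<open>Complex points with the analytic topology\<close>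

text \<open>Over the field \<open>\<complex>\<close>, locally free of rank \<open>d\<close> means of dimension \<open>d\<close>
  (see \<open>quot_functor_field\<close> below), i.e. \<open>F\<close> is of finite length \<open>d\<close>.\<close>

definition quot_points ::
    "nat \<Rightarrow> (('n::finite, complex) mpoly ^ 'r::finite) set set" where
  "quot_points d = quot_functor d {0}"

text \<open>Every \<open>\<complex>\<close>-algebra of finite type is \<open>\<complex>[y\<^sub>0, y\<^sub>1, \<dots>]/I\<close> for an ideal \<open>I\<close> that contains all but
  finitely many of the variables.  Its complex points are the common zeros of \<open>I\<close>; all but finitely
  many coordinates vanish on them, so that the product topology induces the Euclidean one.\<close>

definition finite_type_ideal :: "(nat, complex) mpoly set \<Rightarrow> bool" where
  "finite_type_ideal I \<longleftrightarrow> ideal I ring_of_type_algebra \<and> (\<exists>m. \<forall>i\<ge>m. mvar i \<in> I)"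

definition zero_locus :: "(nat, complex) mpoly set \<Rightarrow> (nat \<Rightarrow> complex) set" where
  "zero_locus I = {p. \<forall>f\<in>I. mpoly_eval p f = 0}"

text \<open>Base change along the evaluation \<open>\<complex>[y]/I \<rightarrow> \<complex>\<close> at a point \<open>p\<close>: as evaluation is onto, the
  submodule generated by the image of \<open>K\<close> is the image.\<close>

definition specialize :: "(nat \<Rightarrow> complex) \<Rightarrow>
    ('n, (nat, complex) mpoly) mpoly ^ 'r \<Rightarrow> ('n, complex) mpoly ^ 'r" where
  "specialize p w = (\<chi> i. Poly_Mapping.map (mpoly_eval p) (w $ i))"

definition family_fibre :: "(nat \<Rightarrow> complex) \<Rightarrow>
    (('n, (nat, complex) mpoly) mpoly ^ 'r) set \<Rightarrow> (('n, complex) mpoly ^ 'r) set" where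
  "family_fibre p K = specialize p ` K"

text \<open>
  For a \<open>\<complex>\<close>-scheme \<open>X\<close> locally of finite type, the analytic topology on \<open>X(\<complex>)\<close> is the finest
  topology that makes \<open>(Spec A)(\<complex>) \<rightarrow> X(\<complex>)\<close> continuous for all \<open>A\<close> of finite type and all morphisms
  \<open>Spec A \<rightarrow> X\<close>: it makes all of these maps continuous, and it is determined by the charts of
  an affine open cover.  For the Quot scheme, a morphism \<open>Spec A \<rightarrow> X\<close> is an element \<open>K\<close> of the Quot
  functor at \<open>A\<close>, and it sends a point \<open>p\<close> to the fibre of \<open>K\<close> at \<open>p\<close>.
\<close>

definition quot_open :: "nat \<Rightarrow> (('n::finite, complex) mpoly ^ 'r::finite) set set \<Rightarrow> bool" where
  "quot_open d U \<longleftrightarrow> U \<subseteq> quot_points d \<and>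
     (\<forall>I K. finite_type_ideal I \<and> K \<in> quot_functor d I \<longrightarrow>
        openin (top_of_set (zero_locus I)) {p \<in> zero_locus I. family_fibre p K \<in> U})"

definition quot_space ::
    "nat \<Rightarrow> (('n::finite, complex) mpoly ^ 'r::finite) set topology" where
  "quot_space d = topology (quot_open d)"

section \<open>The graded ring \<open>\<int>[x\<^sub>1, x\<^sub>2]/(x\<^sub>2\<^sup>r)\<close>\<close>

datatype gen = X1 | X2

fun gen_degree :: "gen \<Rightarrow> nat" where
  "gen_degree X1 = 2"
| "gen_degree X2 = 4"

definition weight :: "(gen \<Rightarrow>\<^sub>0 nat) \<Rightarrow> nat" where
  "weight m = (\<Sum>g\<in>Poly_Mapping.keys m. gen_degree g * Poly_Mapping.lookup m g)"

definition homogeneous :: "nat \<Rightarrow> (gen, int) mpoly set" where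
  "homogeneous i = {f. \<forall>m\<in>Poly_Mapping.keys f. weight m = i}"

definition x2_power_ideal :: "nat \<Rightarrow> (gen, int) mpoly set" where
  "x2_power_ideal r = genideal ring_of_type_algebra {mvar X2 ^ r}"

definition truncated_ring :: "nat \<Rightarrow> (gen, int) mpoly set ring" where
  "truncated_ring r = ring_of_type_algebra Quot x2_power_ideal r"

definition truncated_ring_piece :: "nat \<Rightarrow> nat \<Rightarrow> (gen, int) mpoly set monoid" where
  "truncated_ring_piece r i =
     subgroup_generated (add_monoid (truncated_ring r))
       ((\<lambda>f. x2_power_ideal r +>\<^bsub>ring_of_type_algebra\<^esub> f) ` homogeneous i)"

section \<open>The analytic topology is well defined on the set of complex points\<close>

lemma istopology_quot_open: "istopology (quot_open d)"
proof -
  have "quot_open d (S \<inter> U)" if "quot_open d S" "quot_open d U"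
    for S U :: "(('n::finite, complex) mpoly ^ 'r::finite) set set"
  proof -
    have "{p \<in> Z. family_fibre p K \<in> S \<inter> U} =
        {p \<in> Z. family_fibre p K \<in> S} \<inter> {p \<in> Z. family_fibre p K \<in> U}" for Z K
      by auto
    then show ?thesis
      using that unfolding quot_open_def by (auto intro!: openin_Int)
  qed
  moreover have "quot_open d (\<Union>\<U>)" if "\<forall>U\<in>\<U>. quot_open d U"
    for \<U> :: "(('n::finite, complex) mpoly ^ 'r::finite) set set set"
  proof -
    have "{p \<in> Z. family_fibre p K \<in> \<Union>\<U>} =
        (\<Union>U\<in>\<U>. {p \<in> Z. family_fibre p K \<in> U})" for Z K
      by auto
    then show ?thesis
      using that unfolding quot_open_def by (fastforce intro!: openin_Union)
  qed
  ultimately show ?thesis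
    unfolding istopology_def by blast
qed

lemma openin_quot_space: "openin (quot_space d) U \<longleftrightarrow> quot_open d U"
  by (simp add: quot_space_def istopology_quot_open topology_inverse')

lemma mconst_simps:
  "mconst (a + b) = mconst a + (mconst b :: ('n, 'a::comm_ring_1) mpoly)"
  "mconst (a - b) = mconst a - (mconst b :: ('n, 'a::comm_ring_1) mpoly)"
  "mconst (a * b) = mconst a * (mconst b :: ('n, 'a::comm_ring_1) mpoly)"
  "mconst 0 = (0 :: ('n, 'a::comm_ring_1) mpoly)"
  "mconst 1 = (1 :: ('n, 'a::comm_ring_1) mpoly)"
  by (simp_all add: mconst_def single_add single_diff mult_single)

lemma mconst_eq_0_iff: "mconst a = 0 \<longleftrightarrow> a = 0"
  unfolding mconst_def by (metis lookup_single_eq lookup_zero single_zero)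

lemma module_vec: "Modules.module ((*s) :: 'a::comm_ring_1 \<Rightarrow> 'a ^ 'r \<Rightarrow> 'a ^ 'r)"
  by unfold_locales (simp_all add: vec_eq_iff algebra_simps)

lemma ideal_typeI:
  fixes J :: "'a::comm_ring_1 set"
  assumes "0 \<in> J" "\<And>a b. a \<in> J \<Longrightarrow> b \<in> J \<Longrightarrow> a + b \<in> J" "\<And>a b. a \<in> J \<Longrightarrow> b * a \<in> J"
  shows "ideal J ring_of_type_algebra"
proof (rule idealI[OF ring_from_type_algebra])
  have grp: "group (add_monoid (ring_of_type_algebra :: 'a ring))"
    by (intro abelian_group.a_group ring.is_abelian_group ring_from_type_algebra)
  have inv: "inv\<^bsub>add_monoid ring_of_type_algebra\<^esub> a = - a" for a :: 'a
    by (rule group.inv_equality[OF grp]) (simp_all add: ring_of_type_algebra_def)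
  show "subgroup J (add_monoid ring_of_type_algebra)"
  proof (rule group.subgroupI)
    show "group (add_monoid (ring_of_type_algebra :: 'a ring))"
      by (rule grp)
    show "inv\<^bsub>add_monoid ring_of_type_algebra\<^esub> a \<in> J" if "a \<in> J" for a
      using assms(3)[OF that, of "-1"] unfolding inv by simp
  qed (use assms in \<open>auto simp: ring_of_type_algebra_def\<close>)
  show "x \<otimes>\<^bsub>ring_of_type_algebra\<^esub> a \<in> J" "a \<otimes>\<^bsub>ring_of_type_algebra\<^esub> x \<in> J"
    if "a \<in> J" for a x
    using assms(3)[OF that, of x] by (simp_all add: ring_of_type_algebra_def mult.commute)
qed

lemma genideal_type_UNIV_iff:
  fixes S :: "'a::comm_ring_1 set"
  shows "genideal ring_of_type_algebra S = UNIV \<longleftrightarrow>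
    (\<forall>J. ideal J ring_of_type_algebra \<and> S \<subseteq> J \<longrightarrow> 1 \<in> J)"
proof
  assume "genideal ring_of_type_algebra S = UNIV"
  then show "\<forall>J. ideal J ring_of_type_algebra \<and> S \<subseteq> J \<longrightarrow> 1 \<in> J"
    unfolding genideal_def by blast
next
  assume *: "\<forall>J. ideal J ring_of_type_algebra \<and> S \<subseteq> J \<longrightarrow> 1 \<in> J"
  have "x \<in> J" if J: "ideal J ring_of_type_algebra" "S \<subseteq> J" for x J
    using ideal.I_l_closed[OF J(1), of 1 x] * J by (auto simp: ring_of_type_algebra_def)
  then show "genideal ring_of_type_algebra S = UNIV"
    unfolding genideal_def by blast
qed

lemma quot_functor_field:
  fixes K :: "(('n::finite, 'a::field) mpoly ^ 'r::finite) set"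
  shows "K \<in> quot_functor d {0} \<longleftrightarrow> module.subspace (*s) K \<and>
    (\<exists>b :: nat \<Rightarrow> ('n, 'a) mpoly ^ 'r.
       (\<forall>w. \<exists>a. w - (\<Sum>j<d. mconst (a j) *s b j) \<in> K) \<and>
       (\<forall>a. (\<Sum>j<d. mconst (a j) *s b j) \<in> K \<longrightarrow> (\<forall>j<d. a j = 0)))" (is "?L \<longleftrightarrow> ?R")
proof
  assume L: ?L
  then have sub: "module.subspace (*s) K"
    by (simp add: quot_functor_def)
  have "\<forall>J. ideal J ring_of_type_algebra \<and> {0} \<union> {f. free_on_basic_open d {0} K f} \<subseteq> J \<longrightarrow> 1 \<in> J"
    using L unfolding quot_functor_def genideal_type_UNIV_iff by blast
  moreover have "ideal {0 :: 'a} ring_of_type_algebra"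
    by (rule ideal_typeI) simp_all
  ultimately have "\<not> {0} \<union> {f. free_on_basic_open d {0} K f} \<subseteq> {0}"
    by (metis singletonD zero_neq_one)
  then obtain f where f: "f \<noteq> 0" "free_on_basic_open d {0} K f"
    by blast
  then obtain b :: "nat \<Rightarrow> ('n, 'a) mpoly ^ 'r" where
    b: "\<And>w. \<exists>N a. mconst (f ^ N) *s w - (\<Sum>j<d. mconst (a j) *s b j) \<in> K"
       "\<And>a j. (\<Sum>j<d. mconst (a j) *s b j) \<in> K \<Longrightarrow> j < d \<Longrightarrow> \<exists>N. f ^ N * a j = 0"
    unfolding free_on_basic_open_def by auto
  have "\<exists>a. w - (\<Sum>j<d. mconst (a j) *s b j) \<in> K" for w
  proof -
    obtain N a where Na: "mconst (f ^ N) *s w - (\<Sum>j<d. mconst (a j) *s b j) \<in> K"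
      using b(1) by blast
    let ?c = "inverse (f ^ N)"
    have 1: "mconst ?c *s (mconst (f ^ N) *s w) = w"
      using f(1) by (simp flip: mconst_simps(3) add: vector_smult_assoc mconst_simps(5))
    have 2: "mconst ?c *s (\<Sum>j<d. mconst (a j) *s b j) = (\<Sum>j<d. mconst (?c * a j) *s b j)"
      by (simp add: Modules.module.scale_sum_right[OF module_vec] mconst_simps(3) vector_smult_assoc)
    have "mconst ?c *s (mconst (f ^ N) *s w - (\<Sum>j<d. mconst (a j) *s b j)) \<in> K"
      by (rule Modules.module.subspace_scale[OF module_vec sub Na])
    then have "w - (\<Sum>j<d. mconst (?c * a j) *s b j) \<in> K"
      by (simp only: Modules.module.scale_right_diff_distrib[OF module_vec] 1 2)
    then show ?thesis
      by (rule exI[where x = "\<lambda>j. ?c * a j"])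
  qed
  moreover have "\<forall>j<d. a j = 0" if "(\<Sum>j<d. mconst (a j) *s b j) \<in> K" for a
    using b(2)[OF that] f(1) by auto
  ultimately show ?R
    using sub by blast
next
  assume R: ?R
  then obtain b :: "nat \<Rightarrow> ('n, 'a) mpoly ^ 'r" where sub: "module.subspace (*s) K"
    and b: "\<And>w. \<exists>a. w - (\<Sum>j<d. mconst (a j) *s b j) \<in> K"
      "\<And>a. (\<Sum>j<d. mconst (a j) *s b j) \<in> K \<Longrightarrow> \<forall>j<d. a j = 0"
    by blast
  have "\<exists>N a. mconst (1 ^ N) *s w - (\<Sum>j<d. mconst (a j) *s b j) \<in> K" for w
    using b(1)[of w] by (simp add: mconst_simps(5))
  moreover have "\<forall>j<d. \<exists>N. 1 ^ N * a j \<in> {0}" if "(\<Sum>j<d. mconst (a j) *s b j) \<in> K" for a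
    using b(2)[OF that] by simp
  ultimately have "free_on_basic_open d {0} K 1"
    unfolding free_on_basic_open_def by blast
  then have "genideal ring_of_type_algebra ({0} \<union> {f. free_on_basic_open d {0} K f}) = UNIV"
    unfolding genideal_type_UNIV_iff by blast
  moreover have "mconst a *s w \<in> K" if "a \<in> {0}" for a and w :: "('n, 'a) mpoly ^ 'r"
    using that by (simp add: mconst_simps(4) Modules.module.subspace_0[OF module_vec sub])
  ultimately show ?L
    using sub unfolding quot_functor_def by blast
qed

lemma poly_mapping_sum_single: "f = (\<Sum>m\<in>Poly_Mapping.keys f. Poly_Mapping.single m (Poly_Mapping.lookup f m))"
  by (rule poly_mapping_eqI)
    (auto simp: lookup_sum lookup_single when_def in_keys_iff sum.delta)

lemma poly_mapping_add_induct:
  assumes "\<And>m a. P (Poly_Mapping.single m a)" "\<And>f g. P f \<Longrightarrow> P g \<Longrightarrow> P (f + g)"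
  shows "P (f :: 'k \<Rightarrow>\<^sub>0 'a::comm_monoid_add)"
proof -
  have "P (\<Sum>m\<in>S. Poly_Mapping.single m (Poly_Mapping.lookup f m))" if "finite S" for S
    using that
  proof induction
    case empty
    then show ?case using assms(1)[of undefined 0] by simp
  qed (simp add: assms)
  then show ?thesis
    using poly_mapping_sum_single[of f] by (metis finite_keys)
qed

lemma mpoly_eval_superset:
  assumes "finite S" "Poly_Mapping.keys f \<subseteq> S"
  shows "mpoly_eval p f = (\<Sum>m\<in>S. Poly_Mapping.lookup f m * mono_eval p m)"
  unfolding mpoly_eval_def using assms
  by (intro sum.mono_neutral_left) (auto simp: in_keys_iff)

lemma mpoly_eval_add: "mpoly_eval p (f + g) = mpoly_eval p f + mpoly_eval p g"
proof -
  let ?S = "Poly_Mapping.keys f \<union> Poly_Mapping.keys g"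
  have "Poly_Mapping.keys (f + g) \<subseteq> ?S"
    by (rule Poly_Mapping.keys_add)
  then show ?thesis
    by (simp add: mpoly_eval_superset[of ?S] lookup_add distrib_right sum.distrib)
qed

lemma mpoly_eval_single: "mpoly_eval p (Poly_Mapping.single m a) = a * mono_eval p m"
  by (simp add: mpoly_eval_def)

lemma mpoly_eval_0: "mpoly_eval p 0 = 0"
  by (simp add: mpoly_eval_def)

lemma mpoly_eval_uminus: "mpoly_eval p (- f) = - mpoly_eval p f"
  by (rule minus_unique[symmetric]) (simp flip: mpoly_eval_add add: mpoly_eval_0)

lemma mpoly_eval_diff: "mpoly_eval p (f - g) = mpoly_eval p f - mpoly_eval p g"
  using mpoly_eval_add[of p f "- g"] by (simp add: mpoly_eval_uminus)

lemma mono_eval_superset: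
  assumes "finite S" "Poly_Mapping.keys m \<subseteq> S"
  shows "mono_eval p m = (\<Prod>i\<in>S. p i ^ Poly_Mapping.lookup m i)"
  unfolding mono_eval_def using assms
  by (intro prod.mono_neutral_left) (auto simp: in_keys_iff)

lemma mono_eval_add: "mono_eval p (m + l) = mono_eval p m * mono_eval p l"
proof -
  let ?S = "Poly_Mapping.keys m \<union> Poly_Mapping.keys l"
  have "Poly_Mapping.keys (m + l) \<subseteq> ?S"
    by (rule Poly_Mapping.keys_add)
  then show ?thesis
    by (simp add: mono_eval_superset[of ?S] lookup_add power_add prod.distrib)
qed

lemma mpoly_eval_mult: "mpoly_eval p (f * g) = mpoly_eval p f * mpoly_eval p g"
proof (induction f rule: poly_mapping_add_induct)
  case (1 m a)
  show ?case
    by (induction g rule: poly_mapping_add_induct)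
      (simp_all add: mult_single mpoly_eval_single mono_eval_add mpoly_eval_add algebra_simps)
qed (simp add: mpoly_eval_add algebra_simps)

lemma mpoly_eval_mconst: "mpoly_eval p (mconst c) = c"
  by (simp add: mconst_def mpoly_eval_single) (simp add: mono_eval_def)

lemma mpoly_eval_1: "mpoly_eval p 1 = 1"
  using mpoly_eval_mconst[of p 1] by (simp add: mconst_simps)

lemma mpoly_eval_power: "mpoly_eval p (f ^ N) = mpoly_eval p f ^ N"
  by (induction N) (simp_all add: mpoly_eval_mult mpoly_eval_1)

lemma lookup_map_eval:
  "Poly_Mapping.lookup (Poly_Mapping.map (mpoly_eval p) f) m = mpoly_eval p (Poly_Mapping.lookup f m)"
  by (simp add: map.rep_eq when_def mpoly_eval_0)

lemma map_eval_add:
  "Poly_Mapping.map (mpoly_eval p) (f + g) =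
    Poly_Mapping.map (mpoly_eval p) f + Poly_Mapping.map (mpoly_eval p) g"
  by (rule poly_mapping_eqI) (simp add: lookup_map_eval lookup_add mpoly_eval_add)

lemma map_eval_mult:
  "Poly_Mapping.map (mpoly_eval p) (f * g :: ('n, (nat, complex) mpoly) mpoly) =
    Poly_Mapping.map (mpoly_eval p) f * Poly_Mapping.map (mpoly_eval p) g"
proof (induction f rule: poly_mapping_add_induct)
  case (1 m a)
  show ?case
    by (induction g rule: poly_mapping_add_induct)
      (simp_all add: mult_single map_single mpoly_eval_0 mpoly_eval_mult map_eval_add algebra_simps)
qed (simp add: map_eval_add algebra_simps)

lemma map_eval_mconst: "Poly_Mapping.map (mpoly_eval p) (mconst c) = mconst (mpoly_eval p c)"
  by (simp add: mconst_def mpoly_eval_0)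

lemma specialize_add: "specialize p (v + w) = specialize p v + specialize p w"
  by (simp add: specialize_def vec_eq_iff map_eval_add)

lemma specialize_0: "specialize p 0 = 0"
  by (simp add: specialize_def vec_eq_iff poly_mapping_eq_iff fun_eq_iff lookup_map_eval mpoly_eval_0)

lemma specialize_scale: "specialize p (c *s w) = Poly_Mapping.map (mpoly_eval p) c *s specialize p w"
  by (simp add: specialize_def vec_eq_iff map_eval_mult)

lemma specialize_diff: "specialize p (v - w) = specialize p v - specialize p w"
  using specialize_add[of p "v - w" w] by simp

lemma specialize_sum: "specialize p (sum w S) = (\<Sum>x\<in>S. specialize p (w x))"
  by (induction S rule: infinite_finite_induct) (simp_all add: specialize_0 specialize_add)

lemma map_eval_surj: "\<exists>c'. Poly_Mapping.map (mpoly_eval p) c' = c"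
proof
  show "Poly_Mapping.map (mpoly_eval p) (Poly_Mapping.map mconst c) = c"
    by (rule poly_mapping_eqI)
      (auto simp: lookup_map_eval map.rep_eq when_def mpoly_eval_mconst mpoly_eval_0 mconst_eq_0_iff)
qed

lemma specialize_surj:
  fixes w :: "('n, complex) mpoly ^ 'r"
  shows "\<exists>w' :: ('n, (nat, complex) mpoly) mpoly ^ 'r. specialize p w' = w"
proof -
  have "\<forall>i. \<exists>c :: ('n, (nat, complex) mpoly) mpoly. Poly_Mapping.map (mpoly_eval p) c = w $ i"
    using map_eval_surj by blast
  from choice[OF this] obtain c :: "'r \<Rightarrow> ('n, (nat, complex) mpoly) mpoly"
    where c: "\<And>i. Poly_Mapping.map (mpoly_eval p) (c i) = w $ i"
    by blast
  show ?thesis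
    by (rule exI[where x = "\<chi> i. c i"]) (simp add: specialize_def vec_eq_iff c)
qed

lemma vec_mpoly_induct:
  fixes w :: "('n, 'a::comm_ring_1) mpoly ^ 'r::finite"
  assumes "\<And>i m. P (mconst (Poly_Mapping.lookup (w $ i) m) *s axis i (Poly_Mapping.single m 1))"
    and "P 0" "\<And>v w. P v \<Longrightarrow> P w \<Longrightarrow> P (v + w)"
  shows "P w"
proof -
  have sum: "P (sum g S)" if "\<And>x. x \<in> S \<Longrightarrow> P (g x)"
    for g :: "'x \<Rightarrow> ('n, 'a) mpoly ^ 'r" and S
    using that by (induction S rule: infinite_finite_induct) (auto intro: assms)
  have inner: "axis i (w $ i) = (\<Sum>m\<in>Poly_Mapping.keys (w $ i).
      mconst (Poly_Mapping.lookup (w $ i) m) *s axis i (Poly_Mapping.single m 1))" (is "_ = ?s") for i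
  proof (rule vec_eq_iff[THEN iffD2], rule allI)
    show "axis i (w $ i) $ j = ?s $ j" for j
    proof (cases "j = i")
      case True
      have "?s $ j = (\<Sum>m\<in>Poly_Mapping.keys (w $ i).
          Poly_Mapping.single m (Poly_Mapping.lookup (w $ i) m))"
        using True by (simp add: axis_def mconst_def mult_single)
      then show ?thesis
        using True by (simp add: axis_def poly_mapping_sum_single[symmetric])
    qed (simp add: axis_def)
  qed
  have P_axis: "P (axis i (w $ i))" for i
    by (subst inner) (intro sum assms(1))
  have "w = (\<Sum>i\<in>UNIV. axis i (w $ i))"
    by (simp add: vec_eq_iff axis_def)
  moreover have "P (\<Sum>i\<in>UNIV. axis i (w $ i))"
    by (intro sum P_axis)
  ultimately show ?thesis
    by simp
qed

text \<open>The fibres of a family are points of the Quot scheme.\<close>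

lemma family_fibre_in_quot_points:
  fixes K :: "(('n::finite, (nat, complex) mpoly) mpoly ^ 'r::finite) set"
  assumes K: "K \<in> quot_functor d I" and p: "p \<in> zero_locus I"
  shows "family_fibre p K \<in> quot_points d"
proof -
  let ?ev = "mpoly_eval p"
  note mod = module_vec[where ?'a = "('n, (nat, complex) mpoly) mpoly" and ?'r = 'r]
  note mod' = module_vec[where ?'a = "('n, complex) mpoly" and ?'r = 'r]
  have sub: "module.subspace (*s) K"
    using K by (simp add: quot_functor_def)
  note K_0 = Modules.module.subspace_0[OF mod sub] and K_add = Modules.module.subspace_add[OF mod sub]
    and K_scale = Modules.module.subspace_scale[OF mod sub]
    and K_diff = Modules.module.subspace_diff[OF mod sub]
  have sub': "module.subspace (*s) (family_fibre p K)"
  proof (rule Modules.module.subspaceI[OF mod'])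
    show "0 \<in> family_fibre p K"
      unfolding family_fibre_def using K_0 specialize_0 by (metis imageI)
    show "x + y \<in> family_fibre p K" if "x \<in> family_fibre p K" "y \<in> family_fibre p K" for x y
      using that K_add unfolding family_fibre_def by (auto simp flip: specialize_add)
    show "c *s x \<in> family_fibre p K" if "x \<in> family_fibre p K" for c x
    proof -
      obtain c' where "Poly_Mapping.map ?ev c' = c"
        using map_eval_surj by blast
      with that K_scale show ?thesis
        unfolding family_fibre_def by (auto simp flip: specialize_scale)
    qed
  qed
  have evI: "?ev f = 0" if "f \<in> I" for f
    using that p by (simp add: zero_locus_def)
  have "\<forall>J. ideal J ring_of_type_algebra \<and> I \<union> {f. free_on_basic_open d I K f} \<subseteq> J \<longrightarrow> 1 \<in> J"
    using K unfolding quot_functor_def genideal_type_UNIV_iff by blast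
  moreover have "ideal {f. ?ev f = 0} ring_of_type_algebra"
    by (rule ideal_typeI) (simp_all add: mpoly_eval_0 mpoly_eval_add mpoly_eval_mult)
  moreover have "1 \<notin> {f. ?ev f = 0}"
    by (simp add: mpoly_eval_1)
  ultimately have "\<not> I \<union> {f. free_on_basic_open d I K f} \<subseteq> {f. ?ev f = 0}"
    by blast
  then obtain f where f: "?ev f \<noteq> 0" "free_on_basic_open d I K f"
    using evI by blast
  obtain b :: "nat \<Rightarrow> ('n, (nat, complex) mpoly) mpoly ^ 'r" where
    b: "\<And>w. \<exists>N a. mconst (f ^ N) *s w - (\<Sum>j<d. mconst (a j) *s b j) \<in> K"
       "\<And>a j. (\<Sum>j<d. mconst (a j) *s b j) \<in> K \<Longrightarrow> j < d \<Longrightarrow> \<exists>N. f ^ N * a j \<in> I"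
    using f(2) unfolding free_on_basic_open_def by blast
  let ?comb = "\<lambda>a. \<Sum>j<d. mconst (a j) *s b j"
  have comb_add: "?comb a + ?comb a' = ?comb (\<lambda>j. a j + a' j)" for a a'
    by (simp add: mconst_simps Modules.module.scale_left_distrib[OF mod] sum.distrib)
  have comb_diff: "?comb a - ?comb a' = ?comb (\<lambda>j. a j - a' j)" for a a'
    by (simp add: mconst_simps Modules.module.scale_left_diff_distrib[OF mod] sum_subtractf)
  have comb_scale: "mconst c *s ?comb a = ?comb (\<lambda>j. c * a j)" for a c
    by (simp add: Modules.module.scale_sum_right[OF mod] mconst_simps vector_smult_assoc)
  let ?b = "\<lambda>j. specialize p (b j)"
  have comb_ev: "specialize p (?comb a) = (\<Sum>j<d. mconst (?ev (a j)) *s ?b j)" for a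
    by (simp add: specialize_sum specialize_scale map_eval_mconst)
  have span: "\<exists>a. w - (\<Sum>j<d. mconst (a j) *s ?b j) \<in> family_fibre p K" for w
  proof -
    obtain w' where w': "specialize p w' = w"
      using specialize_surj by blast
    obtain N a where "mconst (f ^ N) *s w' - ?comb a \<in> K"
      using b(1) by blast
    then have "specialize p (mconst (f ^ N) *s w' - ?comb a) \<in> family_fibre p K"
      by (simp add: family_fibre_def)
    then have *: "mconst (?ev f ^ N) *s w - (\<Sum>j<d. mconst (?ev (a j)) *s ?b j) \<in> family_fibre p K"
      by (simp only: specialize_diff comb_ev specialize_scale map_eval_mconst mpoly_eval_power w')
    let ?c = "inverse (?ev f ^ N)"
    have 1: "mconst ?c *s (mconst (?ev f ^ N) *s w) = w"
      using f(1) by (simp flip: mconst_simps(3) add: vector_smult_assoc mconst_simps(5))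
    have 2: "mconst ?c *s (\<Sum>j<d. mconst (?ev (a j)) *s ?b j) =
        (\<Sum>j<d. mconst (?c * ?ev (a j)) *s ?b j)"
      by (simp add: Modules.module.scale_sum_right[OF mod'] mconst_simps(3) vector_smult_assoc)
    have "w - (\<Sum>j<d. mconst (?c * ?ev (a j)) *s ?b j) \<in> family_fibre p K"
      using Modules.module.subspace_scale[OF mod' sub' *, of "mconst ?c"]
      by (simp only: Modules.module.scale_right_diff_distrib[OF mod'] 1 2)
    then show ?thesis
      by (rule exI[where x = "\<lambda>j. ?c * ?ev (a j)"])
  qed
  have ker: "\<exists>N a. mconst (f ^ N) *s u - ?comb a \<in> K \<and> (\<forall>j<d. ?ev (a j) = 0)"
    if u: "specialize p u = 0" for u
  proof (induction u rule: vec_mpoly_induct)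
    case (1 i m)
    let ?c = "Poly_Mapping.lookup (u $ i) m"
    let ?w = "axis i (Poly_Mapping.single m 1)"
    have c: "?ev ?c = 0"
      using u by (simp add: specialize_def vec_eq_iff poly_mapping_eq_iff fun_eq_iff lookup_map_eval)
    obtain N a where "mconst (f ^ N) *s ?w - ?comb a \<in> K"
      using b(1) by blast
    from K_scale[OF this, of "mconst ?c"]
    have "mconst (f ^ N) *s (mconst ?c *s ?w) - ?comb (\<lambda>j. ?c * a j) \<in> K"
      by (simp only: Modules.module.scale_right_diff_distrib[OF mod] comb_scale)
        (simp add: vector_smult_assoc mult.commute)
    then show ?case
      using c by (intro exI[of _ N] exI[of _ "\<lambda>j. ?c * a j"]) (simp add: mpoly_eval_mult)
  next
    case 2
    show ?case
      by (rule exI[of _ 0], rule exI[of _ "\<lambda>_. 0"])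
        (simp add: mconst_simps mpoly_eval_0 K_0)
  next
    case (3 v w)
    obtain N a where v: "mconst (f ^ N) *s v - ?comb a \<in> K" "\<forall>j<d. ?ev (a j) = 0"
      using 3 by blast
    obtain M a' where w: "mconst (f ^ M) *s w - ?comb a' \<in> K" "\<forall>j<d. ?ev (a' j) = 0"
      using 3 by blast
    have v': "mconst (f ^ (N + M)) *s v - ?comb (\<lambda>j. f ^ M * a j) \<in> K"
      using K_scale[OF v(1), of "mconst (f ^ M)"]
      by (simp only: Modules.module.scale_right_diff_distrib[OF mod] comb_scale)
        (simp add: vector_smult_assoc power_add mconst_simps(3) mult.commute)
    have w': "mconst (f ^ (N + M)) *s w - ?comb (\<lambda>j. f ^ N * a' j) \<in> K"
      using K_scale[OF w(1), of "mconst (f ^ N)"]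
      by (simp only: Modules.module.scale_right_diff_distrib[OF mod] comb_scale)
        (simp add: vector_smult_assoc power_add mconst_simps(3) mult.commute)
    have "mconst (f ^ (N + M)) *s (v + w) - ?comb (\<lambda>j. f ^ M * a j + f ^ N * a' j) =
        (mconst (f ^ (N + M)) *s v - ?comb (\<lambda>j. f ^ M * a j)) +
        (mconst (f ^ (N + M)) *s w - ?comb (\<lambda>j. f ^ N * a' j))"
      by (simp only: comb_add[symmetric] Modules.module.scale_right_distrib[OF mod])
        (simp only: algebra_simps)
    with K_add[OF v' w']
    have "mconst (f ^ (N + M)) *s (v + w) - ?comb (\<lambda>j. f ^ M * a j + f ^ N * a' j) \<in> K"
      by simp
    then show ?case
      using v(2) w(2)
      by (intro exI[of _ "N + M"] exI[of _ "\<lambda>j. f ^ M * a j + f ^ N * a' j"])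
        (simp add: mpoly_eval_add mpoly_eval_mult)
  qed
  have indep: "a j = 0" if a: "(\<Sum>j<d. mconst (a j) *s ?b j) \<in> family_fibre p K" and j: "j < d" for a j
  proof -
    let ?a = "\<lambda>j. mconst (a j) :: (nat, complex) mpoly"
    obtain k where k: "k \<in> K" "specialize p (?comb ?a) = specialize p k"
      using a unfolding comb_ev mpoly_eval_mconst family_fibre_def by auto
    then have "specialize p (?comb ?a - k) = 0"
      by (simp add: specialize_diff)
    then obtain N c where c: "mconst (f ^ N) *s (?comb ?a - k) - ?comb c \<in> K" "\<forall>j<d. ?ev (c j) = 0"
      using ker by blast
    have "?comb (\<lambda>j. f ^ N * ?a j - c j) =
        (mconst (f ^ N) *s (?comb ?a - k) - ?comb c) + mconst (f ^ N) *s k"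
      by (simp only: comb_diff[symmetric] comb_scale[symmetric]
          Modules.module.scale_right_diff_distrib[OF mod]) (simp only: algebra_simps)
    also have "\<dots> \<in> K"
      by (intro K_add K_scale c k)
    finally have "?comb (\<lambda>j. f ^ N * ?a j - c j) \<in> K" .
    from b(2)[OF this j] obtain M where "f ^ M * (f ^ N * ?a j - c j) \<in> I"
      by blast
    from evI[OF this] show ?thesis
      using f(1) c(2) j
      by (simp add: mpoly_eval_mult mpoly_eval_diff mpoly_eval_power mpoly_eval_mconst)
  qed
  have "\<forall>w. \<exists>a. w - (\<Sum>j<d. mconst (a j) *s ?b j) \<in> family_fibre p K"
    using span by (rule allI)
  moreover have "\<forall>a. (\<Sum>j<d. mconst (a j) *s ?b j) \<in> family_fibre p K \<longrightarrow> (\<forall>j<d. a j = 0)"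
    using indep by simp
  ultimately have "\<exists>b :: nat \<Rightarrow> ('n, complex) mpoly ^ 'r.
      (\<forall>w. \<exists>a. w - (\<Sum>j<d. mconst (a j) *s b j) \<in> family_fibre p K) \<and>
      (\<forall>a. (\<Sum>j<d. mconst (a j) *s b j) \<in> family_fibre p K \<longrightarrow> (\<forall>j<d. a j = 0))"
    by (intro exI[of _ ?b] conjI)
  with sub' show ?thesis
    unfolding quot_points_def quot_functor_field by (rule conjI)
qed

lemma topspace_quot_space:
  "topspace (quot_space d :: (('n::finite, complex) mpoly ^ 'r::finite) set topology) = quot_points d"
proof -
  have *: "{p \<in> zero_locus I. family_fibre p K \<in> quot_points d} = zero_locus I"
    if "K \<in> quot_functor d I" for I and K :: "(('n, (nat, complex) mpoly) mpoly ^ 'r) set"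
    using family_fibre_in_quot_points[OF that] by auto
  have "quot_open d (quot_points d :: (('n, complex) mpoly ^ 'r) set set)"
    unfolding quot_open_def by (auto simp: *)
  then show ?thesis
    unfolding topspace_def openin_quot_space by (auto simp: quot_open_def)
qed

end

theory Submission
  imports Defs
begin

text \<open>Let \<open>F\<close> be a quotient of length two.  Among the classes of the standard basis vectors \<open>e\<^sub>i\<close>
  and of the vectors \<open>x\<^sub>j e\<^sub>i\<close>, either two vectors \<open>e\<^sub>i, e\<^sub>k\<close> or two vectors \<open>e\<^sub>i, x\<^sub>j e\<^sub>i\<close> form a
  basis of \<open>F\<close>.  Each choice of such a pair defines an open chart: in the first case a product of an
  affine space with the cone of \<open>n\<close>-tuples of commuting \<open>2 \<times> 2\<close> matrices, in the second case an affine
  space, as then all \<open>x\<^sub>k\<close> act by polynomials in \<open>x\<^sub>j\<close>.  Order the pairs of the first kind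
  lexicographically, followed by the pairs of the second kind.  The part of a chart that is not covered
  by the earlier charts is the zero set of some of its linear coordinates, and contracting the other
  coordinates shows that the chart relative to the earlier ones has the homology of
  \<open>(\<complex>\<^sup>m, \<complex>\<^sup>m - 0)\<close>, where \<open>m = i + k - 1\<close> or \<open>m = r - 1 + i + j\<close> (all indices start at \<open>0\<close>).  These
  groups live in even degrees, so the long exact sequences split, and the homology is free with one
  generator of degree \<open>2m\<close> for each pair; as it is free, the cohomology has the same ranks.  Finally,
  for \<open>m \<le> n + r - 2\<close> the pairs with a given \<open>m\<close> correspond to the monomials \<open>x\<^sub>1\<^sup>a x\<^sub>2\<^sup>b\<close> with
  \<open>a + 2b = m\<close> and \<open>b < r\<close>, via \<open>b = i\<close>.\<close>

section \<open>Rank of abelian groups\<close>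

text \<open>The commuting n-tuples of \<open>2 \<times> 2\<close> matrices form a singular variety
  for n \<ge> 2, so Poincare duality and Thom isomorphisms for smooth strata are out of reach.
  Homogeneity of the equations replaces smoothness: the singular directions are contracted by
  scaling, while the linear coordinates that cut out the new part of a chart are left alone. The
  topology is defined by testing on all families, whereas homology computations need concrete
  spaces. Identifying a chart with a subset of an affine space therefore takes two arguments:
  coordinates are continuous on an arbitrary family, and the chart carries a family of its own, so
  that open sets of the Quot scheme are open in the affine picture. The bound n + r - 2 arises
  because the pairs of the second kind run out of variables: for m = n + r - 1 the monomial x1^m
  would ask for j = n.\<close>

lemma int_linear_dependence:
  fixes v :: "'t \<Rightarrow> 's \<Rightarrow> int"
  assumes "finite S" "finite T" "card S < card T"
  shows "\<exists>c. (\<exists>t\<in>T. c t \<noteq> 0) \<and> (\<forall>s\<in>S. (\<Sum>t\<in>T. c t * v t s) = 0)"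
  using assms
proof (induction S arbitrary: T v rule: finite_induct)
  case empty
  then have "T \<noteq> {}" by auto
  then show ?case by (intro exI[of _ "\<lambda>_. 1"]) auto
next
  case (insert s S)
  show ?case
  proof (cases "\<forall>t\<in>T. v t s = 0")
    case True
    obtain c where "\<exists>t\<in>T. c t \<noteq> 0" "\<forall>u\<in>S. (\<Sum>t\<in>T. c t * v t u) = 0"
      using insert.IH[of T v] insert.prems insert.hyps by (metis Suc_lessD card_insert_disjoint)
    then show ?thesis using True by (intro exI[of _ c]) auto
  next
    case False
    then obtain t0 where t0: "t0 \<in> T" "v t0 s \<noteq> 0" by auto
    define T' where "T' = T - {t0}"
    have T': "finite T'" "card S < card T'" "T = insert t0 T'" "t0 \<notin> T'"
      using insert t0 by (auto simp: T'_def)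
    obtain c where c: "\<exists>t\<in>T'. c t \<noteq> 0"
      "\<And>u. u \<in> S \<Longrightarrow> (\<Sum>t\<in>T'. c t * (v t0 s * v t u - v t s * v t0 u)) = 0"
      using insert.IH[of T' "\<lambda>t u. v t0 s * v t u - v t s * v t0 u"] T' by auto
    \<comment> \<open>Fraction-free elimination with pivot \<open>v t0 s\<close>: multiplying the
      other coefficients by the pivot avoids division, and the coefficient of \<open>t0\<close> is
      the one that then cancels coordinate \<open>s\<close>.\<close>
    define d where "d t = (if t = t0 then - (\<Sum>t\<in>T'. c t * v t s) else v t0 s * c t)" for t
    have eq: "(\<Sum>t\<in>T. d t * v t u) = (\<Sum>t\<in>T'. c t * (v t0 s * v t u - v t s * v t0 u))" for u
    proof -
      have "(\<Sum>t\<in>T'. d t * v t u) = (\<Sum>t\<in>T'. v t0 s * c t * v t u)"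
        using T'(4) by (intro sum.cong) (auto simp: d_def)
      moreover have "d t0 * v t0 u = - (\<Sum>t\<in>T'. c t * v t s * v t0 u)"
        by (simp add: d_def sum_distrib_right)
      ultimately have "(\<Sum>t\<in>T. d t * v t u) = (\<Sum>t\<in>T'. v t0 s * c t * v t u) - (\<Sum>t\<in>T'. c t * v t s * v t0 u)"
        using T' by simp
      then show ?thesis
        by (simp add: algebra_simps flip: sum_subtractf)
    qed
    have "(\<Sum>t\<in>T. d t * v t s) = 0" unfolding eq by (simp add: mult.commute)
    moreover have "\<exists>t\<in>T. d t \<noteq> 0" using c(1) T' t0 by (auto simp: d_def)
    ultimately show ?thesis using c(2) by (intro exI[of _ d]) (auto simp: eq)
  qed
qed

text \<open>\<open>h\<close> plays the role of an isomorphism onto \<int>^S. Injectivity turns a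
  relation between coordinate vectors into one in \<open>G\<close>, which bounds the rank above;
  preimages of the unit vectors are independent, which bounds it below.\<close>

lemma abelian_rank_eqI:
  fixes h :: "'g \<Rightarrow> 's \<Rightarrow> int"
  assumes G: "comm_group G" and S: "finite S"
    and add: "\<And>x y s. x \<in> carrier G \<Longrightarrow> y \<in> carrier G \<Longrightarrow> s \<in> S \<Longrightarrow> h (x \<otimes>\<^bsub>G\<^esub> y) s = h x s + h y s"
    and inj: "\<And>x. x \<in> carrier G \<Longrightarrow> (\<And>s. s \<in> S \<Longrightarrow> h x s = 0) \<Longrightarrow> x = \<one>\<^bsub>G\<^esub>"
    and unit: "\<And>s. s \<in> S \<Longrightarrow> \<exists>x\<in>carrier G. \<forall>t\<in>S. h x t = (if t = s then 1 else 0)"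
  shows "abelian_rank G = card S"
proof -
  interpret comm_group G by (rule G)
  have h1: "h \<one>\<^bsub>G\<^esub> s = 0" if "s \<in> S" for s
    using add[of "\<one>\<^bsub>G\<^esub>" "\<one>\<^bsub>G\<^esub>" s] that by simp
  have hinv: "h (inv\<^bsub>G\<^esub> x) s = - h x s" if "x \<in> carrier G" "s \<in> S" for x s
    using add[of x "inv\<^bsub>G\<^esub> x" s] that h1 by simp
  have hnat: "h (x [^]\<^bsub>G\<^esub> (k::nat)) s = int k * h x s" if "x \<in> carrier G" "s \<in> S" for x s k
    using that by (induction k) (auto simp: h1 add algebra_simps)
  have hpow: "h (x [^]\<^bsub>G\<^esub> (k::int)) s = k * h x s" if "x \<in> carrier G" "s \<in> S" for x s k
    using that by (cases k rule: int_cases2) (auto simp: int_pow_int int_pow_neg hnat hinv)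
  have hprod: "h (finprod G f A) s = (\<Sum>a\<in>A. h (f a) s)"
    if "finite A" "f \<in> A \<rightarrow> carrier G" "s \<in> S" for f and A :: "'g set" and s
    using that by (induction A rule: finite_induct) (auto simp: h1 add Pi_def)
  have hcomb: "h (finprod G (\<lambda>x. x [^]\<^bsub>G\<^esub> c x) T) s = (\<Sum>x\<in>T. c x * h x s)"
    if "finite T" "T \<subseteq> carrier G" "s \<in> S" for c :: "'g \<Rightarrow> int" and T s
    using that by (subst hprod) (auto intro!: sum.cong simp: hpow)
  have upper: "card T \<le> card S" if T: "int_independent G T" for T
  proof (rule ccontr)
    assume "\<not> card T \<le> card S"
    then obtain c where c: "\<exists>t\<in>T. c t \<noteq> 0" "\<forall>s\<in>S. (\<Sum>t\<in>T. c t * h t s) = 0"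
      using int_linear_dependence[of S T h] S T unfolding int_independent_def by auto
    have "finprod G (\<lambda>x. x [^]\<^bsub>G\<^esub> c x) T = \<one>\<^bsub>G\<^esub>"
      using T c by (intro inj) (auto simp: int_independent_def hcomb subset_eq intro!: finprod_closed)
    with T c(1) show False unfolding int_independent_def by blast
  qed
  obtain e where e: "\<And>s. s \<in> S \<Longrightarrow> e s \<in> carrier G"
    "\<And>s t. s \<in> S \<Longrightarrow> t \<in> S \<Longrightarrow> h (e s) t = (if t = s then 1 else 0)"
    using bchoice[of S "\<lambda>s x. x \<in> carrier G \<and> (\<forall>t\<in>S. h x t = (if t = s then 1 else 0))"] unit
    by (metis (no_types, lifting))
  have inj_e: "inj_on e S"
    using e(2) by (intro inj_onI) (metis zero_neq_one)
  have "int_independent G (e ` S)"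
    unfolding int_independent_def
  proof (intro conjI allI impI ballI)
    fix c :: "'g \<Rightarrow> int" and x
    assume "finprod G (\<lambda>x. x [^]\<^bsub>G\<^esub> c x) (e ` S) = \<one>\<^bsub>G\<^esub>" "x \<in> e ` S"
    then obtain s where s: "s \<in> S" "x = e s" by auto
    have "0 = (\<Sum>x\<in>e ` S. c x * h x s)"
      using hcomb[of "e ` S" s c] h1[OF s(1)] S e s \<open>finprod _ _ _ = _\<close> by auto
    also have "\<dots> = (\<Sum>t\<in>S. c (e t) * h (e t) s)"
      using inj_e by (simp add: sum.reindex)
    also have "\<dots> = (\<Sum>t\<in>S. if t = s then c (e s) else 0)"
      using e(2) s by (intro sum.cong) auto
    finally show "c x = 0" using s S by simp
  qed (use S e in auto)
  moreover have "card (e ` S) = card S" by (rule card_image[OF inj_e])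
  ultimately show ?thesis
    unfolding abelian_rank_def
    by (intro antisym SUP_least SUP_upper2[of "e ` S"]) (auto intro: upper)
qed

text \<open>Here the coordinates live on \<open>A\<close> and have kernel exactly \<open>B\<close>;
  this makes \<open>B\<close> a subgroup and lets \<open>k\<close> descend to the quotient. Cocycles
  modulo coboundaries are the intended case.\<close>

lemma abelian_rank_Mod_eqI:
  fixes k :: "'g \<Rightarrow> 's \<Rightarrow> int"
  assumes A: "comm_group A" and B_sub: "B \<subseteq> carrier A" and S: "finite S"
    and add: "\<And>x y s. x \<in> carrier A \<Longrightarrow> y \<in> carrier A \<Longrightarrow> s \<in> S \<Longrightarrow> k (x \<otimes>\<^bsub>A\<^esub> y) s = k x s + k y s"
    and ker: "\<And>x. x \<in> carrier A \<Longrightarrow> x \<in> B \<longleftrightarrow> (\<forall>s\<in>S. k x s = 0)"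
    and unit: "\<And>s. s \<in> S \<Longrightarrow> \<exists>x\<in>carrier A. \<forall>t\<in>S. k x t = (if t = s then 1 else 0)"
  shows "abelian_rank (A Mod B) = card S"
proof -
  interpret comm_group A by (rule A)
  have k1: "k \<one>\<^bsub>A\<^esub> s = 0" if "s \<in> S" for s
    using add[of "\<one>\<^bsub>A\<^esub>" "\<one>\<^bsub>A\<^esub>" s] that by simp
  have kinv: "k (inv\<^bsub>A\<^esub> x) s = - k x s" if "x \<in> carrier A" "s \<in> S" for x s
    using add[of x "inv\<^bsub>A\<^esub> x" s] that k1 by simp
  have B: "subgroup B A"
  proof (rule subgroupI)
    show "B \<noteq> {}" using ker[of "\<one>\<^bsub>A\<^esub>"] k1 by auto
    show "inv\<^bsub>A\<^esub> a \<in> B" if "a \<in> B" for a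
      using that B_sub ker[of a] ker[of "inv\<^bsub>A\<^esub> a"] by (auto simp: kinv)
    show "a \<otimes>\<^bsub>A\<^esub> b \<in> B" if "a \<in> B" "b \<in> B" for a b
      using that B_sub ker[of a] ker[of b] ker[of "a \<otimes>\<^bsub>A\<^esub> b"] by (auto simp: add subset_eq)
  qed (rule B_sub)
  interpret N: normal B A using A B by (simp add: comm_group.normal_iff_subgroup)
  have k_coset: "k y s = k x s" if "x \<in> carrier A" and y: "y \<in> B #>\<^bsub>A\<^esub> x" and "s \<in> S" for x y s
  proof -
    obtain b where b: "b \<in> B" "y = b \<otimes>\<^bsub>A\<^esub> x" using y unfolding r_coset_def by blast
    then have "b \<in> carrier A" using N.subset by auto
    then show ?thesis using b that(1,3) add ker[of b] by simp
  qed
  \<comment> \<open>A coset is read off through an arbitrary representative, on which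
    \<open>k\<close> does not depend by \<open>k_coset\<close>.\<close>
  define h where "h C = k (SOME x. x \<in> C)" for C
  have h: "h (B #>\<^bsub>A\<^esub> x) s = k x s" if "x \<in> carrier A" "s \<in> S" for x s
  proof -
    have "x \<in> B #>\<^bsub>A\<^esub> x" using that rcos_self[OF _ B] by simp
    then have "(SOME y. y \<in> B #>\<^bsub>A\<^esub> x) \<in> B #>\<^bsub>A\<^esub> x" by (rule someI)
    then show ?thesis unfolding h_def by (intro k_coset that)
  qed
  have car: "carrier (A Mod B) = (\<lambda>x. B #>\<^bsub>A\<^esub> x) ` carrier A"
    by (auto simp: FactGroup_def RCOSETS_def)
  show ?thesis
  proof (rule abelian_rank_eqI[where h = h and S = S])
    show "comm_group (A Mod B)" using A B by (rule comm_group.abelian_FactGroup)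
    show "h (x \<otimes>\<^bsub>A Mod B\<^esub> y) s = h x s + h y s"
      if "x \<in> carrier (A Mod B)" "y \<in> carrier (A Mod B)" "s \<in> S" for x y s
      using that unfolding car by (auto simp: N.rcos_sum h add)
    show "x = \<one>\<^bsub>A Mod B\<^esub>" if "x \<in> carrier (A Mod B)" "\<And>s. s \<in> S \<Longrightarrow> h x s = 0" for x
    proof -
      obtain y where y: "y \<in> carrier A" "x = B #>\<^bsub>A\<^esub> y" using \<open>x \<in> _\<close> unfolding car by auto
      then have "y \<in> B" using that(2) by (simp add: h ker)
      then show ?thesis using y N.rcos_const[OF is_group] by (simp add: FactGroup_def)
    qed
    show "\<exists>x\<in>carrier (A Mod B). \<forall>t\<in>S. h x t = (if t = s then 1 else 0)" if "s \<in> S" for s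
      using unit[OF that] unfolding car by (auto simp: h)
  qed (rule S)
qed

section \<open>Cohomology of spaces with free homology\<close>

abbreviation cycle :: "nat \<Rightarrow> 'a topology \<Rightarrow> 'a chain \<Rightarrow> bool" where
  "cycle p T \<equiv> singular_relcycle p T {}"

abbreviation boundary :: "nat \<Rightarrow> 'a topology \<Rightarrow> 'a chain \<Rightarrow> bool" where
  "boundary p T \<equiv> singular_relboundary p T {}"

text \<open>The classes of the \<open>z s\<close> form a \<int>-basis of the homology. This is
  phrased with chains, since cochains are evaluated on the cycles \<open>z s\<close>
  themselves.\<close>

definition homology_basis :: "nat \<Rightarrow> 'a topology \<Rightarrow> 's set \<Rightarrow> ('s \<Rightarrow> 'a chain) \<Rightarrow> bool" where
  "homology_basis p T S z \<longleftrightarrow> finite S \<and> (\<forall>s\<in>S. cycle p T (z s)) \<and>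
     (\<forall>c. cycle p T c \<longrightarrow> (\<exists>!n. Poly_Mapping.keys n \<subseteq> S \<and> boundary p T (c - frag_extend z n)))"

text \<open>A retraction of the chains onto the cycles. Composing with it extends a homomorphism on
  cycles to a cochain.\<close>

definition cycle_projection :: "nat \<Rightarrow> 'a topology \<Rightarrow> ('a chain \<Rightarrow> 'a chain) \<Rightarrow> bool" where
  "cycle_projection p T \<pi> \<longleftrightarrow>
     (\<forall>c d. singular_chain p T c \<longrightarrow> singular_chain p T d \<longrightarrow> \<pi> (c - d) = \<pi> c - \<pi> d) \<and>
     (\<forall>c. singular_chain p T c \<longrightarrow> cycle p T (\<pi> c)) \<and> (\<forall>c. cycle p T c \<longrightarrow> \<pi> c = c)"

text \<open>A boundary lift splits the boundary map onto the boundaries.  It exists as the boundaries form a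
  free group, but when the homology in lower degrees is free, it can be built degree by degree
  without the theorem on subgroups of free abelian groups.\<close>

definition boundary_lift :: "nat \<Rightarrow> 'a topology \<Rightarrow> ('a chain \<Rightarrow> 'a chain) \<Rightarrow> bool" where
  "boundary_lift p T L \<longleftrightarrow> (\<forall>c d. L (c - d) = L c - L d) \<and>
     (\<forall>c. singular_chain p T c \<longrightarrow> singular_chain (Suc p) T (L c)) \<and>
     (\<forall>c. boundary p T c \<longrightarrow> chain_boundary (Suc p) (L c) = c)"

lemma cycle_projection_0: "cycle_projection 0 T (\<lambda>c. c)"
  by (simp add: cycle_projection_def singular_cycle chain_boundary_def)

text \<open>\<open>L\<close> is a right inverse of the boundary map on boundaries, so the subtracted
  term has the same boundary as \<open>c\<close>; cycles are fixed because
  \<open>L 0 = 0\<close>.\<close>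

lemma cycle_projection_Suc:
  assumes "boundary_lift p T L"
  shows "cycle_projection (Suc p) T (\<lambda>c. c - L (chain_boundary (Suc p) c))"
proof -
  have d: "L (c - d) = L c - L d" for c d using assms by (simp add: boundary_lift_def)
  have 0: "L 0 = 0" using d[of 0 0] by simp
  have b: "boundary p T (chain_boundary (Suc p) c)" if "singular_chain (Suc p) T c" for c
    using that by (auto simp: singular_boundary)
  show ?thesis
    using assms b unfolding cycle_projection_def
    by (auto simp: d 0 chain_boundary_diff singular_cycle boundary_lift_def
        intro!: singular_chain_diff singular_chain_boundary_alt)
qed

definition homology_coord :: "nat \<Rightarrow> 'a topology \<Rightarrow> 's set \<Rightarrow> ('s \<Rightarrow> 'a chain) \<Rightarrow> 'a chain \<Rightarrow> 's \<Rightarrow>\<^sub>0 int" where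
  "homology_coord p T S z c = (THE n. Poly_Mapping.keys n \<subseteq> S \<and> boundary p T (c - frag_extend z n))"

lemma homology_coord:
  assumes "homology_basis p T S z" "cycle p T c"
  shows "Poly_Mapping.keys (homology_coord p T S z c) \<subseteq> S"
    and "boundary p T (c - frag_extend z (homology_coord p T S z c))"
proof -
  have "\<exists>!n. Poly_Mapping.keys n \<subseteq> S \<and> boundary p T (c - frag_extend z n)"
    using assms by (simp add: homology_basis_def)
  from theI'[OF this] show "Poly_Mapping.keys (homology_coord p T S z c) \<subseteq> S"
    and "boundary p T (c - frag_extend z (homology_coord p T S z c))"
    unfolding homology_coord_def by auto
qed

lemma homology_coord_eqI:
  assumes "homology_basis p T S z" "cycle p T c"
    "Poly_Mapping.keys n \<subseteq> S" "boundary p T (c - frag_extend z n)"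
  shows "homology_coord p T S z c = n"
  using assms homology_coord[OF assms(1,2)] unfolding homology_basis_def by blast

lemma homology_coord_diff:
  assumes H: "homology_basis p T S z" "cycle p T c" "cycle p T d"
  shows "homology_coord p T S z (c - d) = homology_coord p T S z c - homology_coord p T S z d"
proof (rule homology_coord_eqI[OF H(1)])
  let ?n = "homology_coord p T S z"
  show "cycle p T (c - d)" using H by (simp add: singular_relcycle_diff)
  show "Poly_Mapping.keys (?n c - ?n d) \<subseteq> S"
    using homology_coord(1)[OF H(1,2)] homology_coord(1)[OF H(1,3)] keys_diff[of "?n c" "?n d"] by blast
  have "boundary p T ((c - frag_extend z (?n c)) - (d - frag_extend z (?n d)))"
    by (intro singular_relboundary_diff homology_coord H)
  then show "boundary p T (c - d - frag_extend z (?n c - ?n d))"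
    by (simp add: frag_extend_diff algebra_simps)
qed

lemma homology_coord_boundary:
  assumes H: "homology_basis p T S z" "boundary p T c"
  shows "homology_coord p T S z c = 0"
  using H by (intro homology_coord_eqI) (auto intro: singular_relboundary_imp_relcycle)

lemma homology_coord_basis:
  assumes H: "homology_basis p T S z" "s \<in> S"
  shows "homology_coord p T S z (z s) = frag_of s"
  using H by (intro homology_coord_eqI) (auto simp: homology_basis_def)

lemma cycle_frag_extend:
  assumes "homology_basis p T S z" "Poly_Mapping.keys n \<subseteq> S"
  shows "cycle p T (frag_extend z n)"
  using assms unfolding frag_extend_def homology_basis_def
  by (intro singular_relcycle_sum singular_relcycle_cmul) auto

text \<open>\<open>\<rho>\<close> projects chains to cycles and then removes the combination of
  basis cycles that represents the homology class, so it retracts the chains onto the boundaries. As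
  chains are free on the simplices, a lift of \<open>\<rho>\<close> chosen for each simplex extends
  to \<open>L\<close>.\<close>

lemma boundary_lift_exists:
  assumes H: "homology_basis p T S z" and P: "cycle_projection p T \<pi>"
  shows "\<exists>L. boundary_lift p T L"
proof -
  let ?n = "homology_coord p T S z"
  define \<rho> where "\<rho> c = \<pi> c - frag_extend z (?n (\<pi> c))" for c
  have \<pi>: "\<And>c d. singular_chain p T c \<Longrightarrow> singular_chain p T d \<Longrightarrow> \<pi> (c - d) = \<pi> c - \<pi> d"
    "\<And>c. singular_chain p T c \<Longrightarrow> cycle p T (\<pi> c)"
    using P unfolding cycle_projection_def by auto
  have \<rho>_bd: "boundary p T (\<rho> c)" if "singular_chain p T c" for c
    unfolding \<rho>_def by (intro homology_coord H \<pi> that)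
  have \<rho>_diff: "\<rho> (c - d) = \<rho> c - \<rho> d" if "singular_chain p T c" "singular_chain p T d" for c d
    using that unfolding \<rho>_def by (simp add: \<pi> homology_coord_diff[OF H] frag_extend_diff)
  have \<rho>_0: "\<rho> 0 = 0" using \<rho>_diff[of 0 0] by simp
  have \<rho>_id: "\<rho> b = b" if "boundary p T b" for b
    using that P homology_coord_boundary[OF H that] singular_relboundary_imp_relcycle[OF that]
    unfolding \<rho>_def cycle_projection_def by simp
  define l where "l \<sigma> = (SOME d. singular_chain (Suc p) T d \<and> chain_boundary (Suc p) d = \<rho> (frag_of \<sigma>))" for \<sigma>
  have l: "singular_chain (Suc p) T (l \<sigma>)" "chain_boundary (Suc p) (l \<sigma>) = \<rho> (frag_of \<sigma>)"
    if "singular_simplex p T \<sigma>" for \<sigma>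
  proof -
    have "\<exists>d. singular_chain (Suc p) T d \<and> chain_boundary (Suc p) d = \<rho> (frag_of \<sigma>)"
      using \<rho>_bd[of "frag_of \<sigma>"] that by (simp add: singular_chain_of singular_boundary)
    from someI_ex[OF this]
    show "singular_chain (Suc p) T (l \<sigma>)" "chain_boundary (Suc p) (l \<sigma>) = \<rho> (frag_of \<sigma>)"
      unfolding l_def by auto
  qed
  have bd: "chain_boundary (Suc p) (frag_extend l c) = \<rho> c" if "singular_chain p T c" for c
  proof -
    have "Poly_Mapping.keys c \<subseteq> singular_simplex_set p T" using that by (simp add: singular_chain_def)
    then show ?thesis
    proof (induction c rule: free_Abelian_group_induct[consumes 1, case_names zero diff gen])
      case (diff x y)
      then show ?case
        by (simp add: frag_extend_diff chain_boundary_diff \<rho>_diff singular_chain_def)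
    qed (auto simp: l \<rho>_0)
  qed
  have "chain_boundary (Suc p) (frag_extend l c) = c" if "boundary p T c" for c
    using bd[OF singular_relboundary_imp_chain[OF that]] \<rho>_id[OF that] by simp
  then have "boundary_lift p T (frag_extend l)"
    unfolding boundary_lift_def
    by (auto simp: frag_extend_diff singular_chain_def[of p] intro!: singular_chain_extend l)
  then show ?thesis by blast
qed

text \<open>A projection in degree \<open>p\<close> gives a boundary lift in degree
  \<open>p\<close>, and this gives a projection in degree \<open>p + 1\<close>; so bases are used
  strictly below the target degree.\<close>

lemma cycle_projection_exists:
  assumes "\<And>q. q < p \<Longrightarrow> \<exists>(S :: 's set) z. homology_basis q T S z"
  shows "\<exists>\<pi>. cycle_projection p T \<pi>"
  using assms
proof (induction p)
  case 0
  show ?case using cycle_projection_0 by blast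
next
  case (Suc p)
  then obtain \<pi> and S :: "'s set" and z where "cycle_projection p T \<pi>" "homology_basis p T S z"
    by (metis less_Suc_eq)
  then show ?case using boundary_lift_exists cycle_projection_Suc by blast
qed

section \<open>Cochains, and cohomology as the dual of free homology\<close>

lemma cochain_simps:
  "f \<in> carrier (cochain_group p T) \<longleftrightarrow> f \<in> extensional (singular_chain_set p T) \<and>
     (\<forall>c d. singular_chain p T c \<longrightarrow> singular_chain p T d \<longrightarrow> f (c + d) = f c + f d)"
  "f \<otimes>\<^bsub>cochain_group p T\<^esub> g = (\<lambda>c\<in>singular_chain_set p T. f c + g c)"
  "\<one>\<^bsub>cochain_group p T\<^esub> = (\<lambda>c\<in>singular_chain_set p T. 0)"
  by (auto simp: cochain_group_def hom_def integer_group_def)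

lemma comm_group_cochain_group: "comm_group (cochain_group p T)"
proof (rule comm_groupI)
  show "\<exists>y\<in>carrier (cochain_group p T). y \<otimes>\<^bsub>cochain_group p T\<^esub> x = \<one>\<^bsub>cochain_group p T\<^esub>"
    if "x \<in> carrier (cochain_group p T)" for x
    by (rule bexI[of _ "\<lambda>c\<in>singular_chain_set p T. - x c"])
      (use that in \<open>auto simp: cochain_simps singular_chain_add\<close>)
qed (auto simp: cochain_simps singular_chain_add fun_eq_iff extensional_def)

lemma cochain_diff:
  assumes "f \<in> carrier (cochain_group p T)" "singular_chain p T c" "singular_chain p T d"
  shows "f (c - d) = f c - f d"
  using assms singular_chain_diff[OF assms(2,3)] unfolding cochain_simps
  by (metis add_diff_cancel_right' diff_add_cancel)

lemma cochain_0: "f \<in> carrier (cochain_group p T) \<Longrightarrow> f 0 = 0"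
  using cochain_diff[of f p T 0 0] by simp

lemma cocycle_set_iff:
  "f \<in> cocycle_set p T \<longleftrightarrow> f \<in> carrier (cochain_group p T) \<and> (\<forall>c. boundary p T c \<longrightarrow> f c = 0)"
  by (auto simp: cocycle_set_def kernel_def cochain_coboundary_def cochain_simps(3) singular_boundary
      fun_eq_iff restrict_def)

lemma subgroup_cocycle_set: "subgroup (cocycle_set p T) (cochain_group p T)"
proof -
  interpret comm_group "cochain_group p T" by (rule comm_group_cochain_group)
  have inv: "(inv\<^bsub>cochain_group p T\<^esub> f) c = - f c" if f: "f \<in> carrier (cochain_group p T)" "singular_chain p T c" for f c
  proof -
    have "(inv\<^bsub>cochain_group p T\<^esub> f \<otimes>\<^bsub>cochain_group p T\<^esub> f) c = \<one>\<^bsub>cochain_group p T\<^esub> c"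
      using l_inv[OF f(1)] by simp
    then show ?thesis using f(2) by (simp add: cochain_simps)
  qed
  show ?thesis
  proof (rule subgroupI)
    have "\<one>\<^bsub>cochain_group p T\<^esub> \<in> cocycle_set p T"
      using one_closed unfolding cocycle_set_iff
      by (simp add: cochain_simps(3) singular_relboundary_imp_chain)
    then show "cocycle_set p T \<noteq> {}" by blast
    show "inv\<^bsub>cochain_group p T\<^esub> f \<in> cocycle_set p T" if "f \<in> cocycle_set p T" for f
      using that by (auto simp: cocycle_set_iff inv singular_relboundary_imp_chain)
    show "f \<otimes>\<^bsub>cochain_group p T\<^esub> g \<in> cocycle_set p T" if "f \<in> cocycle_set p T" "g \<in> cocycle_set p T" for f g
      using that m_closed[of f g] by (auto simp: cocycle_set_iff cochain_simps(2) singular_relboundary_imp_chain)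
  qed (auto simp: cocycle_set_iff)
qed

text \<open>Evaluation on the basis cycles maps cocycles to \<int>^S. Its kernel consists of
  coboundaries, since a cochain that vanishes on all cycles factors through the boundary map; it is
  onto, since coordinates of homology classes extend to cochains by a cycle projection. This is the
  universal coefficient theorem in the absence of Ext terms.\<close>

theorem abelian_rank_cohomology:
  fixes T :: "'a topology" and S :: "'s set"
  assumes H: "\<And>q. q < p \<Longrightarrow> \<exists>(S :: 's set) z. homology_basis q T S z"
    and Hp: "homology_basis p T S z"
  shows "abelian_rank (singular_cohomology_group p T) = card S"
proof -
  let ?G = "cochain_group p T"
  obtain \<pi> where P: "cycle_projection p T \<pi>" using cycle_projection_exists[OF H] by blast
  have cyc_chain: "singular_chain p T c" if "cycle p T c" for c using that by (simp add: singular_cycle)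
  \<comment> \<open>Coboundaries are the cochains that vanish on cycles. In degree \<open>0\<close>
    all chains are cycles, which leaves only the zero cochain.\<close>
  have cob: "f \<in> coboundary_set p T \<longleftrightarrow> f \<in> carrier ?G \<and> (\<forall>c. cycle p T c \<longrightarrow> f c = 0)" for f
  proof (cases p)
    case 0
    have "cycle 0 T c \<longleftrightarrow> singular_chain 0 T c" for c
      by (simp add: singular_cycle chain_boundary_def)
    then show ?thesis
      by (auto simp: 0 coboundary_set_def cochain_simps fun_eq_iff extensional_def singular_chain_add)
  next
    case (Suc q)
    obtain L where L: "boundary_lift q T L"
    proof -
      obtain S' :: "'s set" and z' where "homology_basis q T S' z'" using H[of q] Suc by auto
      moreover obtain \<pi>' where "cycle_projection q T \<pi>'"
        using cycle_projection_exists[of q T] H Suc by (metis less_SucI)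
      ultimately show ?thesis using boundary_lift_exists that by blast
    qed
    have Ld: "L (c - d) = L c - L d" for c d using L by (simp add: boundary_lift_def)
    have La: "L (c + d) = L c + L d" for c d
      using Ld[of "c + d" d] by (simp add: algebra_simps)
    show ?thesis
    proof
      assume "f \<in> coboundary_set p T"
      then obtain g where g: "g \<in> carrier (cochain_group q T)" "f = cochain_coboundary q T g"
        by (auto simp: coboundary_set_def Suc)
      show "f \<in> carrier ?G \<and> (\<forall>c. cycle p T c \<longrightarrow> f c = 0)"
        using g(1) cochain_0[OF g(1)] unfolding g(2) cochain_coboundary_def Suc cochain_simps
        by (auto simp: singular_chain_add chain_boundary_add singular_chain_boundary_alt singular_cycle)
    next
      assume f: "f \<in> carrier ?G \<and> (\<forall>c. cycle p T c \<longrightarrow> f c = 0)"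
      \<comment> \<open>\<open>g\<close> has to be \<open>f\<close> after an inverse of the boundary
        map. As \<open>f\<close> vanishes on the cycle
        \<open>c - L (chain_boundary (Suc q) c)\<close>, the choices made by \<open>L\<close> do not
        affect the value.\<close>
      define g where "g = (\<lambda>b\<in>singular_chain_set q T. f (L b))"
      have "g \<in> carrier (cochain_group q T)"
        using f L unfolding g_def cochain_simps Suc boundary_lift_def
        by (auto simp: singular_chain_add La)
      moreover have "f = cochain_coboundary q T g"
      proof
        fix c
        show "f c = cochain_coboundary q T g c"
        proof (cases "singular_chain (Suc q) T c")
          case True
          then have c': "singular_chain q T (chain_boundary (Suc q) c)" by (rule singular_chain_boundary_alt)
          then have l: "singular_chain (Suc q) T (L (chain_boundary (Suc q) c))" using L by (simp add: boundary_lift_def)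
          have "cycle (Suc q) T (c - L (chain_boundary (Suc q) c))"
            using cycle_projection_Suc[OF L] True by (simp add: cycle_projection_def)
          then have "f (c - L (chain_boundary (Suc q) c)) = 0" using f Suc by simp
          then have "f c = f (L (chain_boundary (Suc q) c))"
            using cochain_diff[of f p T] f True l Suc by simp
          then show ?thesis using True c' by (simp add: cochain_coboundary_def g_def)
        qed (use f Suc in \<open>auto simp: cochain_coboundary_def cochain_simps extensional_def\<close>)
      qed
      ultimately show "f \<in> coboundary_set p T" by (auto simp: coboundary_set_def Suc)
    qed
  qed
  interpret comm_group ?G by (rule comm_group_cochain_group)
  have car: "carrier (subgroup_generated ?G (cocycle_set p T)) = cocycle_set p T"
    by (rule subgroup.carrier_subgroup_generated_subgroup[OF subgroup_cocycle_set])
  have mult: "f \<otimes>\<^bsub>subgroup_generated ?G (cocycle_set p T)\<^esub> g = f \<otimes>\<^bsub>?G\<^esub> g" for f g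
    by (simp add: subgroup_generated_def)
  have z: "cycle p T (z s)" "singular_chain p T (z s)" if "s \<in> S" for s
    using Hp that cyc_chain by (auto simp: homology_basis_def)
  have fin: "finite S" using Hp by (simp add: homology_basis_def)
  \<comment> \<open>A cocycle ignores boundaries, so on a cycle it depends only on the homology
    class, hence only on its values at the \<open>z s\<close>.\<close>
  have cyc0: "f c = 0" if f: "f \<in> cocycle_set p T" "\<forall>s\<in>S. f (z s) = 0" and c: "cycle p T c" for f c
  proof -
    let ?n = "homology_coord p T S z c"
    note n = homology_coord[OF Hp c]
    have "f (frag_extend z n) = 0" if "Poly_Mapping.keys n \<subseteq> S" for n
      using that
    proof (induction n rule: free_Abelian_group_induct[consumes 1, case_names zero diff gen])
      case (diff x y)
      then show ?case
        using f by (simp add: frag_extend_diff cochain_diff[where p = p and T = T] cocycle_set_iff cyc_chain cycle_frag_extend[OF Hp])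
    qed (use f cochain_0 in \<open>auto simp: cocycle_set_iff\<close>)
    moreover have "f (c - frag_extend z ?n) = 0"
      using f n by (simp add: cocycle_set_iff)
    ultimately show ?thesis
      using f n c by (simp add: cochain_diff[where p = p and T = T] cocycle_set_iff cyc_chain cycle_frag_extend[OF Hp])
  qed
  show ?thesis
    unfolding singular_cohomology_group_def
  proof (rule abelian_rank_Mod_eqI[where k = "\<lambda>f s. f (z s)"])
    show "comm_group (subgroup_generated ?G (cocycle_set p T))"
      by (rule abelian_subgroup_generated[OF comm_group_cochain_group])
    show "coboundary_set p T \<subseteq> carrier (subgroup_generated ?G (cocycle_set p T))"
      unfolding car by (auto simp: cob cocycle_set_iff singular_relboundary_imp_relcycle)
    show "f \<in> coboundary_set p T \<longleftrightarrow> (\<forall>s\<in>S. f (z s) = 0)"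
      if "f \<in> carrier (subgroup_generated ?G (cocycle_set p T))" for f
      using that cyc0[of f] z unfolding car by (auto simp: cob cocycle_set_iff)
    show "(f \<otimes>\<^bsub>subgroup_generated ?G (cocycle_set p T)\<^esub> g) (z s) = f (z s) + g (z s)" if "s \<in> S" for f g s
      using that z by (simp add: mult cochain_simps)
    show "\<exists>f\<in>carrier (subgroup_generated ?G (cocycle_set p T)). \<forall>t\<in>S. f (z t) = (if t = s then 1 else 0)"
      if s: "s \<in> S" for s
    proof
      \<comment> \<open>The cocycle dual to \<open>z s\<close>: \<open>\<pi>\<close> extends the
        coordinate of the homology class from cycles to all chains.\<close>
      define f where "f = (\<lambda>c\<in>singular_chain_set p T. Poly_Mapping.lookup (homology_coord p T S z (\<pi> c)) s)"
      have \<pi>: "cycle p T (\<pi> c)" if "singular_chain p T c" for c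
        using P that by (simp add: cycle_projection_def)
      have \<pi>d: "\<pi> (c - d) = \<pi> c - \<pi> d" if "singular_chain p T c" "singular_chain p T d" for c d
        using P that by (simp add: cycle_projection_def)
      have fd: "f (c - d) = f c - f d" if "singular_chain p T c" "singular_chain p T d" for c d
        using that by (simp add: f_def singular_chain_diff \<pi>d \<pi> homology_coord_diff[OF Hp] lookup_minus)
      have "f (c + d) = f c + f d" if "singular_chain p T c" "singular_chain p T d" for c d
        using fd[of "c + d" d] that by (simp add: singular_chain_add)
      moreover have "f b = 0" if "boundary p T b" for b
        using that P unfolding f_def
        by (simp add: singular_relboundary_imp_chain cycle_projection_def singular_relboundary_imp_relcycle
            homology_coord_boundary[OF Hp])
      ultimately show "f \<in> carrier (subgroup_generated ?G (cocycle_set p T))"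
        unfolding car cocycle_set_iff cochain_simps by (auto simp: f_def)
      show "\<forall>t\<in>S. f (z t) = (if t = s then 1 else 0)"
        using z P by (auto simp: f_def cycle_projection_def homology_coord_basis[OF Hp] lookup_frag_of)
    qed
  qed (rule fin)
qed

section \<open>Homology of spaces filtered by open cells\<close>

definition free_of_rank :: "('g, 'm) monoid_scheme \<Rightarrow> nat \<Rightarrow> bool" where
  "free_of_rank G k \<longleftrightarrow> G \<cong> free_Abelian_group {..<k}"

lemma free_of_rank_0:
  assumes "group G" shows "free_of_rank G 0 \<longleftrightarrow> trivial_group G"
proof -
  have "trivial_group (free_Abelian_group ({} :: nat set))"
    using group_free_Abelian_group[of "{} :: nat set"] by (auto simp: trivial_group_def)
  moreover have "G \<cong> H" if "trivial_group G" "trivial_group H" for H :: "(nat \<Rightarrow>\<^sub>0 int) monoid"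
  proof (rule is_isoI)
    show "(\<lambda>x. \<one>\<^bsub>H\<^esub>) \<in> iso G H"
      using that by (auto simp: trivial_group_def iso_iff hom_def group.is_monoid)
  qed
  ultimately show ?thesis
    unfolding free_of_rank_def using assms group_free_Abelian_group isomorphic_group_triviality
    by (metis lessThan_0)
qed

lemma free_of_rank_1: "free_of_rank G 1 \<longleftrightarrow> G \<cong> integer_group"
proof -
  have "{..<1::nat} = {0}" by auto
  then have "integer_group \<cong> free_Abelian_group {..<1::nat}"
    using isomorphic_group_integer_free_Abelian_group_singleton[of "0::nat"] by simp
  then show ?thesis
    unfolding free_of_rank_def
    by (meson group.iso_sym group_integer_group iso_trans)
qed

lemma free_of_rank_iso: "group G \<Longrightarrow> G \<cong> H \<Longrightarrow> free_of_rank G k \<longleftrightarrow> free_of_rank H k"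
  unfolding free_of_rank_def by (meson group.iso_sym iso_trans)

text \<open>Since \<open>C\<close> is infinite cyclic, the sequence splits: a preimage
  \<open>b\<close> of a generator supplies the additional basis element, which gets the index
  \<open>k\<close>.\<close>

lemma free_of_rank_extension:
  assumes B: "comm_group B" and A: "group A" and C: "group C"
    and f: "f \<in> hom A B" "inj_on f (carrier A)" and g: "g \<in> hom B C" "g ` carrier B = carrier C"
    and ex: "f ` carrier A = kernel B C g"
    and free: "free_of_rank A k" "free_of_rank C 1"
  shows "free_of_rank B (Suc k)"
proof -
  interpret B: comm_group B by (rule B)
  interpret A: group A by (rule A)
  interpret C: group C by (rule C)
  interpret f: group_hom A B f by (simp add: A B.is_group f group_hom_axioms.intro group_hom_def)
  interpret g: group_hom B C g by (simp add: C B.is_group g group_hom_axioms.intro group_hom_def)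
  let ?F = "free_Abelian_group {..<k}" and ?F' = "free_Abelian_group {..<Suc k}"
  obtain \<alpha> where \<alpha>: "\<alpha> \<in> iso ?F A"
    using free(1) A.iso_sym unfolding free_of_rank_def is_iso_def by blast
  obtain \<gamma> where \<gamma>: "\<gamma> \<in> iso C integer_group"
    using free(2) unfolding free_of_rank_1 is_iso_def by blast
  have \<alpha>h: "\<alpha> \<in> hom ?F A" and \<alpha>b: "bij_betw \<alpha> (carrier ?F) (carrier A)"
    using \<alpha> by (auto simp: iso_def)
  have \<gamma>h: "\<gamma> \<in> hom C integer_group" and \<gamma>b: "bij_betw \<gamma> (carrier C) UNIV"
    using \<gamma> by (auto simp: iso_def)
  interpret \<gamma>: group_hom C integer_group \<gamma>
    by (simp add: C \<gamma>h group_hom_axioms.intro group_hom_def)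
  have "1 \<in> \<gamma> ` g ` carrier B" using g(2) \<gamma>b by (simp add: bij_betw_def)
  then obtain b where b: "b \<in> carrier B" "\<gamma> (g b) = 1" by auto
  let ?n = "\<lambda>c :: nat \<Rightarrow>\<^sub>0 int. Poly_Mapping.lookup c k"
  \<comment> \<open>\<open>\<rho>\<close> deletes the coefficient at the new index \<open>k\<close>,
    so that \<open>\<alpha>\<close> can be applied to the rest.\<close>
  define \<rho> where "\<rho> c = c - frag_cmul (Poly_Mapping.lookup c k) (frag_of k)" for c
  have \<rho>_add: "\<rho> (c + d) = \<rho> c + \<rho> d" for c d
    by (simp add: \<rho>_def lookup_add frag_cmul_distrib algebra_simps)
  have \<rho>_car: "\<rho> c \<in> carrier ?F" if "c \<in> carrier ?F'" for c
  proof -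
    have "i \<notin> Poly_Mapping.keys (\<rho> c)" if "i \<ge> k" for i
      using that \<open>c \<in> _\<close> by (cases "i = k") (auto simp: \<rho>_def in_keys_iff lookup_minus lookup_frag_of lookup_frag_cmul subset_eq lessThan_Suc)
    then show ?thesis by (auto simp: not_le[symmetric])
  qed
  have \<rho>_id: "\<rho> c = c" "?n c = 0" if "c \<in> carrier ?F" for c
  proof -
    show "?n c = 0" using that by (auto simp: in_keys_iff subset_eq)
    then show "\<rho> c = c" by (simp add: \<rho>_def)
  qed
  define \<phi> where "\<phi> c = f (\<alpha> (\<rho> c)) \<otimes>\<^bsub>B\<^esub> b [^]\<^bsub>B\<^esub> ?n c" for c
  have \<alpha>_car: "\<alpha> c \<in> carrier A" if "c \<in> carrier ?F" for c
    using \<alpha>h that by (rule hom_in_carrier)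
  have gf: "g (f x) = \<one>\<^bsub>C\<^esub>" if "x \<in> carrier A" for x
    using ex that by (auto simp: kernel_def)
  have \<gamma>pow: "\<gamma> (g (b [^]\<^bsub>B\<^esub> (n::int))) = n" for n
    using b by (simp add: g.hom_int_pow \<gamma>.hom_int_pow)
  have \<gamma>\<phi>: "\<gamma> (g (\<phi> c)) = ?n c" if "c \<in> carrier ?F'" for c
    using that b \<rho>_car[OF that] by (simp add: \<phi>_def \<alpha>_car gf \<gamma>pow)
  have "\<phi> \<in> hom ?F' B"
  proof (rule homI)
    fix c d assume c: "c \<in> carrier ?F'" "d \<in> carrier ?F'"
    show "\<phi> c \<in> carrier B" using c b \<alpha>_car[OF \<rho>_car[OF c(1)]] by (simp add: \<phi>_def)
    have 1: "\<alpha> (\<rho> c + \<rho> d) = \<alpha> (\<rho> c) \<otimes>\<^bsub>A\<^esub> \<alpha> (\<rho> d)"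
      using hom_mult[OF \<alpha>h \<rho>_car[OF c(1)] \<rho>_car[OF c(2)]] by simp
    show "\<phi> (c \<otimes>\<^bsub>?F'\<^esub> d) = \<phi> c \<otimes>\<^bsub>B\<^esub> \<phi> d"
      using b \<alpha>_car[OF \<rho>_car[OF c(1)]] \<alpha>_car[OF \<rho>_car[OF c(2)]]
      by (simp add: \<phi>_def \<rho>_add 1 lookup_add B.int_pow_mult[symmetric] B.m_ac)
  qed
  then interpret \<phi>: group_hom ?F' B \<phi>
    by (simp add: B.is_group group_hom_axioms.intro group_hom_def)
  have inj: "inj_on \<phi> (carrier ?F')"
  proof (subst \<phi>.inj_on_one_iff, intro allI impI)
    fix c assume c: "c \<in> carrier ?F'" "\<phi> c = \<one>\<^bsub>B\<^esub>"
    then have n: "?n c = 0" using \<gamma>\<phi>[OF c(1)] by simp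
    then have "f (\<alpha> (\<rho> c)) = \<one>\<^bsub>B\<^esub>"
      using c \<alpha>_car[OF \<rho>_car[OF c(1)]] by (simp add: \<phi>_def)
    then have "\<alpha> (\<rho> c) = \<one>\<^bsub>A\<^esub>"
      using f(2) \<alpha>_car[OF \<rho>_car[OF c(1)]] f.hom_one by (metis A.one_closed inj_onD)
    also have "\<dots> = \<alpha> 0"
      using hom_one[OF \<alpha>h] by simp
    finally have "\<rho> c = 0"
      using \<alpha>b \<rho>_car[OF c(1)] by (auto simp: bij_betw_def dest!: inj_onD)
    then show "c = \<one>\<^bsub>?F'\<^esub>" using n by (simp add: \<rho>_def)
  qed
  have surj: "x \<in> \<phi> ` carrier ?F'" if x: "x \<in> carrier B" for x
  proof -
    let ?m = "\<gamma> (g x)"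
    \<comment> \<open>Dividing by the right power of \<open>b\<close> moves \<open>x\<close> into
      the kernel of \<open>g\<close>, that is, into the image of \<open>f\<close>.\<close>
    let ?y = "x \<otimes>\<^bsub>B\<^esub> inv\<^bsub>B\<^esub> (b [^]\<^bsub>B\<^esub> ?m)"
    have y: "?y \<in> carrier B" using x b by simp
    have "\<gamma> (g ?y) = 0" using x b by (simp add: \<gamma>pow)
    then have "\<gamma> (g ?y) = \<gamma> \<one>\<^bsub>C\<^esub>" by simp
    then have "g ?y = \<one>\<^bsub>C\<^esub>"
      using \<gamma>b y unfolding bij_betw_def by (meson C.one_closed g.hom_closed inj_onD)
    then have "?y \<in> f ` \<alpha> ` carrier ?F"
      using y ex \<alpha>b by (auto simp: kernel_def bij_betw_def)
    then obtain c where c: "c \<in> carrier ?F" "?y = f (\<alpha> c)" by auto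
    let ?c = "c + frag_cmul ?m (frag_of k)"
    have "?c \<in> carrier ?F'"
      using c(1) keys_add[of c "frag_cmul ?m (frag_of k)"] keys_cmul[of ?m "frag_of k"]
      by (fastforce simp: lessThan_Suc)
    moreover have "\<phi> ?c = x"
    proof -
      have n: "?n ?c = ?m" using \<rho>_id[OF c(1)] by (simp add: lookup_add lookup_frag_cmul lookup_frag_of)
      then have "\<rho> ?c = c" by (simp add: \<rho>_def)
      then have "\<phi> ?c = ?y \<otimes>\<^bsub>B\<^esub> b [^]\<^bsub>B\<^esub> ?m" using n c by (simp add: \<phi>_def)
      then show ?thesis using x b by (simp add: B.m_assoc)
    qed
    ultimately show ?thesis by force
  qed
  have "\<phi> ` carrier ?F' = carrier B" using surj by auto
  with inj have "\<phi> \<in> iso ?F' B" by (simp add: iso_def bij_betw_def \<phi>.homh)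
  then show ?thesis
    unfolding free_of_rank_def by (meson group.iso_sym group_free_Abelian_group is_isoI)
qed

text \<open>Subspace and pair have no homology in odd degrees. For odd \<open>p\<close> the group is
  squeezed between zeros in the long exact sequence; for even \<open>p\<close> the neighbours in
  degrees \<open>p + 1\<close> and \<open>p - 1\<close> vanish, which leaves a short exact sequence
  whose relative term is \<int> or 0.\<close>

lemma homology_extension:
  assumes A: "\<And>p. free_of_rank (homology_group p (subtopology T A)) (rk p)" "\<And>p. \<not> even p \<Longrightarrow> rk p = 0"
    and XA: "\<And>p. free_of_rank (relative_homology_group p T A) (if p = 2 * int m then 1 else 0)"
  shows "free_of_rank (homology_group p T) (rk p + (if p = 2 * int m then 1 else 0))"
proof -
  let ?A = "\<lambda>p. homology_group p (subtopology T A)" and ?R = "\<lambda>p. relative_homology_group p T A"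
  let ?f = "hom_induced p (subtopology T A) {} T {} id" and ?g = "hom_induced p T {} T A id"
  have ex: "?f ` carrier (?A p) = kernel (homology_group p T) (?R p) ?g"
    using homology_exactness_axiom_3[of p T A] by simp
  have f: "?f \<in> hom (?A p) (homology_group p T)" and g: "?g \<in> hom (homology_group p T) (?R p)"
    by (rule hom_induced_hom)+
  interpret f: group_hom "?A p" "homology_group p T" ?f
    by (simp add: f group_hom_axioms.intro group_hom_def)
  interpret g: group_hom "homology_group p T" "?R p" ?g
    by (simp add: g group_hom_axioms.intro group_hom_def)
  show ?thesis
  proof (cases "\<not> even p")
    case True
    then have "trivial_group (?A p)" "trivial_group (?R p)"
      using A[of p] XA[of p] by (auto simp: free_of_rank_0 split: if_splits)
    then have 1: "carrier (?A p) = {\<one>\<^bsub>?A p\<^esub>}" "carrier (?R p) = {\<one>\<^bsub>?R p\<^esub>}"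
      by (auto simp: trivial_group_def)
    have "x = \<one>\<^bsub>homology_group p T\<^esub>" if "x \<in> carrier (homology_group p T)" for x
    proof -
      have "x \<in> kernel (homology_group p T) (?R p) ?g"
        using that g.hom_closed[OF that] 1(2) by (simp add: kernel_def)
      then show ?thesis using ex 1(1) f.hom_one by auto
    qed
    then have "trivial_group (homology_group p T)"
      by (auto simp: trivial_group_def)
    then show ?thesis using True A(2)[of p] by (auto simp: free_of_rank_0)
  next
    case False
    have neq: "p + 1 \<noteq> 2 * int m" using False by presburger
    have "trivial_group (?R (p + 1))" "trivial_group (?A (p - 1))"
      using A[of "p - 1"] XA[of "p + 1"] False neq by (auto simp: free_of_rank_0 split: if_splits)
    then have 1: "carrier (?R (p + 1)) = {\<one>\<^bsub>?R (p + 1)\<^esub>}" "carrier (?A (p - 1)) = {\<one>\<^bsub>?A (p - 1)\<^esub>}"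
      by (auto simp: trivial_group_def)
    have b: "hom_boundary q T A \<in> hom (?R q) (?A (q - 1))" for q
      by (rule hom_boundary_hom)
    have "kernel (?A p) (homology_group p T) ?f = hom_boundary (p + 1) T A ` carrier (?R (p + 1))"
      using homology_exactness_axiom_2[of "p + 1" T A] by simp
    also have "\<dots> = {\<one>\<^bsub>?A p\<^esub>}" using hom_one[OF b[of "p + 1"]] 1 by simp
    finally have inj: "inj_on ?f (carrier (?A p))" by (simp add: f.inj_iff_trivial_ker)
    have "?g ` carrier (homology_group p T) = kernel (?R p) (?A (p - 1)) (hom_boundary p T A)"
      using homology_exactness_axiom_1[of p T A] by simp
    also have "\<dots> = carrier (?R p)"
      using hom_in_carrier[OF b[of p]] 1 by (auto simp: kernel_def)
    finally have surj: "?g ` carrier (homology_group p T) = carrier (?R p)" .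
    show ?thesis
    proof (cases "p = 2 * int m")
      case True
      then show ?thesis
        using free_of_rank_extension[OF abelian_homology_group _ _ f inj g surj ex A(1)] XA[of p] by simp
    next
      case False
      then have "carrier (?R p) = {\<one>\<^bsub>?R p\<^esub>}"
        using XA[of p] by (auto simp: free_of_rank_0 trivial_group_def)
      then have "kernel (homology_group p T) (?R p) ?g = carrier (homology_group p T)"
        using g.hom_closed by (auto simp: kernel_def)
      then have "?f \<in> iso (?A p) (homology_group p T)"
        using inj ex by (simp add: iso_def bij_betw_def f)
      then show ?thesis
        using A(1)[of p] False by (simp add: free_of_rank_iso[OF group_relative_homology_group is_isoI])
    qed
  qed
qed

text \<open>Adding the set of largest key changes the homology by that of the new union relative to
  the old one. Excision replaces this pair by the new set relative to its intersection with the old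
  union, which is what the hypothesis \<open>cell\<close> describes.\<close>

theorem homology_cell_filtration:
  fixes c :: "'i \<Rightarrow> 'a set" and key :: "'i \<Rightarrow> nat"
  assumes "finite D" "inj_on key D"
    and op: "\<And>\<tau>. \<tau> \<in> D \<Longrightarrow> openin T (c \<tau>)"
    and cell: "\<And>\<tau> p. \<tau> \<in> D \<Longrightarrow> free_of_rank
      (relative_homology_group p (subtopology T (c \<tau>)) (\<Union>\<sigma>\<in>{\<sigma> \<in> D. key \<sigma> < key \<tau>}. c \<sigma>))
      (if p = 2 * int (m \<tau>) then 1 else 0)"
  shows "free_of_rank (homology_group p (subtopology T (\<Union>\<tau>\<in>D. c \<tau>))) (card {\<tau> \<in> D. p = 2 * int (m \<tau>)})"
  using assms
proof (induction D arbitrary: p rule: finite_ranking_induct[where f = key])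
  case empty
  show ?case by (simp add: free_of_rank_0 trivial_homology_group_empty)
next
  case (insert \<nu> S)
  show ?case
  \<comment> \<open>The induction rule allows the inserted element to be present already.\<close>
  proof (cases "\<nu> \<in> S")
    case True
    with insert show ?thesis by (simp add: insert_absorb)
  next
    case False
    have lt: "key \<sigma> < key \<nu>" if "\<sigma> \<in> S" for \<sigma>
      using insert.hyps(2)[OF that] insert.prems(1) False that by (auto simp: inj_on_def order_less_le)
    let ?U = "\<Union>\<tau>\<in>S. c \<tau>" and ?U' = "\<Union>\<tau>\<in>insert \<nu> S. c \<tau>"
    let ?Y = "subtopology T ?U'"
    have IH: "free_of_rank (homology_group p (subtopology T ?U)) (card {\<tau> \<in> S. p = 2 * int (m \<tau>)})" for p
    proof (rule insert.IH)
      show "inj_on key S" using insert.prems(1) by (rule inj_on_subset) auto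
      show "openin T (c \<tau>)" if "\<tau> \<in> S" for \<tau> using insert.prems(2) that by simp
      fix \<tau> p assume \<tau>: "\<tau> \<in> S"
      \<comment> \<open>\<open>\<nu>\<close> has maximal key, so it is never among the predecessors
        of a member of \<open>S\<close>.\<close>
      have "{\<sigma> \<in> insert \<nu> S. key \<sigma> < key \<tau>} = {\<sigma> \<in> S. key \<sigma> < key \<tau>}"
        using insert.hyps(2)[OF \<tau>] by auto
      then show "free_of_rank
          (relative_homology_group p (subtopology T (c \<tau>)) (\<Union>\<sigma>\<in>{\<sigma> \<in> S. key \<sigma> < key \<tau>}. c \<sigma>))
          (if p = 2 * int (m \<tau>) then 1 else 0)"
        using insert.prems(3)[of \<tau> p] \<tau> by (simp only: insert_iff simp_thms)
    qed
    have sub: "?U \<subseteq> ?U'" "c \<nu> \<subseteq> ?U'" and U': "?U' = ?U \<union> c \<nu>" by auto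
    have opU: "openin T ?U" "openin T (c \<nu>)" using insert.prems by auto
    have top: "?U' \<subseteq> topspace T" using opU openin_subset unfolding U' by auto
    have opY: "openin ?Y ?U" "openin ?Y (c \<nu>)"
      using opU sub by (auto simp: openin_open_subtopology U' openin_Un)
    \<comment> \<open>What is excised is the complement of the new set. It is closed and lies in the
      open set \<open>?U\<close>, so the condition on closure and interior is immediate.\<close>
    have "closedin ?Y (?U' - c \<nu>)"
      using closedin_diff[OF closedin_topspace opY(2)] top by (simp add: Int_absorb1)
    then have ex: "?Y closure_of (?U' - c \<nu>) \<subseteq> ?Y interior_of ?U"
      using opY(1) by (auto simp: closure_of_closedin interior_of_openin U')
    have "hom_induced p (subtopology ?Y (?U' - (?U' - c \<nu>))) (?U - (?U' - c \<nu>)) (subtopology ?Y ?U') ?U id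
       \<in> iso (relative_homology_group p (subtopology ?Y (?U' - (?U' - c \<nu>))) (?U - (?U' - c \<nu>)))
           (relative_homology_group p (subtopology ?Y ?U') ?U)" for p
      by (rule homology_excision_axiom[OF ex sub(1)])
    moreover have "?U' - (?U' - c \<nu>) = c \<nu>" "?U - (?U' - c \<nu>) = c \<nu> \<inter> ?U" using sub by auto
    moreover have "subtopology ?Y (c \<nu>) = subtopology T (c \<nu>)" "subtopology ?Y ?U' = ?Y"
      using sub by (simp_all add: subtopology_subtopology Int_absorb1)
    moreover have "relative_homology_group p (subtopology T (c \<nu>)) (c \<nu> \<inter> ?U)
        = relative_homology_group p (subtopology T (c \<nu>)) ?U" for p
      using relative_homology_group_restrict[of p "subtopology T (c \<nu>)" ?U] openin_subset[OF opU(2)]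
      by (simp add: Int_absorb1)
    ultimately have "relative_homology_group p (subtopology T (c \<nu>)) ?U \<cong> relative_homology_group p ?Y ?U" for p
      by (metis is_isoI)
    note iso = free_of_rank_iso[OF group_relative_homology_group this]
    have "{\<sigma> \<in> insert \<nu> S. key \<sigma> < key \<nu>} = S" using lt by auto
    then have R: "free_of_rank (relative_homology_group p ?Y ?U) (if p = 2 * int (m \<nu>) then 1 else 0)" for p
      using insert.prems(3)[of \<nu> p] iso[of p] by simp
    have sY: "subtopology ?Y ?U = subtopology T ?U"
      using sub by (simp add: subtopology_subtopology Int_absorb1)
    have "card {\<tau> \<in> S. p = 2 * int (m \<tau>)} = 0" if "\<not> even p" for p
      using that by (auto simp: card_eq_0_iff)
    then have *: "free_of_rank (homology_group p ?Y)
        (card {\<tau> \<in> S. p = 2 * int (m \<tau>)} + (if p = 2 * int (m \<nu>) then 1 else 0))"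
    proof (rule homology_extension[where A = ?U and rk = "\<lambda>p. card {\<tau> \<in> S. p = 2 * int (m \<tau>)}", rotated])
      show "free_of_rank (homology_group p (subtopology ?Y ?U)) (card {\<tau> \<in> S. p = 2 * int (m \<tau>)})" for p
        unfolding sY by (rule IH)
    qed (use R in blast)+
    have "{\<tau> \<in> insert \<nu> S. p = 2 * int (m \<tau>)} =
        (if p = 2 * int (m \<nu>) then insert \<nu> else id) {\<tau> \<in> S. p = 2 * int (m \<tau>)}"
      by auto
    then have "card {\<tau> \<in> insert \<nu> S. p = 2 * int (m \<tau>)} =
        card {\<tau> \<in> S. p = 2 * int (m \<tau>)} + (if p = 2 * int (m \<nu>) then 1 else 0)"
      using insert.hyps(1) False by simp
    with * show ?thesis by simp
  qed
qed

text \<open>Take cycles representing the images of the free generators. The isomorphism then sends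
  \<open>n\<close> to the class of \<open>frag_extend z n\<close>, and its bijectivity is the unique
  existence in \<open>homology_basis\<close>.\<close>

lemma homology_basis_exists:
  assumes "free_of_rank (homology_group (int q) T) k"
  shows "\<exists>z. homology_basis q T {..<k} z"
proof -
  let ?H = "homology_group (int q) T" and ?F = "free_Abelian_group {..<k}"
  let ?cl = "homologous_rel_set q T {}"
  obtain \<phi> where \<phi>: "\<phi> \<in> iso ?F ?H"
    using assms group.iso_sym[OF group_relative_homology_group] unfolding free_of_rank_def is_iso_def by blast
  then have \<phi>h: "\<phi> \<in> hom ?F ?H" and \<phi>b: "bij_betw \<phi> (carrier ?F) (carrier ?H)"
    by (auto simp: iso_def)
  interpret N: normal "singular_relboundary_set q T {}" "relcycle_group q T {}"
    by (rule normal_subgroup_singular_relboundary_relcycle)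
  have clh: "?cl (c + d) = ?cl c \<otimes>\<^bsub>?H\<^esub> ?cl d" if "cycle q T c" "cycle q T d" for c d
    using N.rcos_sum[of c d] that by (simp add: nontrivial_relative_homology_group FactGroup_def right_coset_singular_relboundary)
  have car: "carrier ?H = ?cl ` {c. cycle q T c}"
    by (rule carrier_relative_homology_group)
  have "\<exists>c. cycle q T c \<and> ?cl c = \<phi> (frag_of s)" if "s < k" for s
    using hom_in_carrier[OF \<phi>h, of "frag_of s"] that unfolding car by auto
  then obtain z where z: "\<And>s. s < k \<Longrightarrow> cycle q T (z s)" "\<And>s. s < k \<Longrightarrow> ?cl (z s) = \<phi> (frag_of s)"
    by metis
  have cyc: "cycle q T (frag_extend z n)" if "Poly_Mapping.keys n \<subseteq> {..<k}" for n
    unfolding frag_extend_def using that z by (intro singular_relcycle_sum singular_relcycle_cmul) auto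
  have eq: "\<phi> n = ?cl (frag_extend z n)" if "Poly_Mapping.keys n \<subseteq> {..<k}" for n
    using that
  proof (induction n rule: free_Abelian_group_induct[consumes 1, case_names zero diff gen])
    case zero
    have "\<phi> 0 = \<one>\<^bsub>?H\<^esub>" using hom_one[OF \<phi>h] by simp
    then show ?case using homologous_rel_set_eq_relboundary[of q T "{}" 0] by simp
  next
    case (diff x y)
    have xy: "Poly_Mapping.keys (x - y) \<subseteq> {..<k}" using diff keys_diff[of x y] by blast
    have "\<phi> (x - y) \<otimes>\<^bsub>?H\<^esub> \<phi> y = \<phi> x"
      using hom_mult[OF \<phi>h, of "x - y" y] xy diff by simp
    also have "\<dots> = ?cl (frag_extend z (x - y)) \<otimes>\<^bsub>?H\<^esub> \<phi> y"
      using clh[OF cyc[OF xy] cyc[OF diff(2)]] diff by (simp add: frag_extend_diff)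
    finally show ?case
      using group.right_cancel[OF group_relative_homology_group] hom_in_carrier[OF \<phi>h] diff xy cyc[OF xy]
      by (metis (no_types, lifting) car carrier_free_Abelian_group_iff image_eqI mem_Collect_eq)
  qed (use z in auto)
  have "homology_basis q T {..<k} z"
    unfolding homology_basis_def
  proof (intro conjI allI impI ballI)
    fix c assume c: "cycle q T c"
    have iff: "boundary q T (c - frag_extend z n) \<longleftrightarrow> \<phi> n = ?cl c" if "Poly_Mapping.keys n \<subseteq> {..<k}" for n
      using homologous_rel_set_eq[of q T "{}" c "frag_extend z n"] eq[OF that]
      by (auto simp: homologous_rel_def)
    have "?cl c \<in> carrier ?H" using c by (auto simp: car)
    then have "\<exists>!n. n \<in> carrier ?F \<and> \<phi> n = ?cl c"
      using \<phi>b unfolding bij_betw_def inj_on_def by (metis (no_types, lifting) imageE)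
    then show "\<exists>!n. Poly_Mapping.keys n \<subseteq> {..<k} \<and> boundary q T (c - frag_extend z n)"
      using iff by (metis carrier_free_Abelian_group_iff)
  qed (use z in auto)
  then show ?thesis by blast
qed

text \<open>A shift by \<open>k\<close> dimensions reduces this to dimension 0, where the punctured
  space is empty and the homology is that of a point.\<close>

lemma relative_homology_Euclidean_punctured:
  "free_of_rank (relative_homology_group p (Euclidean_space k) (topspace (Euclidean_space k) - {\<lambda>_. 0}))
     (if p = int k then 1 else 0)"
proof -
  let ?R = "\<lambda>p k. relative_homology_group p (Euclidean_space k) (topspace (Euclidean_space k) - {\<lambda>_. 0})"
  have top: "topspace (Euclidean_space 0) = {\<lambda>_. 0}"
    by (auto simp: topspace_Euclidean_space)
  have "closedin (Euclidean_space 0) {\<lambda>_. 0}"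
    using closedin_topspace[of "Euclidean_space 0"] by (simp add: top)
  from relative_homology_group_Euclidean_complement_step[OF this, of "p - int k" k]
  have iso: "homology_group (p - int k) (Euclidean_space 0) \<cong> ?R p k"
    by (simp add: top)
  have "free_of_rank (homology_group (p - int k) (Euclidean_space 0)) (if p = int k then 1 else 0)"
  proof (cases "p = int k")
    case True
    then show ?thesis using homology_coefficients[OF top] by (simp add: free_of_rank_1[simplified])
  next
    case False
    then show ?thesis using homology_dimension_axiom[OF top, of "p - int k"] by (simp add: free_of_rank_0)
  qed
  then show ?thesis using iso free_of_rank_iso[OF group_relative_homology_group] by blast
qed

lemma continuous_on_coord: "continuous_on A (\<lambda>x. x i)"
  by (rule continuous_on_subset[OF continuous_on_product_coordinates]) auto

text \<open>Scaling the coordinates outside \<open>J\<close> down to 0 deforms the pair to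
  \<complex>^J and its complement of the origin; \<open>supp\<close> says that this coordinate
  subspace lies in \<open>E\<close>. The coordinates in \<open>J\<close> stay fixed meanwhile, so
  the complement of their common zeros is preserved. \<open>E\<close> itself may be
  singular.\<close>

lemma relative_homology_cone:
  fixes E :: "('c \<Rightarrow> complex) set"
  assumes J: "finite J"
    and scale: "\<And>x t. x \<in> E \<Longrightarrow> 0 \<le> t \<Longrightarrow> t \<le> 1 \<Longrightarrow> (\<lambda>i. if i \<in> J then x i else of_real t * x i) \<in> E"
    and supp: "\<And>x. (\<And>i. i \<notin> J \<Longrightarrow> x i = 0) \<Longrightarrow> x \<in> E"
  shows "free_of_rank (relative_homology_group p (top_of_set E) (E - {x. \<forall>i\<in>J. x i = 0}))
    (if p = 2 * int (card J) then 1 else 0)"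
proof -
  let ?m = "card J" and ?S = "E - {x. \<forall>i\<in>J. x i = 0}"
  let ?Y = "Euclidean_space (2 * ?m)" and ?T = "topspace (Euclidean_space (2 * ?m)) - {\<lambda>_. 0}"
  obtain \<beta> where \<beta>: "bij_betw \<beta> {..<?m} J"
    using J by (metis bij_betw_from_nat_into_finite)
  define \<kappa> where "\<kappa> = inv_into {..<?m} \<beta>"
  have \<kappa>: "\<kappa> i < ?m" "\<beta> (\<kappa> i) = i" if "i \<in> J" for i
    using \<beta> that by (auto simp: \<kappa>_def bij_betw_def inv_into_into f_inv_into_f simp flip: lessThan_iff)
  have \<beta>': "\<beta> k \<in> J" "\<kappa> (\<beta> k) = k" if "k < ?m" for k
    using \<beta> that by (auto simp: \<kappa>_def bij_betw_def)
  \<comment> \<open>Real and imaginary parts of the coordinates in \<open>J\<close> become the even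
    and odd coordinates of a real point.\<close>
  define f where "f x i = (if i < 2 * ?m then if even i then Re (x (\<beta> (i div 2))) else Im (x (\<beta> (i div 2))) else 0)"
    for x :: "'c \<Rightarrow> complex" and i :: nat
  define g where "g y i = (if i \<in> J then Complex (y (2 * \<kappa> i)) (y (2 * \<kappa> i + 1)) else 0)" for y :: "nat \<Rightarrow> real" and i
  have contf: "continuous_map (top_of_set E) ?Y f"
  proof -
    have "continuous_map (top_of_set E) euclideanreal (\<lambda>x. if even i then Re (x (\<beta> (i div 2))) else Im (x (\<beta> (i div 2))))" for i
      by (cases "even i") (auto intro!: continuous_on_Re continuous_on_Im continuous_on_coord)
    then show ?thesis
      unfolding f_def[abs_def] by (simp add: continuous_map_componentwise_Euclidean_space)
  qed
  have gE: "g y \<in> E" for y by (intro supp) (simp add: g_def)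
  have contg: "continuous_map ?Y (top_of_set E) g"
  proof -
    have "continuous_on (topspace ?Y) (\<lambda>y. g y i)" for i
      by (cases "i \<in> J") (auto simp: g_def Complex_eq
          intro!: continuous_on_add continuous_on_mult continuous_on_const continuous_on_of_real continuous_on_coord)
    then have "continuous_on (topspace ?Y) g"
      by (intro continuous_on_coordinatewise_then_product) simp
    then show ?thesis
      using gE by (auto simp: continuous_map_in_subtopology continuous_map_Euclidean_space_iff)
  qed
  have fg: "f (g y) = y" if "y \<in> topspace ?Y" for y
  proof
    fix i :: nat
    have "2 * (i div 2) = i" if "even i" using that by simp
    moreover have "Suc (2 * (i div 2)) = i" if "odd i" using that by simp
    ultimately show "f (g y) i = y i"
      using that \<beta>'[of "i div 2"] by (auto simp: f_def g_def topspace_Euclidean_space)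
  qed
  have gf: "g (f x) = (\<lambda>i. if i \<in> J then x i else of_real 0 * x i)" for x
  proof
    fix i
    show "g (f x) i = (if i \<in> J then x i else of_real 0 * x i)"
      using \<kappa>[of i] by (auto simp: f_def g_def complex_eq_iff)
  qed
  have f0: "f x = (\<lambda>_. 0) \<longleftrightarrow> (\<forall>i\<in>J. x i = 0)" for x
  proof
    assume *: "f x = (\<lambda>_. 0)"
    have "g (f x) = (\<lambda>_. 0)" by (simp add: * g_def fun_eq_iff complex_eq_iff)
    then show "\<forall>i\<in>J. x i = 0" unfolding gf by (metis)
  next
    assume *: "\<forall>i\<in>J. x i = 0"
    have "x (\<beta> (i div 2)) = 0" if "i < 2 * ?m" for i
      using * \<beta>'(1)[of "i div 2"] that by simp
    then show "f x = (\<lambda>_. 0)" by (simp add: f_def fun_eq_iff)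
  qed
  have "relative_homology_group p (top_of_set E) ?S \<cong> relative_homology_group p ?Y ?T"
  proof (rule homotopy_equivalent_space_imp_isomorphic_relative_homology_groups[OF contf _ contg])
    show "f \<in> ?S \<rightarrow> ?T"
      using contf by (auto simp: continuous_map_def f0[unfolded fun_eq_iff] fun_eq_iff)
    show "g \<in> ?T \<rightarrow> ?S"
    proof
      fix y assume y: "y \<in> ?T"
      then have "f (g y) \<noteq> (\<lambda>_. 0)" using fg[of y] by auto
      then show "g y \<in> ?S" using gE f0[of "g y"] by auto
    qed
    show "homotopic_with (\<lambda>k. k \<in> ?T \<rightarrow> ?T) ?Y ?Y (f \<circ> g) id"
      using fg by (intro homotopic_with_equal) (auto intro!: continuous_map_compose[OF contg contf])
    \<comment> \<open>The homotopy runs from \<open>g \<circ> f\<close> at time 0 to the identity at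
      time 1.\<close>
    let ?h = "\<lambda>z :: real \<times> ('c \<Rightarrow> complex). \<lambda>i. if i \<in> J then snd z i else of_real (fst z) * snd z i"
    show "homotopic_with (\<lambda>h. h \<in> ?S \<rightarrow> ?S) (top_of_set E) (top_of_set E) (g \<circ> f) id"
      unfolding homotopic_with_def
    proof (intro exI[of _ ?h] conjI allI ballI)
      have "continuous_on ({0..1} \<times> E) (\<lambda>z. ?h z i)" for i
        by (cases "i \<in> J")
          (auto intro!: continuous_on_mult continuous_on_of_real continuous_on_fst continuous_on_id
            continuous_on_product_then_coordinatewise[OF continuous_on_snd[OF continuous_on_id]])
      then have "continuous_on ({0..1} \<times> E) ?h"
        by (intro continuous_on_coordinatewise_then_product)
      moreover have "?h \<in> {0..1} \<times> E \<rightarrow> E"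
      proof
        fix z :: "real \<times> ('c \<Rightarrow> complex)" assume "z \<in> {0..1} \<times> E"
        then show "?h z \<in> E" using scale[of "snd z" "fst z"] by auto
      qed
      ultimately show "continuous_map (prod_topology (top_of_set {0..1}) (top_of_set E)) (top_of_set E) ?h"
        unfolding prod_topology_subtopology_eu continuous_map_in_subtopology by simp
      show "?h (0, x) = (g \<circ> f) x" for x by (simp only: o_apply gf fst_conv snd_conv)
      show "?h (1, x) = id x" for x by (simp add: fun_eq_iff)
      show "(\<lambda>x. ?h (t, x)) \<in> ?S \<rightarrow> ?S" if "t \<in> {0..1}" for t
      proof
        fix x assume "x \<in> ?S"
        then have "(\<lambda>i. if i \<in> J then x i else of_real t * x i) \<in> ?S" using that scale[of x t] by auto
        then show "?h (t, x) \<in> ?S" by (simp only: fst_conv snd_conv)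
      qed
    qed
  qed
  from free_of_rank_iso[OF group_relative_homology_group this] show ?thesis
    using relative_homology_Euclidean_punctured[of p "2 * ?m"] by simp
qed

section \<open>Charts of the Quot scheme\<close>

definition comb :: "(('n, 'a) mpoly ^ 'r) \<times> (('n, 'a) mpoly ^ 'r) \<Rightarrow> 'a \<times> 'a \<Rightarrow> ('n, 'a::comm_ring_1) mpoly ^ 'r" where
  "comb b x = mconst (fst x) *s fst b + mconst (snd x) *s snd b"

lemma comb_add: "comb b (x + y) = comb b x + comb b y"
  by (simp add: comb_def mconst_simps Modules.module.scale_left_distrib[OF module_vec])

lemma comb_diff: "comb b (x - y) = comb b x - comb b y"
  by (simp add: comb_def mconst_simps Modules.module.scale_left_diff_distrib[OF module_vec])

lemma comb_scale: "mconst c *s comb b x = comb b (c * fst x, c * snd x)"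
  by (simp add: comb_def mconst_simps Modules.module.scale_right_distrib[OF module_vec] vector_smult_assoc)

lemma comb_0: "comb b 0 = 0" "comb b (0, 0) = 0"
  by (simp_all add: comb_def mconst_simps)

definition chart :: "(('n::finite, complex) mpoly ^ 'r::finite) \<times> (('n, complex) mpoly ^ 'r) \<Rightarrow>
    (('n, complex) mpoly ^ 'r) set set" where
  "chart b = {K. module.subspace (*s) K \<and> (\<forall>w. \<exists>x. w - comb b x \<in> K) \<and> (\<forall>x. comb b x \<in> K \<longrightarrow> x = 0)}"

lemma sum_lessThan_2: "(\<Sum>j<2. f j) = f 0 + f (1::nat)"
  by (simp add: numeral_2_eq_2)

lemma all_less_2: "(\<forall>j<2. P j) \<longleftrightarrow> P 0 \<and> P (1::nat)"
  by (auto simp: numeral_2_eq_2 less_Suc_eq)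

lemma quot_points_2_iff: "K \<in> quot_points 2 \<longleftrightarrow> (\<exists>b. K \<in> chart b)"
proof
  assume "K \<in> quot_points 2"
  then obtain b where b: "module.subspace (*s) K"
      "\<And>w. \<exists>a. w - (mconst (a (0::nat)) *s b (0::nat) + mconst (a 1) *s b 1) \<in> K"
      "\<And>a. mconst (a (0::nat)) *s b 0 + mconst (a 1) *s b 1 \<in> K \<Longrightarrow> a 0 = 0 \<and> a 1 = 0"
    unfolding quot_points_def quot_functor_field sum_lessThan_2 all_less_2 by metis
  have "K \<in> chart (b 0, b 1)"
    unfolding chart_def comb_def mem_Collect_eq
  proof (intro conjI allI impI)
    show "\<exists>x. w - (mconst (fst x) *s fst (b 0, b 1) + mconst (snd x) *s snd (b 0, b 1)) \<in> K" for w
      using b(2)[of w] by (metis fst_conv snd_conv)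
    show "x = 0" if "mconst (fst x) *s fst (b 0, b 1) + mconst (snd x) *s snd (b 0, b 1) \<in> K" for x
      using b(3)[of "\<lambda>j. if j = 0 then fst x else snd x"] that by (simp add: prod_eq_iff)
  qed (rule b)
  then show "\<exists>b. K \<in> chart b" ..
next
  assume "\<exists>b. K \<in> chart b"
  then obtain b where b: "module.subspace (*s) K" "\<And>w. \<exists>x. w - comb b x \<in> K" "\<And>x. comb b x \<in> K \<Longrightarrow> x = 0"
    unfolding chart_def by blast
  let ?b = "\<lambda>j::nat. if j = 0 then fst b else snd b"
  have "\<exists>a. w - (mconst (a (0::nat)) *s ?b 0 + mconst (a 1) *s ?b 1) \<in> K" for w
  proof -
    obtain x where "w - comb b x \<in> K" using b(2) by blast
    then show ?thesis
      by (intro exI[of _ "\<lambda>j. if j = 0 then fst x else snd x"]) (simp add: comb_def)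
  qed
  moreover have "a 0 = 0 \<and> a 1 = 0" if "mconst (a (0::nat)) *s ?b 0 + mconst (a 1) *s ?b 1 \<in> K" for a
    using b(3)[of "(a 0, a 1)"] that by (simp add: comb_def zero_prod_def)
  ultimately show "K \<in> quot_points 2"
    unfolding quot_points_def quot_functor_field sum_lessThan_2 all_less_2
    using b(1) by (intro conjI exI[of _ ?b] allI impI) blast+
qed

section \<open>Coordinates in a chart and change of basis\<close>

definition coords where
  "coords b K w = (THE x. w - comb b x \<in> K)"

definition det2 :: "'a \<times> 'a \<Rightarrow> 'a \<times> 'a \<Rightarrow> 'a::comm_ring_1" where
  "det2 x y = fst x * snd y - snd x * fst y"

lemma cramer2:
  fixes a a' c c' p q :: "'a::field"
  assumes D: "a * c' - c * a' \<noteq> 0"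
  shows "(p * c' - q * a') / (a * c' - c * a') * a + (a * q - c * p) / (a * c' - c * a') * a' = p"
    and "(p * c' - q * a') / (a * c' - c * a') * c + (a * q - c * p) / (a * c' - c * a') * c' = q"
proof -
  define E where "E = a * c' - c * a'"
  have "(p * c' - q * a') * a + (a * q - c * p) * a' = p * E"
    "(p * c' - q * a') * c + (a * q - c * p) * c' = q * E" by (simp_all add: E_def algebra_simps)
  moreover have "E \<noteq> 0" using D by (simp add: E_def)
  ultimately have "(p * c' - q * a') / E * a + (a * q - c * p) / E * a' = p"
    "(p * c' - q * a') / E * c + (a * q - c * p) / E * c' = q"
    by (simp_all add: nonzero_eq_divide_eq flip: add_divide_distrib)
  then show "(p * c' - q * a') / (a * c' - c * a') * a + (a * q - c * p) / (a * c' - c * a') * a' = p"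
    "(p * c' - q * a') / (a * c' - c * a') * c + (a * q - c * p) / (a * c' - c * a') * c' = q"
    by (simp_all only: E_def)
qed

context
  fixes b :: "(('n::finite, complex) mpoly ^ 'r::finite) \<times> (('n, complex) mpoly ^ 'r)" and K
  assumes K: "K \<in> chart b"
begin

lemma chart_subspace:
  "0 \<in> K" "v \<in> K \<Longrightarrow> w \<in> K \<Longrightarrow> v + w \<in> K" "v \<in> K \<Longrightarrow> w \<in> K \<Longrightarrow> v - w \<in> K" "v \<in> K \<Longrightarrow> c *s v \<in> K"
proof -
  have sub: "module.subspace (*s) K" using K by (simp add: chart_def)
  show "0 \<in> K" "v \<in> K \<Longrightarrow> w \<in> K \<Longrightarrow> v + w \<in> K" "v \<in> K \<Longrightarrow> w \<in> K \<Longrightarrow> v - w \<in> K" "v \<in> K \<Longrightarrow> c *s v \<in> K"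
    using Modules.module.subspace_0[OF module_vec sub] Modules.module.subspace_add[OF module_vec sub]
      Modules.module.subspace_diff[OF module_vec sub] Modules.module.subspace_scale[OF module_vec sub]
    by auto
qed

lemma coords_eqI: "w - comb b x \<in> K \<Longrightarrow> coords b K w = x"
  unfolding coords_def
proof (rule the_equality)
  fix y assume *: "w - comb b y \<in> K" "w - comb b x \<in> K"
  have "comb b (y - x) = (w - comb b x) - (w - comb b y)" by (simp add: comb_diff)
  then have "comb b (y - x) \<in> K" using chart_subspace(3)[OF *(2,1)] by simp
  then have "y - x = 0" using K unfolding chart_def by blast
  then show "y = x" by simp
qed

lemma coords_mem: "w - comb b (coords b K w) \<in> K"
proof -
  obtain x where "w - comb b x \<in> K" using K unfolding chart_def by blast
  then show ?thesis using coords_eqI by metis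
qed

lemma coords_add: "coords b K (v + w) = coords b K v + coords b K w"
proof (rule coords_eqI)
  show "v + w - comb b (coords b K v + coords b K w) \<in> K"
    using chart_subspace(2)[OF coords_mem[of v] coords_mem[of w]] by (simp add: comb_add algebra_simps)
qed

lemma coords_scale: "coords b K (mconst c *s w) = (c * fst (coords b K w), c * snd (coords b K w))"
proof (rule coords_eqI)
  show "mconst c *s w - comb b (c * fst (coords b K w), c * snd (coords b K w)) \<in> K"
    using chart_subspace(4)[OF coords_mem[of w], of "mconst c"]
    by (simp add: comb_scale Modules.module.scale_right_diff_distrib[OF module_vec])
qed

lemma coords_eq_0_iff: "coords b K w = 0 \<longleftrightarrow> w \<in> K"
  using coords_mem[of w] coords_eqI[of w 0] by (auto simp: comb_0)

lemma coords_diff: "coords b K (v - w) = coords b K v - coords b K w"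
  using coords_add[of "v - w" w] by simp

lemma coords_comb: "coords b K (comb b' x) =
   (fst x * fst (coords b K (fst b')) + snd x * fst (coords b K (snd b')),
    fst x * snd (coords b K (fst b')) + snd x * snd (coords b K (snd b')))"
  by (simp add: comb_def coords_add coords_scale)

lemma coords_basis: "coords b K (fst b) = (1, 0)" "coords b K (snd b) = (0, 1)"
  by (rule coords_eqI, simp add: comb_def mconst_simps chart_subspace)+

text \<open>Express the basis \<open>b\<close> through \<open>b'\<close>: determinants multiply, so
  the one belonging to \<open>b'\<close> divides 1.\<close>

lemma chart_spanI:
  assumes "\<And>w. \<exists>x. w - comb b' x \<in> K"
  shows "det2 (coords b K (fst b')) (coords b K (snd b')) \<noteq> 0"
proof -
  obtain x y where "fst b - comb b' x \<in> K" "snd b - comb b' y \<in> K" using assms by blast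
  then have *: "coords b K (comb b' x) = (1, 0)" "coords b K (comb b' y) = (0, 1)"
    using coords_basis coords_diff coords_eq_0_iff by (metis eq_iff_diff_eq_0)+
  have "det2 x y * det2 (coords b K (fst b')) (coords b K (snd b')) =
      det2 (coords b K (comb b' x)) (coords b K (comb b' y))"
    unfolding coords_comb by (simp add: det2_def algebra_simps)
  also have "\<dots> = 1" unfolding * by (simp add: det2_def)
  finally show ?thesis by auto
qed

text \<open>The two quotients are Cramer's rule for writing the class of \<open>w\<close> in terms
  of \<open>b'\<close>. Explicit determinants make the later continuity arguments possible.\<close>

lemma chart_change_mem:
  fixes b' :: "(('n, complex) mpoly ^ 'r) \<times> (('n, complex) mpoly ^ 'r)" and w
  defines "D \<equiv> det2 (coords b K (fst b')) (coords b K (snd b'))"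
  assumes D: "D \<noteq> 0"
  shows "w - comb b' (det2 (coords b K w) (coords b K (snd b')) / D,
      det2 (coords b K (fst b')) (coords b K w) / D) \<in> K" (is "w - comb b' ?x \<in> K")
proof -
  obtain p q where w: "coords b K w = (p, q)" by force
  obtain a c where b0: "coords b K (fst b') = (a, c)" by force
  obtain a' c' where b1: "coords b K (snd b') = (a', c')" by force
  have D': "a * c' - c * a' \<noteq> 0" using D by (simp add: D_def det2_def b0 b1)
  have x: "?x = ((p * c' - q * a') / (a * c' - c * a'), (a * q - c * p) / (a * c' - c * a'))"
    by (simp add: D_def w b0 b1 det2_def)
  have "coords b K (comb b' ?x) = coords b K w"
    by (subst x) (simp only: coords_comb w b0 b1 fst_conv snd_conv cramer2[OF D'])
  then have "coords b K (w - comb b' ?x) = 0" unfolding coords_diff by simp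
  then show ?thesis by (simp only: coords_eq_0_iff)
qed

lemma chart_change:
  assumes D: "det2 (coords b K (fst b')) (coords b K (snd b')) \<noteq> 0"
  shows "K \<in> chart b'"
proof -
  have "x = 0" if "comb b' x \<in> K" for x
  proof -
    have 0: "coords b K (comb b' x) = 0" using that by (simp only: coords_eq_0_iff)
    have "det2 (coords b K (comb b' x)) (coords b K (snd b')) = fst x * det2 (coords b K (fst b')) (coords b K (snd b'))"
      "det2 (coords b K (fst b')) (coords b K (comb b' x)) = snd x * det2 (coords b K (fst b')) (coords b K (snd b'))"
      unfolding coords_comb det2_def by (simp_all add: algebra_simps)
    then show ?thesis using D unfolding 0 by (auto simp: det2_def[of 0] det2_def[of _ 0] prod_eq_iff)
  qed
  moreover have "\<exists>x. w - comb b' x \<in> K" for w using chart_change_mem[OF D] by blast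
  ultimately show ?thesis using K unfolding chart_def by blast
qed

end

lemma coords_change:
  assumes "K \<in> chart b" "det2 (coords b K (fst b')) (coords b K (snd b')) \<noteq> 0" (is "?D \<noteq> 0")
  shows "coords b' K w = (det2 (coords b K w) (coords b K (snd b')) / ?D,
      det2 (coords b K (fst b')) (coords b K w) / ?D)"
  by (rule coords_eqI[OF chart_change[OF assms] chart_change_mem[OF assms]])

lemma chart_iff_det:
  assumes "K \<in> chart b"
  shows "K \<in> chart b' \<longleftrightarrow> det2 (coords b K (fst b')) (coords b K (snd b')) \<noteq> 0"
  using chart_change[OF assms] chart_spanI[OF assms, of b'] unfolding chart_def by blast

text \<open>\<open>K\<close> lies in some chart, so the quotient has dimension two and a spanning
  pair is a basis.\<close>

lemma spanning_imp_chart: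
  assumes "K \<in> quot_points 2" "\<And>w. \<exists>x. w - comb b x \<in> K"
  shows "K \<in> chart b"
  using assms chart_spanI chart_iff_det quot_points_2_iff by metis

section \<open>Continuity of the coordinates\<close>

text \<open>The constant family with value \<open>w\<close>; it is a right inverse of
  \<open>specialize p\<close> for every \<open>p\<close> at once.\<close>

definition const_lift :: "('n, complex) mpoly ^ 'r \<Rightarrow> ('n, (nat, complex) mpoly) mpoly ^ 'r" where
  "const_lift w = (\<chi> i. Poly_Mapping.map mconst (w $ i))"

lemma specialize_const_lift: "specialize p (const_lift w) = w"
proof -
  have "Poly_Mapping.map (mpoly_eval p) (Poly_Mapping.map mconst c) = c" for c :: "('a, complex) mpoly"
    by (rule poly_mapping_eqI)
      (auto simp: lookup_map_eval map.rep_eq when_def mpoly_eval_mconst mpoly_eval_0 mconst_eq_0_iff)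
  then show ?thesis by (simp add: specialize_def const_lift_def vec_eq_iff)
qed

abbreviation ev2 :: "(nat \<Rightarrow> complex) \<Rightarrow> (nat, complex) mpoly \<times> (nat, complex) mpoly \<Rightarrow> complex \<times> complex" where
  "ev2 p x \<equiv> (mpoly_eval p (fst x), mpoly_eval p (snd x))"

abbreviation specialize2 where
  "specialize2 p b \<equiv> (specialize p (fst b), specialize p (snd b))"

lemma specialize_comb: "specialize p (comb b x) = comb (specialize2 p b) (ev2 p x)"
  by (simp add: comb_def specialize_add specialize_scale map_eval_mconst)

lemma continuous_on_mpoly_eval: "continuous_on A (\<lambda>p. mpoly_eval p (f :: (nat, complex) mpoly))"
  unfolding mpoly_eval_def mono_eval_def
  by (intro continuous_on_sum continuous_on_mult continuous_on_const continuous_on_prod continuous_on_power continuous_on_coord)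

text \<open>The functions that vanish at \<open>p\<close> form a proper ideal, so one of the
  elements generating the unit ideal by local freeness is nonzero at \<open>p\<close>. Spanning is
  all that is recorded: the fibres are already known to be points of the Quot scheme, where
  \<open>spanning_imp_chart\<close> turns it into a basis.\<close>

lemma family_local_frame:
  fixes K :: "(('n::finite, (nat, complex) mpoly) mpoly ^ 'r::finite) set"
  assumes K: "K \<in> quot_functor 2 I" and p: "p \<in> zero_locus I"
  obtains f \<beta> where "mpoly_eval p f \<noteq> 0" "\<And>w. \<exists>N a. mconst (f ^ N) *s w - comb \<beta> a \<in> K"
proof -
  have "\<forall>J. ideal J ring_of_type_algebra \<and> I \<union> {f. free_on_basic_open 2 I K f} \<subseteq> J \<longrightarrow> 1 \<in> J"
    using K unfolding quot_functor_def genideal_type_UNIV_iff by blast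
  moreover have "ideal {f. mpoly_eval p f = 0} ring_of_type_algebra"
    by (rule ideal_typeI) (simp_all add: mpoly_eval_0 mpoly_eval_add mpoly_eval_mult)
  moreover have "1 \<notin> {f. mpoly_eval p f = 0}" by (simp add: mpoly_eval_1)
  ultimately have "\<not> I \<union> {f. free_on_basic_open 2 I K f} \<subseteq> {f. mpoly_eval p f = 0}" by blast
  then obtain f where f: "mpoly_eval p f \<noteq> 0" "free_on_basic_open 2 I K f"
    using p unfolding zero_locus_def by blast
  then obtain b :: "nat \<Rightarrow> ('n, (nat, complex) mpoly) mpoly ^ 'r" where
    b: "\<forall>w. \<exists>N a. mconst (f ^ N) *s w - (\<Sum>j<2. mconst (a j) *s b j) \<in> K"
    unfolding free_on_basic_open_def by blast
  have "\<exists>N a. mconst (f ^ N) *s w - comb (b 0, b 1) a \<in> K" for w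
  proof -
    obtain N a where "mconst (f ^ N) *s w - (\<Sum>j<2. mconst (a j) *s b j) \<in> K"
      using b by blast
    then show ?thesis by (intro exI[of _ N] exI[of _ "(a 0, a 1)"]) (simp add: comb_def sum_lessThan_2)
  qed
  with f(1) that show ?thesis by blast
qed

text \<open>Near \<open>p0\<close> the local frame of the family gives coordinates that are
  quotients of polynomial functions of \<open>p\<close>. A determinant in these decides whether
  \<open>b\<close> is a basis of the fibre, and Cramer's rule converts the coordinates to
  \<open>b\<close>.\<close>

lemma chart_family:
  fixes K :: "(('n::finite, (nat, complex) mpoly) mpoly ^ 'r::finite) set"
  assumes K: "K \<in> quot_functor 2 I" and p0: "p0 \<in> zero_locus I" "family_fibre p0 K \<in> chart b"
  shows "\<exists>V. openin (top_of_set (zero_locus I)) V \<and> p0 \<in> V \<and> (\<forall>p\<in>V. family_fibre p K \<in> chart b) \<and>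
    continuous_on V (\<lambda>p. coords b (family_fibre p K) u)"
proof -
  let ?F = "\<lambda>p. family_fibre p K"
  obtain f \<beta> where f: "mpoly_eval p0 f \<noteq> 0" and \<beta>: "\<And>w. \<exists>N a. mconst (f ^ N) *s w - comb \<beta> a \<in> K"
    using family_local_frame[OF K p0(1)] by blast
  have "\<forall>w. \<exists>N a. mconst (f ^ N) *s const_lift w - comb \<beta> a \<in> K" using \<beta> by blast
  then obtain N a where "\<And>w. mconst (f ^ N w) *s const_lift w - comb \<beta> (a w) \<in> K"
    by metis
  then have "specialize p (mconst (f ^ N w) *s const_lift w - comb \<beta> (a w)) \<in> ?F p" for p w
    by (simp add: family_fibre_def)
  then have a: "mconst (mpoly_eval p f ^ N w) *s w - comb (specialize2 p \<beta>) (ev2 p (a w)) \<in> ?F p" for p w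
    by (simp add: specialize_diff specialize_scale map_eval_mconst specialize_const_lift specialize_comb mpoly_eval_power)
  \<comment> \<open>Coordinates in the local frame; the factor \<open>f ^ N w\<close> is removed by
    inverting its value at \<open>p\<close>.\<close>
  define g where "g p w = (let c = inverse (mpoly_eval p f ^ N w) in (c * fst (ev2 p (a w)), c * snd (ev2 p (a w))))" for p w
  have g: "?F p \<in> chart (specialize2 p \<beta>)" "coords (specialize2 p \<beta>) (?F p) w = g p w"
    if p: "p \<in> zero_locus I" "mpoly_eval p f \<noteq> 0" for p w
  proof -
    have F: "?F p \<in> quot_points 2" using K p(1) by (rule family_fibre_in_quot_points)
    then have sub: "module.subspace (*s) (?F p)" unfolding quot_points_2_iff chart_def by blast
    have *: "w - comb (specialize2 p \<beta>) (g p w) \<in> ?F p" for w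
    proof -
      let ?c = "inverse (mpoly_eval p f ^ N w)"
      have 1: "mconst ?c *s (mconst (mpoly_eval p f ^ N w) *s w) = w"
        using p(2) by (simp flip: mconst_simps(3) add: vector_smult_assoc mconst_simps(5))
      show ?thesis
        using Modules.module.subspace_scale[OF module_vec sub a[of p w], of "mconst ?c"]
        by (simp only: Modules.module.scale_right_diff_distrib[OF module_vec] 1 comb_scale g_def Let_def)
    qed
    then show 2: "?F p \<in> chart (specialize2 p \<beta>)" using F by (intro spanning_imp_chart) blast+
    show "coords (specialize2 p \<beta>) (?F p) w = g p w" by (rule coords_eqI[OF 2 *])
  qed
  define D where "D p = det2 (g p (fst b)) (g p (snd b))" for p
  define V0 where "V0 = {p \<in> zero_locus I. mpoly_eval p f \<noteq> 0}"
  define V where "V = {p \<in> V0. D p \<noteq> 0}"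
  have cg: "continuous_on V0 (\<lambda>p. fst (g p w))" "continuous_on V0 (\<lambda>p. snd (g p w))" for w
    unfolding g_def Let_def fst_conv snd_conv
    by (intro continuous_on_mult continuous_on_inverse continuous_on_power continuous_on_mpoly_eval; simp add: V0_def)+
  have cdet: "continuous_on V0 (\<lambda>p. det2 (g p w) (g p w'))" for w w'
    unfolding det2_def by (intro continuous_on_diff continuous_on_mult cg)
  have "V0 = zero_locus I \<inter> (\<lambda>p. mpoly_eval p f) -` (- {0})" by (auto simp: V0_def)
  then have op0: "openin (top_of_set (zero_locus I)) V0"
    using continuous_openin_preimage_gen[OF continuous_on_mpoly_eval[of "zero_locus I" f], of "- {0}"]
    by (simp add: open_Compl)
  have "V = V0 \<inter> D -` (- {0})" by (auto simp: V_def)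
  moreover have "continuous_on V0 D" using cdet by (simp add: D_def[abs_def])
  ultimately have "openin (top_of_set V0) V"
    using continuous_openin_preimage_gen[of V0 D "- {0}"] by (simp add: open_Compl)
  then have "openin (top_of_set (zero_locus I)) V" using op0 by (rule openin_trans)
  moreover have chart: "?F p \<in> chart b \<longleftrightarrow> D p \<noteq> 0" if "p \<in> V0" for p
    using chart_iff_det[OF g(1)[of p], of b] that by (simp add: g(2) D_def V0_def)
  then have "p0 \<in> V" "\<forall>p\<in>V. ?F p \<in> chart b" using p0 f by (auto simp: V_def V0_def)
  moreover have "continuous_on V (\<lambda>p. (det2 (g p u) (g p (snd b)) / D p, det2 (g p (fst b)) (g p u) / D p))"
    using continuous_on_subset[OF cdet, of V] unfolding D_def
    by (intro continuous_on_Pair continuous_on_divide) (auto simp: V_def D_def)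
  then have "continuous_on V (\<lambda>p. coords b (?F p) u)"
  proof (rule continuous_on_eq)
    fix p assume "p \<in> V"
    then have p: "p \<in> zero_locus I" "mpoly_eval p f \<noteq> 0" "D p \<noteq> 0" by (auto simp: V_def V0_def)
    show "(det2 (g p u) (g p (snd b)) / D p, det2 (g p (fst b)) (g p u) / D p) = coords b (?F p) u"
      using coords_change[OF g(1)[OF p(1,2)], of b u] p(3) by (simp add: g(2)[OF p(1,2)] D_def)
  qed
  ultimately show ?thesis by blast
qed

text \<open>Openness is tested on the base of every family, where \<open>chart_family\<close>
  provides a neighbourhood of each point on which the coordinates are continuous.\<close>

lemma openin_chart_preimage:
  fixes b :: "(('n::finite, complex) mpoly ^ 'r::finite) \<times> (('n, complex) mpoly ^ 'r)"
  assumes "open W"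
  shows "openin (quot_space 2) {K \<in> chart b. coords b K u \<in> W}"
  unfolding openin_quot_space quot_open_def
proof (intro conjI allI impI)
  show "{K \<in> chart b. coords b K u \<in> W} \<subseteq> quot_points 2" using quot_points_2_iff by blast
  fix I and K :: "(('n, (nat, complex) mpoly) mpoly ^ 'r) set"
  assume "finite_type_ideal I \<and> K \<in> quot_functor 2 I"
  then have K: "K \<in> quot_functor 2 I" ..
  show "openin (top_of_set (zero_locus I)) {p \<in> zero_locus I. family_fibre p K \<in> {K \<in> chart b. coords b K u \<in> W}}"
    (is "openin _ ?S")
  proof (subst openin_subopen, intro ballI)
    fix p0 assume p0: "p0 \<in> ?S"
    then obtain V where V: "openin (top_of_set (zero_locus I)) V" "p0 \<in> V" "\<And>p. p \<in> V \<Longrightarrow> family_fibre p K \<in> chart b"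
      "continuous_on V (\<lambda>p. coords b (family_fibre p K) u)"
      using chart_family[OF K, of p0 b u] by blast
    let ?V = "V \<inter> (\<lambda>p. coords b (family_fibre p K) u) -` W"
    have "openin (top_of_set (zero_locus I)) ?V"
      using continuous_openin_preimage_gen[OF V(4), of W] assms V(1) by (auto intro: openin_trans)
    moreover have "p0 \<in> ?V" "?V \<subseteq> ?S" using p0 V openin_subset[OF V(1)] by auto
    ultimately show "\<exists>T. openin (top_of_set (zero_locus I)) T \<and> p0 \<in> T \<and> T \<subseteq> ?S" by blast
  qed
qed

lemma openin_chart: "openin (quot_space 2) (chart b)"
  using openin_chart_preimage[of UNIV b] by simp

lemma topspace_chart: "topspace (subtopology (quot_space 2) (chart b)) = chart b"
  using openin_subset[OF openin_chart[of b]] by (simp add: Int_absorb1)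

lemma continuous_map_coords:
  "continuous_map (subtopology (quot_space 2) (chart b)) euclidean (\<lambda>K. coords b K u)"
  unfolding continuous_map_def topspace_chart
proof (intro conjI allI impI)
  fix U :: "(complex \<times> complex) set" assume "openin euclidean U"
  then have "openin (quot_space 2) {K \<in> chart b. coords b K u \<in> U}"
    by (intro openin_chart_preimage) simp
  then show "openin (subtopology (quot_space 2) (chart b)) {K \<in> chart b. coords b K u \<in> U}"
    by (auto simp: openin_open_subtopology[OF openin_chart])
qed simp

section \<open>The universal family over a chart\<close>

text \<open>A point of the Quot scheme is presented by \<open>r\<close> vectors in \<open>\<complex>\<^sup>2\<close> (at the indices \<open>Inl l\<close>) and \<open>n\<close>
  commuting endomorphisms of \<open>\<complex>\<^sup>2\<close>; the two columns of the \<open>k\<close>-th one are at the indices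
  \<open>Inr (k, False)\<close> and \<open>Inr (k, True)\<close>.\<close>

type_synonym ('n, 'r) qdata = "'r + 'n \<times> bool \<Rightarrow> complex \<times> complex"

definition cmul :: "complex \<Rightarrow> complex \<times> complex \<Rightarrow> complex \<times> complex" where
  "cmul c u = (c * fst u, c * snd u)"

lemma cmul_simps:
  "cmul c (u + v) = cmul c u + cmul c v" "cmul (c + d) u = cmul c u + cmul d u"
  "cmul (c * d) u = cmul c (cmul d u)" "cmul 1 u = u" "cmul 0 u = 0" "cmul c 0 = 0"
  "cmul (c - d) u = cmul c u - cmul d u"
  by (auto simp: cmul_def prod_eq_iff algebra_simps)

lemma cmul_sum: "cmul c (sum f S) = (\<Sum>x\<in>S. cmul c (f x))"
  by (induction S rule: infinite_finite_induct) (auto simp: cmul_simps)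

definition act :: "('n, 'r) qdata \<Rightarrow> 'n \<Rightarrow> complex \<times> complex \<Rightarrow> complex \<times> complex" where
  "act x k u = cmul (fst u) (x (Inr (k, False))) + cmul (snd u) (x (Inr (k, True)))"

definition commuting :: "('n, 'r) qdata \<Rightarrow> bool" where
  "commuting x \<longleftrightarrow> (\<forall>k l u. act x k (act x l u) = act x l (act x k u))"

lemma act_linear: "act x k (u + v) = act x k u + act x k v" "act x k (cmul c u) = cmul c (act x k u)" "act x k 0 = 0"
  by (auto simp: act_def cmul_def prod_eq_iff algebra_simps)

lemma act_basis: "act x k (1, 0) = x (Inr (k, False))" "act x k (0, 1) = x (Inr (k, True))"
  by (auto simp: act_def cmul_def prod_eq_iff)

text \<open>The operator of the monomial \<open>m\<close>. The fold over the variables is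
  independent of their order when the endomorphisms commute, hence the hypothesis in
  \<open>mact_add_single\<close>.\<close>

definition mact :: "('n::finite, 'r) qdata \<Rightarrow> ('n \<Rightarrow>\<^sub>0 nat) \<Rightarrow> complex \<times> complex \<Rightarrow> complex \<times> complex" where
  "mact x m u = Finite_Set.fold (\<lambda>k. act x k ^^ Poly_Mapping.lookup m k) u UNIV"

lemma commute_funpow:
  assumes "\<And>u. f (g u) = g (f u)"
  shows "(f ^^ i) ((g ^^ j) u) = (g ^^ j) ((f ^^ i) u)"
proof -
  have 1: "f ((g ^^ j) u) = (g ^^ j) (f u)" for u
    by (induction j) (simp_all add: assms)
  show ?thesis by (induction i) (simp_all add: 1)
qed

lemma mact_0:
  fixes x :: "('n::finite, 'r) qdata"
  shows "mact x 0 u = u"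
proof -
  have "Finite_Set.fold (\<lambda>k u. u) u (UNIV :: 'n set) = u"
  proof -
    interpret comp_fun_commute "\<lambda>(k::'n) (u::complex \<times> complex). u" by unfold_locales auto
    have "Finite_Set.fold (\<lambda>k u. u) u S = u" if "finite S" for S :: "'n set"
      using that by induction auto
    then show ?thesis by simp
  qed
  then show ?thesis by (simp add: mact_def id_def)
qed

lemma mact_add_single:
  assumes "commuting x"
  shows "mact x (m + Poly_Mapping.single k 1) u = act x k (mact x m u)"
proof -
  let ?f = "\<lambda>m k. act x k ^^ Poly_Mapping.lookup m k"
  have com: "act x k (act x l u) = act x l (act x k u)" for k l u
    using assms unfolding commuting_def by blast
  have cfc: "comp_fun_commute (?f m)" for m
    by unfold_locales (auto simp: fun_eq_iff intro!: commute_funpow com)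
  have eq: "Finite_Set.fold (?f (m + Poly_Mapping.single k 1)) u S =
      (if k \<in> S then act x k (Finite_Set.fold (?f m) u S) else Finite_Set.fold (?f m) u S)" if "finite S" for S
    using that
  proof induction
    case (insert l S)
    interpret A: comp_fun_commute "?f m" by (rule cfc)
    interpret B: comp_fun_commute "?f (m + Poly_Mapping.single k 1)" by (rule cfc)
    \<comment> \<open>If \<open>k\<close> lies in \<open>S\<close>, the extra factor
      \<open>act x k\<close> sits inside the fold and has to be moved out past the powers of
      \<open>act x l\<close>.\<close>
    have sw: "(act x l ^^ i) (act x k u) = act x k ((act x l ^^ i) u)" for i u
      using commute_funpow[of "act x l" "act x k" i 1, OF com] by simp
    have "Finite_Set.fold (?f m) u (insert l S) = ?f m l (Finite_Set.fold (?f m) u S)"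
      "Finite_Set.fold (?f (m + Poly_Mapping.single k 1)) u (insert l S) =
        ?f (m + Poly_Mapping.single k 1) l (Finite_Set.fold (?f (m + Poly_Mapping.single k 1)) u S)"
      by (rule A.fold_insert[OF insert.hyps] B.fold_insert[OF insert.hyps])+
    moreover have "Poly_Mapping.lookup (m + Poly_Mapping.single k 1) l =
        Poly_Mapping.lookup m l + (if l = k then 1 else 0)"
      by (simp add: lookup_add lookup_single when_def)
    ultimately show ?case using insert.hyps(2) by (simp only: insert.IH) (auto simp: sw)
  qed simp
  show ?thesis using eq[of UNIV] by (simp add: mact_def)
qed

lemma monomial_induct [case_names zero add]:
  fixes m :: "'n \<Rightarrow>\<^sub>0 nat"
  assumes "P 0" "\<And>m k. P m \<Longrightarrow> P (m + Poly_Mapping.single k 1)"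
  shows "P m"
proof (induction "\<Sum>k\<in>Poly_Mapping.keys m. Poly_Mapping.lookup m k" arbitrary: m)
  case 0
  then have "Poly_Mapping.lookup m k = 0" for k
    by (cases "k \<in> Poly_Mapping.keys m") (auto simp: in_keys_iff)
  then have "m = 0" by (intro poly_mapping_eqI) simp
  then show ?case using assms by simp
next
  case (Suc d)
  then obtain k where k: "k \<in> Poly_Mapping.keys m" by (metis sum.empty ex_in_conv nat.simps(3))
  define m' where "m' = m - Poly_Mapping.single k 1"
  have lk: "Poly_Mapping.lookup m' l = Poly_Mapping.lookup m l - (if l = k then 1 else 0)" for l
    by (simp add: m'_def lookup_minus lookup_single when_def)
  have m: "m = m' + Poly_Mapping.single k 1"
    using k by (intro poly_mapping_eqI) (auto simp: lookup_add lk lookup_single when_def in_keys_iff)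
  have "(\<Sum>l\<in>Poly_Mapping.keys m'. Poly_Mapping.lookup m' l) = (\<Sum>l\<in>Poly_Mapping.keys m. Poly_Mapping.lookup m' l)"
    by (intro sum.mono_neutral_left) (auto simp: in_keys_iff lk)
  moreover have "(\<Sum>l\<in>Poly_Mapping.keys m. Poly_Mapping.lookup m l) =
      (\<Sum>l\<in>Poly_Mapping.keys m. Poly_Mapping.lookup m' l) + (\<Sum>l\<in>Poly_Mapping.keys m. if l = k then 1 else 0)"
    by (subst sum.distrib[symmetric], intro sum.cong) (use k in \<open>auto simp: lk in_keys_iff\<close>)
  ultimately have "d = (\<Sum>l\<in>Poly_Mapping.keys m'. Poly_Mapping.lookup m' l)"
    using Suc(2) k by (simp add: sum.delta)
  from Suc(1)[OF this] show ?case using assms(2) m by metis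
qed

text \<open>For commuting \<open>x\<close> this is the homomorphism of modules over the polynomial
  ring that sends the \<open>l\<close>-th basis vector to \<open>x (Inl l)\<close>, the variables
  acting on \<complex>^2 through \<open>act\<close>.\<close>

definition eval_at :: "('n::finite, 'r::finite) qdata \<Rightarrow> ('n, complex) mpoly ^ 'r \<Rightarrow> complex \<times> complex" where
  "eval_at x w = (\<Sum>l\<in>UNIV. \<Sum>m\<in>Poly_Mapping.keys (w $ l). cmul (Poly_Mapping.lookup (w $ l) m) (mact x m (x (Inl l))))"

lemma eval_at_superset:
  fixes w :: "('n::finite, complex) mpoly ^ 'r::finite"
  assumes "finite S" "\<And>l. Poly_Mapping.keys (w $ l) \<subseteq> S"
  shows "eval_at x w = (\<Sum>l\<in>UNIV. \<Sum>m\<in>S. cmul (Poly_Mapping.lookup (w $ l) m) (mact x m (x (Inl l))))"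
  unfolding eval_at_def using assms
  by (intro sum.cong sum.mono_neutral_left) (auto simp: in_keys_iff cmul_simps)

lemma eval_at_add: "eval_at x (v + w) = eval_at x v + eval_at x w"
proof -
  let ?S = "(\<Union>l. Poly_Mapping.keys (v $ l)) \<union> (\<Union>l. Poly_Mapping.keys (w $ l))"
  have "Poly_Mapping.keys ((v + w) $ l) \<subseteq> ?S" for l
    using Poly_Mapping.keys_add[of "v $ l" "w $ l"] by auto
  moreover have "finite ?S" by simp
  ultimately show ?thesis
    by (subst (1 2 3) eval_at_superset[of ?S]) (auto simp: lookup_add cmul_simps sum.distrib)
qed

lemma eval_at_0: "eval_at x 0 = 0"
  using eval_at_add[of x 0 0] by simp

lemma eval_at_diff: "eval_at x (v - w) = eval_at x v - eval_at x w"
  using eval_at_add[of x "v - w" w] by simp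

lemma eval_at_mconst:
  fixes w :: "('n::finite, complex) mpoly ^ 'r::finite"
  shows "eval_at x (mconst c *s w) = cmul c (eval_at x w)"
proof -
  let ?S = "\<Union>l. Poly_Mapping.keys (w $ l)"
  have l: "Poly_Mapping.lookup (mconst c * f) m = c * Poly_Mapping.lookup f m" for f :: "('n, complex) mpoly" and m
    by (induction f rule: poly_mapping_add_induct)
      (simp_all add: mconst_def mult_single lookup_single when_def distrib_left lookup_add)
  have "Poly_Mapping.keys ((mconst c *s w) $ l) \<subseteq> ?S" for l
    by (auto simp: in_keys_iff l)
  moreover have "finite ?S" by simp
  ultimately show ?thesis
    by (subst (1 2) eval_at_superset[of ?S]) (auto simp: l cmul_simps cmul_sum in_keys_iff)
qed

lemma eval_at_monomial: "eval_at x (axis l (Poly_Mapping.single m 1)) = mact x m (x (Inl l))"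
proof -
  have "(\<Sum>i\<in>Poly_Mapping.keys (axis l (Poly_Mapping.single m (1::complex)) $ l').
      cmul (Poly_Mapping.lookup (axis l (Poly_Mapping.single m (1::complex)) $ l') i) (mact x i (x (Inl l')))) =
      (if l' = l then mact x m (x (Inl l)) else 0)" for l'
    by (simp add: axis_def cmul_simps)
  then show ?thesis by (simp add: eval_at_def)
qed

lemma mvar_monomial: "mvar k *s axis l (Poly_Mapping.single m 1) =
    axis l (Poly_Mapping.single (m + Poly_Mapping.single k 1) (1::'a::comm_ring_1))"
  by (simp add: vec_eq_iff axis_def mvar_def mult_single add.commute)

lemma eval_at_mvar:
  assumes "commuting x"
  shows "eval_at x (mvar k *s w) = act x k (eval_at x w)"
proof (induction w rule: vec_mpoly_induct)
  case (1 i m)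
  have "mvar k *s (mconst (Poly_Mapping.lookup (w $ i) m) *s axis i (Poly_Mapping.single m 1)) =
      mconst (Poly_Mapping.lookup (w $ i) m) *s (mvar k *s axis i (Poly_Mapping.single m 1))"
    by (simp add: vector_smult_assoc mult.commute)
  then show ?case
    by (simp add: eval_at_mconst mvar_monomial eval_at_monomial mact_add_single[OF assms] act_linear del: One_nat_def)
qed (simp_all add: eval_at_0 act_linear eval_at_add Modules.module.scale_right_distrib[OF module_vec])

lemma single_eq_mconst_mult: "Poly_Mapping.single m c = mconst c * Poly_Mapping.single m (1::'a::comm_ring_1)"
  by (simp add: mconst_def mult_single)

definition point :: "('n::finite, 'r::finite) qdata \<Rightarrow> (('n, complex) mpoly ^ 'r) set" where
  "point x = {w. eval_at x w = 0}"

text \<open>\<open>eval_at\<close> intertwines a variable with an endomorphism, so the kernel is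
  stable under variables; induction extends this to monomials and additivity to polynomials.\<close>

lemma subspace_point:
  assumes "commuting x"
  shows "module.subspace (*s) (point x)"
proof (rule Modules.module.subspaceI[OF module_vec])
  show "c *s w \<in> point x" if "w \<in> point x" for c w
  proof -
    have mono: "eval_at x (Poly_Mapping.single m 1 *s w) = 0" for m
    proof (induction m rule: monomial_induct)
      case zero
      then show ?case using that by (simp add: point_def)
    next
      case (add m k)
      have "Poly_Mapping.single (m + Poly_Mapping.single k 1) 1 *s w = mvar k *s (Poly_Mapping.single m 1 *s w)"
        by (simp add: vector_smult_assoc mvar_def mult_single add.commute)
      then show ?case by (simp add: eval_at_mvar[OF assms] add act_linear)
    qed
    have "eval_at x (c *s w) = 0"
    proof (induction c rule: poly_mapping_add_induct)
      case (1 m a)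
      have "Poly_Mapping.single m a *s w = mconst a *s (Poly_Mapping.single m 1 *s w)"
        by (subst single_eq_mconst_mult) (simp add: vector_smult_assoc)
      then show ?case by (simp add: eval_at_mconst mono cmul_simps)
    qed (simp add: eval_at_add Modules.module.scale_left_distrib[OF module_vec])
    then show ?thesis by (simp add: point_def)
  qed
qed (auto simp: point_def eval_at_0 eval_at_add)

text \<open>Sending \<open>b\<close> to the standard basis selects one representative from each
  orbit of base changes of \<complex>^2, so points of the chart correspond to these data without
  passing to a quotient.\<close>

definition chart_data :: "(('n::finite, complex) mpoly ^ 'r::finite) \<times> (('n, complex) mpoly ^ 'r) \<Rightarrow> ('n, 'r) qdata set" where
  "chart_data b = {x. commuting x \<and> eval_at x (fst b) = (1, 0) \<and> eval_at x (snd b) = (0, 1)}"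

definition to_data :: "(('n::finite, complex) mpoly ^ 'r::finite) \<times> (('n, complex) mpoly ^ 'r) \<Rightarrow>
    (('n, complex) mpoly ^ 'r) set \<Rightarrow> ('n, 'r) qdata" where
  "to_data b K = (\<lambda>i. case i of Inl l \<Rightarrow> coords b K (axis l 1)
     | Inr kj \<Rightarrow> coords b K (mvar (fst kj) *s (if snd kj then snd b else fst b)))"

lemma eval_at_comb: "x \<in> chart_data b \<Longrightarrow> eval_at x (comb b y) = y"
  by (simp add: chart_data_def comb_def eval_at_add eval_at_mconst cmul_def)

lemma point_in_chart:
  assumes "x \<in> chart_data b"
  shows "point x \<in> chart b" and "coords b (point x) w = eval_at x w"
proof -
  have mem: "w - comb b (eval_at x w) \<in> point x" for w
    by (simp add: point_def eval_at_diff eval_at_comb[OF assms])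
  show *: "point x \<in> chart b"
    unfolding chart_def mem_Collect_eq
  proof (intro conjI allI impI)
    show "module.subspace (*s) (point x)" using assms by (simp add: chart_data_def subspace_point)
    show "\<exists>y. w - comb b y \<in> point x" for w using mem by blast
    show "y = 0" if "comb b y \<in> point x" for y using that by (simp add: point_def eval_at_comb[OF assms])
  qed
  show "coords b (point x) w = eval_at x w" by (rule coords_eqI[OF * mem])
qed

lemma eval_at_axis: "eval_at x (axis l 1) = x (Inl l)"
  using eval_at_monomial[of x l 0] by (simp add: mact_0)

lemma to_data_point:
  assumes "x \<in> chart_data b"
  shows "to_data b (point x) = x"
proof
  fix i
  have "commuting x" using assms by (simp add: chart_data_def)
  then show "to_data b (point x) i = x i"
    using assms unfolding to_data_def point_in_chart(2)[OF assms]
    by (auto simp: eval_at_axis eval_at_mvar chart_data_def act_basis split: sum.split)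
qed

text \<open>Multiplication by the variables descends to the quotient by the submodule
  \<open>K\<close>, and its matrices inherit commutativity from the polynomial ring. Taking
  coordinates in the quotient is then evaluation at \<open>to_data b K\<close>, and the kernel of
  this is \<open>K\<close>.\<close>

lemma
  assumes K: "K \<in> chart b"
  shows to_data_in_chart: "to_data b K \<in> chart_data b"
    and point_to_data: "point (to_data b K) = K"
    and eval_at_to_data: "eval_at (to_data b K) w = coords b K w"
proof -
  let ?x = "to_data b K"
  have scale: "coords b K (mconst c *s w) = cmul c (coords b K w)" for c w
    by (simp add: coords_scale[OF K] cmul_def)
  \<comment> \<open>Replacing \<open>w\<close> by its combination of \<open>b\<close> changes
    \<open>mvar k *s w\<close> by an element of \<open>K\<close>.\<close>
  have mvar: "coords b K (mvar k *s w) = act ?x k (coords b K w)" for k w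
  proof -
    have "mvar k *s w - mvar k *s comb b (coords b K w) \<in> K"
      using chart_subspace(4)[OF K coords_mem[OF K, of w], of "mvar k"]
      by (simp add: Modules.module.scale_right_diff_distrib[OF module_vec])
    then have "coords b K (mvar k *s w) = coords b K (mvar k *s comb b (coords b K w))"
      using coords_eq_0_iff[OF K] coords_diff[OF K] by (metis eq_iff_diff_eq_0)
    also have "mvar k *s comb b (coords b K w) = mconst (fst (coords b K w)) *s (mvar k *s fst b) + mconst (snd (coords b K w)) *s (mvar k *s snd b)"
      by (simp add: comb_def Modules.module.scale_right_distrib[OF module_vec] vector_smult_assoc mult.commute)
    also have "coords b K \<dots> = act ?x k (coords b K w)"
      by (simp add: coords_add[OF K] scale act_def to_data_def)
    finally show ?thesis .
  qed
  have com: "commuting ?x"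
    unfolding commuting_def
  proof (intro allI)
    fix k l u
    have u: "coords b K (comb b u) = u" by (simp add: coords_comb[OF K] coords_basis[OF K])
    have "mvar k *s (mvar l *s comb b u) = mvar l *s (mvar k *s comb b u)"
      by (simp add: vector_smult_assoc mult.commute)
    then show "act ?x k (act ?x l u) = act ?x l (act ?x k u)"
      using mvar u by metis
  qed
  have mono: "coords b K (axis l (Poly_Mapping.single m 1)) = mact ?x m (?x (Inl l))" for l m
  proof (induction m rule: monomial_induct)
    case zero
    have "Poly_Mapping.single 0 1 = (1 :: ('n, complex) mpoly)" by simp
    then show ?case by (simp add: mact_0 to_data_def)
  next
    case (add m k)
    then show ?case
      using mvar[of k "axis l (Poly_Mapping.single m 1)"] by (simp add: mvar_monomial mact_add_single[OF com] del: One_nat_def)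
  qed
  show ev: "eval_at ?x w = coords b K w" for w
  proof (induction w rule: vec_mpoly_induct)
    case 2
    show ?case using coords_eq_0_iff[OF K, of 0] chart_subspace(1)[OF K] by (simp add: eval_at_0)
  qed (simp_all add: eval_at_mconst scale eval_at_monomial mono eval_at_add coords_add[OF K])
  show "?x \<in> chart_data b"
    by (simp add: chart_data_def com ev coords_basis[OF K])
  show "point ?x = K"
    by (auto simp: point_def ev coords_eq_0_iff[OF K])
qed

lemma continuous_map_to_data:
  "continuous_map (subtopology (quot_space 2) (chart b)) (top_of_set (chart_data b)) (to_data b)"
proof -
  have "continuous_map (subtopology (quot_space 2) (chart b)) euclidean (\<lambda>K. to_data b K i)" for i
    by (cases i) (simp_all add: to_data_def continuous_map_coords)
  then have "continuous_map (subtopology (quot_space 2) (chart b)) euclidean (to_data b)"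
    by (simp flip: euclidean_product_topology add: continuous_map_componentwise_UNIV)
  moreover have "to_data b \<in> chart b \<rightarrow> chart_data b" using to_data_in_chart by blast
  ultimately show ?thesis by (auto simp: continuous_map_in_subtopology)
qed

text \<open>Agreement is asked on \<open>A\<close> only, because the operators of monomials are
  polynomial functions of the data where these commute.\<close>

definition polyfun :: "(nat \<Rightarrow> complex) set \<Rightarrow> ((nat \<Rightarrow> complex) \<Rightarrow> complex) \<Rightarrow> bool" where
  "polyfun A q \<longleftrightarrow> (\<exists>a. \<forall>p\<in>A. mpoly_eval p a = q p)"

lemma mpoly_eval_mvar: "mpoly_eval p (mvar i) = p i"
  by (simp add: mvar_def mpoly_eval_single mono_eval_def)

lemma polyfun_const: "polyfun A (\<lambda>p. c)"
  unfolding polyfun_def by (rule exI[of _ "mconst c"]) (simp add: mpoly_eval_mconst)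

lemma polyfun_coordinate: "polyfun A (\<lambda>p. p i)"
  unfolding polyfun_def by (rule exI[of _ "mvar i"]) (simp add: mpoly_eval_mvar)

lemma polyfun_eval: "polyfun A (\<lambda>p. mpoly_eval p a)"
  unfolding polyfun_def by (rule exI[of _ a]) simp

lemma polyfun_binary:
  assumes "polyfun A q" "polyfun A q'"
  shows "polyfun A (\<lambda>p. q p + q' p)" "polyfun A (\<lambda>p. q p - q' p)" "polyfun A (\<lambda>p. q p * q' p)"
proof -
  obtain a a' where "\<And>p. p \<in> A \<Longrightarrow> mpoly_eval p a = q p" "\<And>p. p \<in> A \<Longrightarrow> mpoly_eval p a' = q' p"
    using assms unfolding polyfun_def by blast
  then show "polyfun A (\<lambda>p. q p + q' p)" "polyfun A (\<lambda>p. q p - q' p)" "polyfun A (\<lambda>p. q p * q' p)"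
    unfolding polyfun_def
    by (intro exI[of _ "a + a'"] exI[of _ "a - a'"] exI[of _ "a * a'"];
        simp add: mpoly_eval_add mpoly_eval_diff mpoly_eval_mult)+
qed

lemmas polyfun_intros = polyfun_const polyfun_coordinate polyfun_eval polyfun_binary

definition polyfun2 :: "(nat \<Rightarrow> complex) set \<Rightarrow> ((nat \<Rightarrow> complex) \<Rightarrow> complex \<times> complex) \<Rightarrow> bool" where
  "polyfun2 A q \<longleftrightarrow> polyfun A (\<lambda>p. fst (q p)) \<and> polyfun A (\<lambda>p. snd (q p))"

lemma polyfun2_intros:
  "polyfun2 A (\<lambda>p. c)"
  "polyfun2 A q \<Longrightarrow> polyfun2 A q' \<Longrightarrow> polyfun2 A (\<lambda>p. q p + q' p)"
  "polyfun2 A q \<Longrightarrow> polyfun2 A q' \<Longrightarrow> polyfun2 A (\<lambda>p. q p - q' p)"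
  "polyfun A q0 \<Longrightarrow> polyfun2 A q' \<Longrightarrow> polyfun2 A (\<lambda>p. cmul (q0 p) (q' p))"
  unfolding polyfun2_def cmul_def by (simp_all add: polyfun_const polyfun_binary)

lemma polyfun2_cong: "(\<And>p. p \<in> A \<Longrightarrow> q p = q' p) \<Longrightarrow> polyfun2 A q = polyfun2 A q'"
  by (simp add: polyfun2_def polyfun_def)

lemma polyfun2_act:
  assumes "\<And>i. polyfun2 A (\<lambda>p. x p i)" "polyfun2 A q"
  shows "polyfun2 A (\<lambda>p. act (x p) k (q p))"
  unfolding act_def using assms by (intro polyfun2_intros) (simp_all add: polyfun2_def)

lemma polyfun2_mact:
  assumes "\<And>i. polyfun2 A (\<lambda>p. x p i)" "polyfun2 A q" "\<And>p. p \<in> A \<Longrightarrow> commuting (x p)"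
  shows "polyfun2 A (\<lambda>p. mact (x p) m (q p))"
proof (induction m rule: monomial_induct)
  case zero
  then show ?case using assms(2) by (simp add: mact_0)
next
  case (add m k)
  have "polyfun2 A (\<lambda>p. act (x p) k (mact (x p) m (q p)))"
    by (rule polyfun2_act[OF assms(1) add])
  then show ?case
    by (subst polyfun2_cong[OF mact_add_single[OF assms(3)]]) auto
qed

lemma polyfun2_eval_at:
  assumes "\<And>i. polyfun2 A (\<lambda>p. x p i)" "\<And>p. p \<in> A \<Longrightarrow> commuting (x p)"
  shows "polyfun2 A (\<lambda>p. eval_at (x p) (specialize p w))"
proof (induction w rule: vec_mpoly_induct)
  case (1 i m)
  let ?c = "Poly_Mapping.lookup (w $ i) m"
  have "specialize p (axis i (Poly_Mapping.single m 1)) = axis i (Poly_Mapping.single m 1)" for p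
    by (simp add: specialize_def vec_eq_iff axis_def mpoly_eval_0 mpoly_eval_1 poly_mapping_eq_iff fun_eq_iff lookup_map_eval lookup_single when_def)
  then have "eval_at (x p) (specialize p (mconst ?c *s axis i (Poly_Mapping.single m 1))) =
      cmul (mpoly_eval p ?c) (mact (x p) m (x p (Inl i)))" for p
    by (simp add: specialize_scale map_eval_mconst eval_at_mconst eval_at_monomial)
  then show ?case
    using assms by (simp add: polyfun2_intros polyfun_intros polyfun2_mact)
qed (simp_all add: specialize_0 eval_at_0 specialize_add eval_at_add polyfun2_intros)

lemma finite_inj_nat: "\<exists>f :: 'c::finite \<Rightarrow> nat. inj f"
  using finite_imp_inj_to_nat_seg[OF finite[of "UNIV :: 'c set"]] by blast

lemma specialize_mconst_scale: "specialize p (mconst a *s w) = mconst (mpoly_eval p a) *s specialize p w"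
  by (simp add: specialize_scale map_eval_mconst)

text \<open>The universal family is taken over the vanishing ideal of the set of complex points, so that
  all of its properties can be checked fibrewise.\<close>

lemma openin_point_preimage:
  fixes b :: "(('n::finite, complex) mpoly ^ 'r::finite) \<times> (('n, complex) mpoly ^ 'r)"
  assumes U: "openin (quot_space 2) U"
  shows "openin (top_of_set (chart_data b)) {x \<in> chart_data b. point x \<in> U}"
proof -
  \<comment> \<open>The complex coordinates of the data are numbered: \<open>emb\<close> places them
    in a sequence padded with zeros, and \<open>dec\<close> reads them back.\<close>
  obtain enc :: "('r + 'n \<times> bool) \<times> bool \<Rightarrow> nat" where enc: "inj enc" using finite_inj_nat by blast
  define dec :: "(nat \<Rightarrow> complex) \<Rightarrow> ('n, 'r) qdata" where "dec p i = (p (enc (i, False)), p (enc (i, True)))" for p i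
  define emb :: "('n, 'r) qdata \<Rightarrow> nat \<Rightarrow> complex"
    where "emb x j = (if j \<in> range enc then (let (i, s) = inv_into UNIV enc j in if s then snd (x i) else fst (x i)) else 0)" for x j
  have dec_emb: "dec (emb x) = x" for x by (simp add: fun_eq_iff dec_def emb_def inv_into_f_f[OF enc])
  \<comment> \<open>\<open>Z\<close> is the copy of \<open>chart_data b\<close> among the sequences,
    \<open>I\<close> its vanishing ideal and \<open>K\<close> the family whose fibre at
    \<open>p\<close> shall be \<open>point (dec p)\<close>.\<close>
  define Z where "Z = {p. (\<forall>j. j \<notin> range enc \<longrightarrow> p j = 0) \<and> dec p \<in> chart_data b}"
  define I where "I = {f. \<forall>p\<in>Z. mpoly_eval p f = 0}"
  define K where "K = {w. \<forall>p\<in>Z. specialize p w \<in> point (dec p)}"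
  have Z: "dec p \<in> chart_data b" if "p \<in> Z" for p using that by (simp add: Z_def)
  have dec_poly: "polyfun2 A (\<lambda>p. dec p i)" for A i
    by (simp add: polyfun2_def dec_def polyfun_intros)
  \<comment> \<open>A polynomial function that vanishes on \<open>Z\<close> comes from an element of
    \<open>I\<close>, so it still vanishes on \<open>zero_locus I\<close>. In this way the equations
    defining \<open>Z\<close> carry over, and \<open>Z\<close> is Zariski closed.\<close>
  have vanish: "q p = 0" if q: "polyfun A q" "Z \<subseteq> A" "\<And>p. p \<in> Z \<Longrightarrow> q p = 0" and p: "p \<in> zero_locus I" "p \<in> A" for A q p
  proof -
    obtain a where a: "\<And>p. p \<in> A \<Longrightarrow> mpoly_eval p a = q p" using q(1) unfolding polyfun_def by blast
    then have "a \<in> I" using q by (auto simp: I_def)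
    then show ?thesis using p a by (auto simp: zero_locus_def)
  qed
  have vanish2: "q p = c" if q: "polyfun2 A q" "Z \<subseteq> A" "\<And>p. p \<in> Z \<Longrightarrow> q p = c" and p: "p \<in> zero_locus I" "p \<in> A" for A q p c
  proof -
    have "polyfun A (\<lambda>p. fst (q p) - fst c)" "polyfun A (\<lambda>p. snd (q p) - snd c)"
      using q(1) by (simp_all add: polyfun2_def polyfun_binary(2) polyfun_const)
    from vanish[OF this(1) q(2) _ p] vanish[OF this(2) q(2) _ p] q(3) show ?thesis by (simp add: prod_eq_iff)
  qed
  have ZI: "zero_locus I = Z"
  proof
    show "Z \<subseteq> zero_locus I" by (auto simp: zero_locus_def I_def)
    show "zero_locus I \<subseteq> Z"
    proof
      fix p assume p: "p \<in> zero_locus I"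
      have 1: "p j = 0" if "j \<notin> range enc" for j
        by (rule vanish[of UNIV "\<lambda>p. p j", OF _ _ _ p]) (use that in \<open>auto simp: polyfun_intros Z_def\<close>)
      \<comment> \<open>Commutation comes first, as \<open>ev\<close> below establishes
        polynomiality of evaluation on the commuting locus only.\<close>
      have 2: "commuting (dec p)"
        unfolding commuting_def
      proof (intro allI)
        fix k l u
        have zc: "act (dec p) k (act (dec p) l u) - act (dec p) l (act (dec p) k u) = 0" if "p \<in> Z" for p
        proof -
          have "commuting (dec p)" using Z[OF that] by (simp add: chart_data_def)
          then have "act (dec p) k (act (dec p) l u) = act (dec p) l (act (dec p) k u)"
            unfolding commuting_def by blast
          then show ?thesis by simp
        qed
        have "act (dec p) k (act (dec p) l u) - act (dec p) l (act (dec p) k u) = 0"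
          by (rule vanish2[of UNIV "\<lambda>p. act (dec p) k (act (dec p) l u) - act (dec p) l (act (dec p) k u)", OF _ _ _ p])
            (use zc in \<open>auto intro!: polyfun2_intros polyfun2_act dec_poly\<close>)
        then show "act (dec p) k (act (dec p) l u) = act (dec p) l (act (dec p) k u)" by simp
      qed
      have ev: "polyfun2 {p. commuting (dec p)} (\<lambda>p. eval_at (dec p) w)" for w
      proof -
        have "polyfun2 {p. commuting (dec p)} (\<lambda>p. eval_at (dec p) (specialize p (const_lift w)))"
          by (rule polyfun2_eval_at) (simp_all only: dec_poly mem_Collect_eq)
        then show ?thesis by (simp only: specialize_const_lift)
      qed
      have sub: "Z \<subseteq> {p. commuting (dec p)}" and "\<And>p. p \<in> Z \<Longrightarrow> eval_at (dec p) (fst b) = (1, 0)"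
        "\<And>p. p \<in> Z \<Longrightarrow> eval_at (dec p) (snd b) = (0, 1)"
        using Z unfolding chart_data_def by blast+
      then have "eval_at (dec p) (fst b) = (1, 0)" "eval_at (dec p) (snd b) = (0, 1)"
        using vanish2[OF ev sub _ p] 2 by blast+
      with 1 2 show "p \<in> Z" by (simp add: Z_def chart_data_def)
    qed
  qed
  have fin: "finite_type_ideal I"
    unfolding finite_type_ideal_def
  proof
    show "ideal I ring_of_type_algebra"
      by (rule ideal_typeI) (auto simp: I_def mpoly_eval_0 mpoly_eval_add mpoly_eval_mult)
    obtain M where "\<And>j. j \<in> range enc \<Longrightarrow> j < M"
      using finite_nat_set_iff_bounded[of "range enc"] finite_imageI[OF finite, of enc] by blast
    then have "i \<notin> range enc" if "i \<ge> M" for i using that by (meson not_le)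
    then have "mvar i \<in> I" if "i \<ge> M" for i
      using that unfolding I_def Z_def by (simp add: mpoly_eval_mvar)
    then show "\<exists>m. \<forall>i\<ge>m. mvar i \<in> I" by blast
  qed
  have sub: "module.subspace (*s) (point (dec p))" if "p \<in> Z" for p
    by (rule subspace_point) (use Z[OF that] in \<open>simp add: chart_data_def\<close>)
  define B where "B = (const_lift (fst b), const_lift (snd b))"
  have B: "specialize2 p B = b" for p by (simp add: B_def specialize_const_lift)
  \<comment> \<open>The coefficients are polynomials whose values on \<open>Z\<close> are the
    coordinates of the evaluation; membership in \<open>K\<close> is a condition on the fibres, so
    these values decide it.\<close>
  have span: "\<exists>a. w - comb B a \<in> K \<and> (\<forall>p\<in>Z. ev2 p a = eval_at (dec p) (specialize p w))" for w
  proof -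
    have "polyfun2 Z (\<lambda>p. eval_at (dec p) (specialize p w))"
      using Z by (intro polyfun2_eval_at dec_poly) (simp add: chart_data_def)
    then obtain a a' where a: "\<And>p. p \<in> Z \<Longrightarrow> mpoly_eval p a = fst (eval_at (dec p) (specialize p w))"
       "\<And>p. p \<in> Z \<Longrightarrow> mpoly_eval p a' = snd (eval_at (dec p) (specialize p w))"
      unfolding polyfun2_def polyfun_def by blast
    then have "w - comb B (a, a') \<in> K"
      by (simp add: K_def point_def specialize_diff specialize_comb B eval_at_diff eval_at_comb[OF Z])
    with a show ?thesis by (intro exI[of _ "(a, a')"]) simp
  qed
  have KQ: "K \<in> quot_functor 2 I"
    unfolding quot_functor_def mem_Collect_eq
  proof (intro conjI ballI allI)
    show "module.subspace (*s) K"
    proof (rule Modules.module.subspaceI[OF module_vec])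
      show "0 \<in> K" by (simp add: K_def specialize_0 point_def eval_at_0)
      show "v + w \<in> K" if "v \<in> K" "w \<in> K" for v w
        using that by (simp add: K_def specialize_add point_def eval_at_add)
      show "c *s w \<in> K" if "w \<in> K" for c w
        using that unfolding K_def
        by (auto simp: specialize_scale intro: Modules.module.subspace_scale[OF module_vec sub])
    qed
    show "mconst a *s w \<in> K" if "a \<in> I" for a w
      using that by (simp add: K_def I_def specialize_mconst_scale point_def eval_at_mconst cmul_simps)
    \<comment> \<open>The lifted pair \<open>B\<close> is a basis of the whole family, so the open
      set can be all of the base, with \<open>f = 1\<close>.\<close>
    have "free_on_basic_open 2 I K 1"
      unfolding free_on_basic_open_def
    proof (intro exI[of _ "\<lambda>j::nat. if j = 0 then fst B else snd B"] conjI allI impI)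
      fix w
      obtain a where a: "w - comb B a \<in> K" using span by blast
      show "\<exists>N a. mconst (1 ^ N) *s w - (\<Sum>j<(2::nat). mconst (a j) *s (if j = 0 then fst B else snd B)) \<in> K"
        using a by (intro exI[of _ 0] exI[of _ "\<lambda>j. if j = 0 then fst a else snd a"])
          (simp add: sum_lessThan_2 comb_def mconst_simps)
    next
      fix a :: "nat \<Rightarrow> (nat, complex) mpoly" and j :: nat
      assume "(\<Sum>j<2. mconst (a j) *s (if j = 0 then fst B else snd B)) \<in> K" and j: "j < 2"
      then have "comb B (a 0, a 1) \<in> K" by (simp add: sum_lessThan_2 comb_def)
      then have "ev2 p (a 0, a 1) = 0" if "p \<in> Z" for p
        using that by (simp add: K_def specialize_comb B point_def eval_at_comb[OF Z])
      then have "mpoly_eval p (a 0) = 0 \<and> mpoly_eval p (a 1) = 0" if "p \<in> Z" for p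
        using that unfolding zero_prod_def by simp
      then have "a 0 \<in> I" "a 1 \<in> I" unfolding I_def by blast+
      then have "a j \<in> I" using j by (cases j) auto
      then show "\<exists>N. 1 ^ N * a j \<in> I" by simp
    qed
    then show "genideal ring_of_type_algebra (I \<union> {f. free_on_basic_open 2 I K f}) = UNIV"
      unfolding genideal_type_UNIV_iff by blast
  qed
  have fibre: "family_fibre p K = point (dec p)" if p: "p \<in> Z" for p
  proof
    show "family_fibre p K \<subseteq> point (dec p)" using p by (auto simp: family_fibre_def K_def)
    \<comment> \<open>The constant lift of \<open>u\<close> is corrected by a combination of
      \<open>B\<close> whose coefficients vanish at \<open>p\<close>; this puts it into
      \<open>K\<close> and leaves its value at \<open>p\<close> unchanged.\<close>
    show "point (dec p) \<subseteq> family_fibre p K"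
    proof
      fix u assume u: "u \<in> point (dec p)"
      obtain a where a: "const_lift u - comb B a \<in> K" "ev2 p a = eval_at (dec p) (specialize p (const_lift u))"
        using span p by blast
      then have "ev2 p a = 0" using u by (simp add: specialize_const_lift point_def)
      then have "specialize p (const_lift u - comb B a) = u"
        by (simp add: specialize_diff specialize_comb specialize_const_lift comb_0)
      then show "u \<in> family_fibre p K" using a(1) unfolding family_fibre_def by force
    qed
  qed
  have "openin (top_of_set Z) {p \<in> Z. family_fibre p K \<in> U}"
  proof -
    have "quot_open 2 U" using U by (simp only: openin_quot_space)
    then have "openin (top_of_set (zero_locus I)) {p \<in> zero_locus I. family_fibre p K \<in> U}"
      unfolding quot_open_def using fin KQ by blast
    then show ?thesis by (simp only: ZI)
  qed
  moreover have "{p \<in> Z. family_fibre p K \<in> U} = {p \<in> Z. point (dec p) \<in> U}" using fibre by auto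
  ultimately have op: "openin (top_of_set Z) {p \<in> Z. point (dec p) \<in> U}" by simp
  have "continuous_on A (\<lambda>x. emb x j)" for A j
  proof (cases "j \<in> range enc")
    case True
    obtain i s where "inv_into UNIV enc j = (i, s)" by force
    with True show ?thesis
      using continuous_on_fst[OF continuous_on_coord[of A i]] continuous_on_snd[OF continuous_on_coord[of A i]]
      by (cases s) (simp_all add: emb_def)
  qed (simp add: emb_def)
  then have "continuous_on (chart_data b) emb" by (intro continuous_on_coordinatewise_then_product)
  moreover have embZ: "emb x \<in> Z" if "x \<in> chart_data b" for x
    unfolding Z_def using that by (simp add: dec_emb) (simp add: emb_def)
  ultimately have "openin (top_of_set (chart_data b)) (chart_data b \<inter> emb -` {p \<in> Z. point (dec p) \<in> U})"
    using op by (intro continuous_openin_preimage[where T = Z]) auto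
  moreover have "chart_data b \<inter> emb -` {p \<in> Z. point (dec p) \<in> U} = {x \<in> chart_data b. point x \<in> U}"
    using embZ by (auto simp: dec_emb)
  ultimately show ?thesis by simp
qed

text \<open>\<open>to_data\<close> is continuous because coordinates are continuous on every family,
  and \<open>point\<close> because open sets are in particular tested on the universal
  family.\<close>

theorem homeomorphic_maps_chart:
  "homeomorphic_maps (subtopology (quot_space 2) (chart b)) (top_of_set (chart_data b)) (to_data b) point"
  unfolding homeomorphic_maps_def topspace_chart
proof (intro conjI ballI)
  have pc: "point x \<in> chart b" if "x \<in> chart_data b" for x by (rule point_in_chart(1)[OF that])
  show "continuous_map (top_of_set (chart_data b)) (subtopology (quot_space 2) (chart b)) point"
    unfolding continuous_map_def topspace_chart
  proof (intro conjI allI impI)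
    fix U assume "openin (subtopology (quot_space 2) (chart b)) U"
    then have "openin (quot_space 2) U" using openin_chart openin_trans_full by blast
    then show "openin (top_of_set (chart_data b)) {x \<in> topspace (top_of_set (chart_data b)). point x \<in> U}"
      using openin_point_preimage by simp
  qed (use pc in auto)
qed (auto simp: continuous_map_to_data point_to_data to_data_point)

section \<open>The cells\<close>

lemma point_in_other_chart:
  assumes "x \<in> chart_data b"
  shows "point x \<in> chart b' \<longleftrightarrow> det2 (eval_at x (fst b')) (eval_at x (snd b')) \<noteq> 0"
  using chart_iff_det[OF point_in_chart(1)[OF assms], of b'] by (simp only: point_in_chart(2)[OF assms])

text \<open>Transfers \<open>relative_homology_cone\<close> to a chart: \<open>f\<close> and
  \<open>g\<close> are mutually inverse parametrizations, under which \<open>W\<close> becomes the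
  complement of the common zeros of the coordinates in \<open>J\<close>.\<close>

lemma relative_homology_chart:
  fixes E :: "('c \<Rightarrow> complex) set"
    and b :: "(('n::finite, complex) mpoly ^ 'r::finite) \<times> (('n, complex) mpoly ^ 'r)"
  assumes J: "finite J"
    and scale: "\<And>y t. y \<in> E \<Longrightarrow> 0 \<le> t \<Longrightarrow> t \<le> 1 \<Longrightarrow> (\<lambda>i. if i \<in> J then y i else of_real t * y i) \<in> E"
    and supp: "\<And>y. (\<And>i. i \<notin> J \<Longrightarrow> y i = 0) \<Longrightarrow> y \<in> E"
    and cont: "continuous_on E f" "continuous_on (chart_data b) g"
    and f: "\<And>y. y \<in> E \<Longrightarrow> f y \<in> chart_data b" and g: "\<And>x. x \<in> chart_data b \<Longrightarrow> g x \<in> E"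
    and gf: "\<And>y. y \<in> E \<Longrightarrow> g (f y) = y" and fg: "\<And>x. x \<in> chart_data b \<Longrightarrow> f (g x) = x"
    and W: "\<And>y. y \<in> E \<Longrightarrow> point (f y) \<notin> W \<longleftrightarrow> (\<forall>i\<in>J. y i = 0)"
  shows "free_of_rank (relative_homology_group p (subtopology (quot_space 2) (chart b)) W)
    (if p = 2 * int (card J) then 1 else 0)"
proof -
  let ?C = "subtopology (quot_space 2) (chart b)" and ?T = "E - {y. \<forall>i\<in>J. y i = 0}"
  have cf: "continuous_map (top_of_set E) (top_of_set (chart_data b)) f"
    and cg: "continuous_map (top_of_set (chart_data b)) (top_of_set E) g"
    using cont f g by (auto simp: continuous_map_in_subtopology)
  have h: "continuous_map ?C (top_of_set (chart_data b)) (to_data b)"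
    "continuous_map (top_of_set (chart_data b)) ?C point"
    using homeomorphic_maps_chart[of b] by (auto simp: homeomorphic_maps_def)
  note to = continuous_map_compose[OF h(1) cg] and fro = continuous_map_compose[OF cf h(2)]
  have 1: "(point \<circ> f) ((g \<circ> to_data b) K) = K" if "K \<in> chart b" for K
    using that by (simp add: fg to_data_in_chart point_to_data)
  have 2: "(g \<circ> to_data b) ((point \<circ> f) y) = y" if "y \<in> E" for y
    using that by (simp add: f gf to_data_point)
  have "relative_homology_group p ?C (chart b \<inter> W) \<cong> relative_homology_group p (top_of_set E) ?T"
  proof (rule homotopy_equivalent_space_imp_isomorphic_relative_homology_groups[OF to _ fro])
    show "g \<circ> to_data b \<in> chart b \<inter> W \<rightarrow> ?T"
    proof
      fix K assume K: "K \<in> chart b \<inter> W"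
      then have E: "(g \<circ> to_data b) K \<in> E" by (simp add: g to_data_in_chart)
      show "(g \<circ> to_data b) K \<in> ?T" using W[OF E] E 1[of K] K by auto
    qed
    show "point \<circ> f \<in> ?T \<rightarrow> chart b \<inter> W"
    proof
      fix y assume y: "y \<in> ?T"
      then have "point (f y) \<in> chart b" "point (f y) \<in> W"
        using W[of y] point_in_chart(1)[OF f, of y] by auto
      then show "(point \<circ> f) y \<in> chart b \<inter> W" by simp
    qed
    show "homotopic_with (\<lambda>h. h \<in> chart b \<inter> W \<rightarrow> chart b \<inter> W) ?C ?C ((point \<circ> f) \<circ> (g \<circ> to_data b)) id"
      using 1 by (intro homotopic_with_equal continuous_map_compose[OF to fro]) (auto simp: topspace_chart)
    show "homotopic_with (\<lambda>k. k \<in> ?T \<rightarrow> ?T) (top_of_set E) (top_of_set E) ((g \<circ> to_data b) \<circ> (point \<circ> f)) id"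
      using 2 by (intro homotopic_with_equal continuous_map_compose[OF fro to]) auto
  qed
  moreover have "relative_homology_group p ?C (chart b \<inter> W) = relative_homology_group p ?C W"
    using relative_homology_group_restrict[of p ?C W] by (simp only: topspace_chart)
  ultimately have "relative_homology_group p ?C W \<cong> relative_homology_group p (top_of_set E) ?T" by simp
  from free_of_rank_iso[OF group_relative_homology_group this] show ?thesis
    using relative_homology_cone[OF J scale supp] by simp
qed

section \<open>The two kinds of charts in coordinates\<close>

abbreviation component :: "bool \<Rightarrow> complex \<times> complex \<Rightarrow> complex" where
  "component s \<equiv> (if s then snd else fst)"

definition pairs :: "('i \<times> bool \<Rightarrow> complex) \<Rightarrow> 'i \<Rightarrow> complex \<times> complex" where
  "pairs y i = (y (i, False), y (i, True))"

lemma continuous_on_pairs: "continuous_on A (\<lambda>y. pairs y i)"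
  unfolding pairs_def by (intro continuous_on_Pair continuous_on_coord)

definition vec_chart :: "'r \<Rightarrow> 'r \<Rightarrow> (('n::finite, complex) mpoly ^ 'r::finite) \<times> (('n, complex) mpoly ^ 'r)" where
  "vec_chart i k = (axis i 1, axis k 1)"

definition cyc_chart :: "'r \<Rightarrow> 'n \<Rightarrow> (('n::finite, complex) mpoly ^ 'r::finite) \<times> (('n, complex) mpoly ^ 'r)" where
  "cyc_chart i j = (axis i 1, mvar j *s axis i 1)"

lemma vec_chart_data:
  "x \<in> chart_data (vec_chart i k) \<longleftrightarrow> commuting x \<and> x (Inl i) = (1, 0) \<and> x (Inl k) = (0, 1)"
  by (simp add: chart_data_def vec_chart_def eval_at_axis)

lemma cyc_chart_data:
  "x \<in> chart_data (cyc_chart i j) \<longleftrightarrow> commuting x \<and> x (Inl i) = (1, 0) \<and> x (Inr (j, False)) = (0, 1)"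
  by (auto simp: chart_data_def cyc_chart_def eval_at_axis eval_at_mvar act_basis)

lemma commuting_cong: "(\<And>i. x (Inr i) = x' (Inr i)) \<Longrightarrow> commuting x = commuting x'"
  by (simp add: commuting_def act_def)

text \<open>Two of the vectors are fixed, the others are free and the matrices form a commuting
  tuple. Commutation is homogeneous, so it survives scaling all matrices, together with any of the
  free vector coordinates.\<close>

lemma relative_homology_vec_chart:
  fixes i k :: "'r::finite"
  assumes ik: "i \<noteq> k" and J: "J \<subseteq> {(Inl l, s) | l s. l \<noteq> i \<and> l \<noteq> k}"
    and W: "\<And>x. x \<in> chart_data (vec_chart i k) \<Longrightarrow>
      point x \<notin> W \<longleftrightarrow> (\<forall>(j, s)\<in>J. component s (x j) = 0)"
  shows "free_of_rank (relative_homology_group p (subtopology (quot_space 2)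
      (chart (vec_chart i k :: (('n::finite, complex) mpoly ^ 'r) \<times> _))) W) (if p = 2 * int (card J) then 1 else 0)"
proof -
  \<comment> \<open>In \<open>E\<close> the two fixed vectors are replaced by 0, since
    \<open>(1, 0)\<close> and \<open>(0, 1)\<close> would not survive the scaling; \<open>f\<close>
    puts them back.\<close>
  define E where "E = {y :: ('r + 'n \<times> bool) \<times> bool \<Rightarrow> complex.
    (\<forall>s. y (Inl i, s) = 0 \<and> y (Inl k, s) = 0) \<and> commuting (pairs y)}"
  define f where "f y = (pairs y)(Inl i := (1, 0), Inl k := (0, 1))" for y :: "('r + 'n \<times> bool) \<times> bool \<Rightarrow> complex"
  define g where "g x js = (if fst js = Inl i \<or> fst js = Inl k then 0 else component (snd js) (x (fst js)))"
    for x :: "('n, 'r) qdata" and js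
  have com_f: "commuting (f y) = commuting (pairs y)" for y by (rule commuting_cong) (simp add: f_def)
  have com_g: "commuting (pairs (g x)) = commuting x" for x
    by (rule commuting_cong) (simp add: g_def pairs_def)
  show ?thesis
  proof (rule relative_homology_chart[where E = E and f = f and g = g])
    show "finite J" by (rule finite)
    show "(\<lambda>i. if i \<in> J then y i else of_real t * y i) \<in> E" (is "?y \<in> E") if "y \<in> E" for y t
    proof -
      have "act (pairs ?y) a u = cmul (of_real t) (act (pairs y) a u)" for a u
      proof -
        have "?y (Inr c, s) = of_real t * y (Inr c, s)" for c s using J by auto
        then show ?thesis by (simp add: act_def pairs_def cmul_def algebra_simps)
      qed
      then have "commuting (pairs ?y)"
        using that by (auto simp: E_def commuting_def act_linear)
      moreover have "?y (Inl i, s) = 0" "?y (Inl k, s) = 0" for s using that by (auto simp: E_def)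
      ultimately show ?thesis by (simp add: E_def)
    qed
    show "y \<in> E" if "\<And>i. i \<notin> J \<Longrightarrow> y i = 0" for y
    proof -
      have 0: "y (Inr c, s) = 0" "y (Inl i, s) = 0" "y (Inl k, s) = 0" for c s
        using that J by blast+
      then show ?thesis by (simp add: E_def commuting_def act_def pairs_def cmul_def zero_prod_def)
    qed
    show "continuous_on E f"
      unfolding f_def
    proof (rule continuous_on_coordinatewise_then_product)
      show "continuous_on E (\<lambda>y. ((pairs y)(Inl i := (1, 0), Inl k := (0, 1))) j)" for j
        by (cases "j = Inl i"; cases "j = Inl k") (use ik in \<open>simp_all add: continuous_on_pairs\<close>)
    qed
    show "continuous_on (chart_data (vec_chart i k)) g"
    proof (rule continuous_on_coordinatewise_then_product)
      show "continuous_on (chart_data (vec_chart i k)) (\<lambda>x. g x js)" for js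
        by (cases "fst js = Inl i \<or> fst js = Inl k"; cases "snd js")
          (simp_all add: g_def continuous_on_fst continuous_on_snd continuous_on_coord)
    qed
    show "f y \<in> chart_data (vec_chart i k)" if "y \<in> E" for y
      using that ik unfolding vec_chart_data com_f by (simp add: E_def f_def)
    show "g x \<in> E" if "x \<in> chart_data (vec_chart i k)" for x
      using that unfolding vec_chart_data E_def by (simp add: com_g) (simp add: g_def)
    show "g (f y) = y" if "y \<in> E" for y
    proof
      fix js :: "('r + 'n \<times> bool) \<times> bool" obtain j s where "js = (j, s)" by force
      then show "g (f y) js = y js" using that by (auto simp: g_def f_def E_def pairs_def)
    qed
    show "f (g x) = x" if "x \<in> chart_data (vec_chart i k)" for x
      using that unfolding vec_chart_data by (auto simp: g_def f_def pairs_def fun_eq_iff)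
    show "point (f y) \<notin> W \<longleftrightarrow> (\<forall>i\<in>J. y i = 0)" if "y \<in> E" for y
    proof -
      have "component s (f y j) = y (j, s)" if "(j, s) \<in> J" for j s
        using that J by (auto simp: f_def pairs_def)
      moreover have "f y \<in> chart_data (vec_chart i k)"
        using that ik unfolding vec_chart_data com_f by (simp add: E_def f_def)
      ultimately show ?thesis using W by fastforce
    qed
  qed
qed

lemma index_cases:
  fixes a :: "'r + 'n \<times> bool"
  obtains "a = Inl i" | l where "a = Inl l" "l \<noteq> i" | "a = Inr (j, False)" | "a = Inr (j, True)"
    | k where "a = Inr (k, False)" "k \<noteq> j" | k where "a = Inr (k, True)" "k \<noteq> j"
proof (cases a)
  case (Inl l)
  then show ?thesis using that(1,2) by (cases "l = i") auto
next
  case (Inr c)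
  obtain k s where "c = (k, s)" by force
  then show ?thesis using that(3-6) Inr by (cases "k = j"; cases s) auto
qed

text \<open>The first column of the \<open>j\<close>-th matrix is \<open>(0, 1)\<close>, so this is
  a companion matrix, and a matrix commuting with it is determined by its first column
  \<open>(p, q)\<close>: it equals \<open>p\<close> plus \<open>q\<close> times the
  \<open>j\<close>-th. Free coordinates are therefore the vectors other than the
  \<open>i\<close>-th, the second column for \<open>j\<close> and the first columns for the other
  variables; \<open>Inr (k, k = j)\<close> selects these columns.\<close>

lemma relative_homology_cyc_chart:
  fixes i :: "'r::finite" and j :: "'n::finite"
  assumes J: "J \<subseteq> {(a, s). a \<noteq> Inl i}"
    and W: "\<And>x. x \<in> chart_data (cyc_chart i j) \<Longrightarrow>
      point x \<notin> W \<longleftrightarrow> (\<forall>(a, s)\<in>J. component s (case a of Inl l \<Rightarrow> x (Inl l) | Inr k \<Rightarrow> x (Inr (k, k = j))) = 0)"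
  shows "free_of_rank (relative_homology_group p (subtopology (quot_space 2)
      (chart (cyc_chart i j))) W) (if p = 2 * int (card J) then 1 else 0)"
proof -
  define E where "E = {y :: ('r + 'n) \<times> bool \<Rightarrow> complex. \<forall>s. y (Inl i, s) = 0}"
  \<comment> \<open>For \<open>k \<noteq> j\<close> the value at \<open>Inr (k, True)\<close> is the
    second column of \<open>p\<close> plus \<open>q\<close> times the \<open>j\<close>-th matrix,
    where \<open>(p, q)\<close> is the first column of the \<open>k\<close>-th.\<close>
  define f :: "(('r + 'n) \<times> bool \<Rightarrow> complex) \<Rightarrow> ('n, 'r) qdata" where "f y a = (case a of
      Inl l \<Rightarrow> if l = i then (1, 0) else pairs y (Inl l)
    | Inr (k, s) \<Rightarrow> if k = j then (if s then pairs y (Inr j) else (0, 1)) else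
        if s then (y (Inr k, True) * y (Inr j, False), y (Inr k, False) + y (Inr k, True) * y (Inr j, True))
        else pairs y (Inr k))" for y a
  define g :: "('n, 'r) qdata \<Rightarrow> ('r + 'n) \<times> bool \<Rightarrow> complex" where "g x as = (if fst as = Inl i then 0 else component (snd as)
      (case fst as of Inl l \<Rightarrow> x (Inl l) | Inr k \<Rightarrow> x (Inr (k, k = j))))" for x as
  have f_simps: "f y (Inl i) = (1, 0)" "l \<noteq> i \<Longrightarrow> f y (Inl l) = pairs y (Inl l)"
    "f y (Inr (j, False)) = (0, 1)" "f y (Inr (j, True)) = pairs y (Inr j)"
    "k \<noteq> j \<Longrightarrow> f y (Inr (k, False)) = pairs y (Inr k)"
    "k \<noteq> j \<Longrightarrow> f y (Inr (k, True)) = (y (Inr k, True) * y (Inr j, False), y (Inr k, False) + y (Inr k, True) * y (Inr j, True))"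
    for y k l
    by (simp_all add: f_def)
  have act_f: "act (f y) k u = (if k = j then act (f y) j u
      else cmul (y (Inr k, False)) u + cmul (y (Inr k, True)) (act (f y) j u))" for y k u
    by (auto simp: act_def f_simps cmul_def pairs_def algebra_simps)
  have f_com: "commuting (f y)" for y
    unfolding commuting_def
  proof (intro allI)
    fix k l u
    \<comment> \<open>All the endomorphisms are polynomials of degree at most one in the
      \<open>j\<close>-th, hence they commute.\<close>
    have "\<exists>p q. \<forall>u. act (f y) k u = cmul p u + cmul q (act (f y) j u)" for k
    proof (cases "k = j")
      case True
      have "act (f y) k u = cmul 0 u + cmul 1 (act (f y) j u)" for u
        by (simp only: True cmul_simps add_0)
      then show ?thesis by blast
    qed (use act_f[of y k] in auto)
    then obtain p q p' q' where k: "\<And>u. act (f y) k u = cmul p u + cmul q (act (f y) j u)"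
      and l: "\<And>u. act (f y) l u = cmul p' u + cmul q' (act (f y) j u)" by metis
    have "cmul p (cmul p' u + cmul q' v) + cmul q (cmul p' v + cmul q' w) =
        cmul p' (cmul p u + cmul q v) + cmul q' (cmul p v + cmul q w)" for v w
      by (simp add: cmul_def algebra_simps)
    then show "act (f y) k (act (f y) l u) = act (f y) l (act (f y) k u)"
      by (simp only: k l act_linear)
  qed
  have f_in: "f y \<in> chart_data (cyc_chart i j)" for y
    by (simp add: cyc_chart_data f_com f_simps)
  show ?thesis
  proof (rule relative_homology_chart[where E = E and f = f and g = g])
    show "finite J" by (rule finite)
    show "(\<lambda>i. if i \<in> J then y i else of_real t * y i) \<in> E" if "y \<in> E" for y t
      using that by (simp add: E_def)
    show "y \<in> E" if "\<And>i. i \<notin> J \<Longrightarrow> y i = 0" for y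
      unfolding E_def using that J by blast
    show "continuous_on E f"
    proof (rule continuous_on_coordinatewise_then_product)
      fix a :: "'r + 'n \<times> bool"
      show "continuous_on E (\<lambda>y. f y a)"
        by (rule index_cases[where a = a and i = i and j = j]) (simp_all add: f_simps continuous_on_pairs continuous_on_Pair continuous_on_mult
            continuous_on_add continuous_on_coord)
    qed
    show "continuous_on (chart_data (cyc_chart i j)) g"
    proof (rule continuous_on_coordinatewise_then_product)
      fix as :: "('r + 'n) \<times> bool"
      obtain c s where as: "as = (c, s)" by force
      show "continuous_on (chart_data (cyc_chart i j)) (\<lambda>x. g x as)"
        by (cases "c = Inl i"; cases c; cases s)
          (simp_all add: as g_def continuous_on_fst continuous_on_snd continuous_on_coord)
    qed
    show "g x \<in> E" for x by (simp add: E_def g_def)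
    show "g (f y) = y" if "y \<in> E" for y
    proof
      fix as :: "('r + 'n) \<times> bool"
      obtain c s where as: "as = (c, s)" by force
      show "g (f y) as = y as"
      proof (cases c)
        case (Inl l)
        then show ?thesis using that by (cases "l = i") (auto simp: as g_def f_simps pairs_def E_def)
      next
        case (Inr k)
        then show ?thesis by (cases "k = j") (auto simp: as g_def f_simps pairs_def)
      qed
    qed
    show "f (g x) = x" if x: "x \<in> chart_data (cyc_chart i j)" for x
    proof
      fix a :: "'r + 'n \<times> bool"
      have com: "commuting x" and x0: "x (Inl i) = (1, 0)" and xj: "x (Inr (j, False)) = (0, 1)"
        using x by (auto simp: cyc_chart_data)
      \<comment> \<open>The second basis vector is the image of the first under the
        \<open>j\<close>-th endomorphism, so commutation derives the second column from the
        first.\<close>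
      have xk: "x (Inr (k, True)) = act x j (x (Inr (k, False)))" for k
      proof -
        have "act x k (act x j (1, 0)) = act x j (act x k (1, 0))" using com unfolding commuting_def by blast
        then show ?thesis by (simp add: act_basis xj)
      qed
      show "f (g x) a = x a"
      proof (cases rule: index_cases[where a = a and i = i and j = j])
        case (6 k)
        then show ?thesis
          by (simp add: f_simps g_def xk[of k]) (simp add: act_def xj cmul_def prod_eq_iff)
      qed (simp_all add: f_simps g_def pairs_def x0 xj)
    qed
    show "point (f y) \<notin> W \<longleftrightarrow> (\<forall>i\<in>J. y i = 0)" if "y \<in> E" for y
    proof -
      have "component s (case a of Inl l \<Rightarrow> f y (Inl l) | Inr k \<Rightarrow> f y (Inr (k, k = j))) = y (a, s)"
        if "(a, s) \<in> J" for a s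
      proof (cases a)
        case (Inl l)
        then have "l \<noteq> i" using that J by auto
        then show ?thesis using Inl by (simp add: f_simps pairs_def)
      next
        case (Inr k)
        then show ?thesis by (cases "k = j") (auto simp: f_simps pairs_def)
      qed
      then show ?thesis using W[OF f_in, of y] by fastforce
    qed
  qed (rule f_in)
qed

section \<open>The cell decomposition\<close>

lemma det2_eq_0_iff:
  fixes u v :: "complex \<times> complex"
  assumes "u \<noteq> 0" "det2 u v = 0"
  shows "\<exists>c. v = cmul c u"
proof (cases "fst u = 0")
  case True
  with assms show ?thesis
    by (intro exI[of _ "snd v / snd u"]) (auto simp: det2_def cmul_def prod_eq_iff)
next
  case False
  with assms show ?thesis
    by (intro exI[of _ "fst v / fst u"]) (auto simp: det2_def cmul_def prod_eq_iff field_simps)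
qed

lemma det2_simps:
  "det2 (1, 0) u = snd u" "det2 u (1, 0) = - snd u" "det2 u (0, 1) = fst u" "det2 0 u = 0" "det2 u 0 = 0"
  "det2 u u = (0 :: complex)" "det2 (cmul a u) (cmul c u) = 0"
  by (simp_all add: det2_def cmul_def)

lemma det2_commute: "det2 u v = - det2 v u"
  by (simp add: det2_def)

lemma point_in_vec_chart:
  assumes "x \<in> chart_data b"
  shows "point x \<in> chart (vec_chart i k) \<longleftrightarrow> det2 (x (Inl i)) (x (Inl k)) \<noteq> 0"
  using point_in_other_chart[OF assms, of "vec_chart i k"] by (simp add: vec_chart_def eval_at_axis)

lemma point_in_cyc_chart:
  assumes "x \<in> chart_data b"
  shows "point x \<in> chart (cyc_chart i j) \<longleftrightarrow> det2 (x (Inl i)) (act x j (x (Inl i))) \<noteq> 0"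
proof -
  have "commuting x" using assms by (simp add: chart_data_def)
  then show ?thesis
    using point_in_other_chart[OF assms, of "cyc_chart i j"] by (simp add: cyc_chart_def eval_at_axis eval_at_mvar)
qed

text \<open>The multiples of \<open>u\<close> contain the images of the generators and are stable
  under the variables, hence contain the whole image. With \<open>u = 0\<close> this covers
  vanishing generators as well.\<close>

lemma eval_at_in_line:
  fixes x :: "('n::finite, 'r::finite) qdata"
  assumes com: "commuting x" and l: "\<And>l. \<exists>c. x (Inl l) = cmul c u" and k: "\<And>k. \<exists>c. act x k u = cmul c u"
  shows "\<exists>c. eval_at x w = cmul c u"
proof -
  have mono: "\<exists>c. mact x m (x (Inl i)) = cmul c u" for i m
  proof (induction m rule: monomial_induct)
    case zero
    then show ?case using l by (simp add: mact_0)
  next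
    case (add m a)
    then obtain c where c: "mact x m (x (Inl i)) = cmul c u" by blast
    obtain d where d: "act x a u = cmul d u" using k by blast
    have "mact x (m + Poly_Mapping.single a 1) (x (Inl i)) = cmul (c * d) u"
      by (simp only: mact_add_single[OF com] c act_linear d cmul_simps)
    then show ?case by blast
  qed
  show ?thesis
  proof (induction w rule: vec_mpoly_induct)
    case (1 i m)
    obtain c where "mact x m (x (Inl i)) = cmul c u" using mono by blast
    then show ?case by (intro exI) (simp only: eval_at_mconst eval_at_monomial cmul_simps(3)[symmetric])
  next
    case 2
    show ?case by (rule exI[of _ 0]) (simp add: eval_at_0 cmul_simps)
  next
    case (3 v w)
    then obtain c d where "eval_at x v = cmul c u" "eval_at x w = cmul d u" by blast
    then show ?case by (intro exI[of _ "c + d"]) (simp add: eval_at_add cmul_simps)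
  qed
qed

text \<open>If all the determinants vanish, the images of the generators and their multiples by the
  variables lie on one line, although evaluation reaches both standard basis vectors.\<close>

lemma quot_points_covered:
  assumes K: "K \<in> quot_points 2"
  shows "(\<exists>i k. K \<in> chart (vec_chart i k)) \<or> (\<exists>i j. K \<in> chart (cyc_chart i j))"
proof (rule ccontr)
  assume *: "\<not> ?thesis"
  obtain b where b: "K \<in> chart b" using K quot_points_2_iff by blast
  define x where "x = to_data b K"
  have x: "x \<in> chart_data b" "point x = K" using b by (simp_all add: x_def to_data_in_chart point_to_data)
  have d: "det2 (x (Inl i)) (x (Inl k)) = 0" "det2 (x (Inl i)) (act x j (x (Inl i))) = 0" for i k j
    using * point_in_vec_chart[OF x(1), of i k] point_in_cyc_chart[OF x(1), of i j] x(2) by auto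
  have "\<exists>u. (\<forall>l. \<exists>c. x (Inl l) = cmul c u) \<and> (\<forall>k. \<exists>c. act x k u = cmul c u)"
  proof (cases "\<forall>l. x (Inl l) = 0")
    case True
    then show ?thesis by (intro exI[of _ 0]) (simp add: cmul_simps act_linear)
  next
    case False
    then obtain i where i: "x (Inl i) \<noteq> 0" by blast
    show ?thesis
      by (rule exI[of _ "x (Inl i)"]) (use det2_eq_0_iff[OF i] d in blast)
  qed
  then obtain u where u: "\<And>l. \<exists>c. x (Inl l) = cmul c u" "\<And>k. \<exists>c. act x k u = cmul c u" by blast
  have com: "commuting x" using x by (simp add: chart_data_def)
  obtain a c where "eval_at x (fst b) = cmul a u" "eval_at x (snd b) = cmul c u"
    using eval_at_in_line[OF com u] by blast
  then have "cmul a u = (1, 0)" "cmul c u = (0, 1)" using x by (simp_all add: chart_data_def)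
  then have "det2 (1, 0) (0, 1 :: complex) = 0" using det2_simps(7)[of a u c] by simp
  then show False by (simp add: det2_def)
qed

section \<open>Numbering and ordering the cells\<close>

type_synonym ('n, 'r) cell = "'r \<times> 'r + 'r \<times> 'n"

text \<open>The index types carry no order; the two numberings, starting at 0, supply one.\<close>

locale enumeration =
  fixes er :: "'r::finite \<Rightarrow> nat" and en :: "'n::finite \<Rightarrow> nat"
  assumes er: "bij_betw er UNIV {..<CARD('r)}" and en: "bij_betw en UNIV {..<CARD('n)}"
begin

lemma er_inj: "er i = er k \<longleftrightarrow> i = k" and en_inj: "en j = en l \<longleftrightarrow> j = l"
  using er en by (auto simp: bij_betw_def inj_on_def)

text \<open>Larger than every index, so that pairs of indices are compared lexicographically as
  two-digit numbers in base \<open>B\<close>.\<close>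

definition B where "B = CARD('r) + CARD('n)"

lemma less_B: "er i < B" "en j < B"
  using bij_betwE[OF er] bij_betwE[OF en] by (auto simp: B_def intro: trans_less_add1 trans_less_add2)

lemma lex_less_iff:
  fixes a b c d :: nat
  assumes "b < B" "d < B"
  shows "a * B + b < c * B + d \<longleftrightarrow> a < c \<or> (a = c \<and> b < d)"
proof -
  have 1: "a * B + b < c * B + d" if "a < c" "b < B" for a b c d :: nat
  proof -
    have "a * B + b < Suc a * B" using that by simp
    also have "\<dots> \<le> c * B" using that by (intro mult_le_mono1) simp
    finally show ?thesis by simp
  qed
  show ?thesis using 1[of a c b d] 1[of c a d b] assms by (cases a c rule: linorder_cases) auto
qed

lemma lex_less_square: "er i * B + er k < B * B"
proof -
  have "er i * B + er k < Suc (er i) * B" using less_B by simp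
  also have "\<dots> \<le> B * B" using less_B(1)[of i] by (intro mult_le_mono1) simp
  finally show ?thesis .
qed

text \<open>Swapping the two basis vectors does not change the chart, so only increasing pairs are
  listed.\<close>

definition cells :: "('n, 'r) cell set" where
  "cells = Inl ` {(i, k). er i < er k} \<union> range Inr"

text \<open>Keys of the first kind stay below \<open>B * B\<close>; the shift places all charts of
  the second kind after them.\<close>

fun cell_key :: "('n, 'r) cell \<Rightarrow> nat" where
  "cell_key (Inl (i, k)) = er i * B + er k"
| "cell_key (Inr (i, j)) = B * B + (er i * B + en j)"

fun cell_chart :: "('n, 'r) cell \<Rightarrow> (('n, complex) mpoly ^ 'r) set set" where
  "cell_chart (Inl (i, k)) = chart (vec_chart i k)"
| "cell_chart (Inr (i, j)) = chart (cyc_chart i j)"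

text \<open>The number of linear conditions on the part not covered before. First kind: two for each
  index below \<open>er i\<close> and one for each strictly between \<open>er i\<close> and
  \<open>er k\<close>, that is \<open>2 * er i + (er k - er i - 1)\<close>. Second kind: one for
  each of the other \<open>CARD('r) - 1\<close> vectors, one more for each index below
  \<open>er i\<close>, and one for each variable before \<open>j\<close>.\<close>

fun cell_codim :: "('n, 'r) cell \<Rightarrow> nat" where
  "cell_codim (Inl (i, k)) = er i + er k - 1"
| "cell_codim (Inr (i, j)) = CARD('r) - 1 + er i + en j"

lemma cell_key_inj: "inj_on cell_key cells"
proof (rule inj_onI)
  fix \<sigma> \<tau> assume eq: "cell_key \<sigma> = cell_key \<tau>"
  have lex: "a * B + b = c * B + d \<longleftrightarrow> a = c \<and> b = d" if "b < B" "d < B" for a b c d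
    using lex_less_iff[OF that] lex_less_iff[OF that(2,1)] by (metis less_irrefl nat_neq_iff)
  show "\<sigma> = \<tau>"
  proof (cases \<sigma>; cases \<tau>)
    fix p q assume "\<sigma> = Inl p" "\<tau> = Inl q"
    then show ?thesis using eq lex less_B by (cases p; cases q) (simp add: er_inj)
  next
    fix p q assume "\<sigma> = Inr p" "\<tau> = Inr q"
    then show ?thesis using eq lex less_B by (cases p; cases q) (simp add: er_inj en_inj)
  next
    fix p q assume "\<sigma> = Inl p" "\<tau> = Inr q"
    then show ?thesis using eq lex_less_square[of "fst p" "snd p"] by (cases p; cases q) simp
  next
    fix p q assume "\<sigma> = Inr p" "\<tau> = Inl q"
    then show ?thesis using eq lex_less_square[of "fst q" "snd q"] by (cases p; cases q) simp
  qed
qed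

lemma card_er_less: "card {l. er l < t} = t" if "t \<le> CARD('r)" for t
proof -
  have "er ` {l. er l < t} = {..<t}"
    using er that unfolding bij_betw_def by (auto simp: image_iff set_eq_iff) (metis order_less_le_trans lessThan_iff rangeE)
  moreover have "inj_on er {l. er l < t}" by (auto simp: inj_on_def er_inj)
  ultimately show ?thesis by (metis card_image card_lessThan)
qed

lemma card_en_less: "card {l. en l < t} = t" if "t \<le> CARD('n)" for t
proof -
  have "en ` {l. en l < t} = {..<t}"
    using en that unfolding bij_betw_def by (auto simp: image_iff set_eq_iff) (metis order_less_le_trans lessThan_iff rangeE)
  moreover have "inj_on en {l. en l < t}" by (auto simp: inj_on_def en_inj)
  ultimately show ?thesis by (metis card_image card_lessThan)
qed

lemma less_card: "er i < CARD('r)" "en j < CARD('n)"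
  using bij_betwE[OF er] bij_betwE[OF en] by auto

definition earlier :: "('n, 'r) cell \<Rightarrow> (('n, complex) mpoly ^ 'r) set set" where
  "earlier \<tau> = (\<Union>\<sigma>\<in>{\<sigma> \<in> cells. cell_key \<sigma> < cell_key \<tau>}. cell_chart \<sigma>)"

lemma not_in_earlier_iff:
  "K \<notin> earlier \<tau> \<longleftrightarrow>
    (\<forall>i k. er i < er k \<longrightarrow> cell_key (Inl (i, k)) < cell_key \<tau> \<longrightarrow> K \<notin> chart (vec_chart i k)) \<and>
    (\<forall>i j. cell_key (Inr (i, j)) < cell_key \<tau> \<longrightarrow> K \<notin> chart (cyc_chart i j))"
proof -
  have "K \<notin> earlier \<tau> \<longleftrightarrow> (\<forall>\<sigma>\<in>cells. cell_key \<sigma> < cell_key \<tau> \<longrightarrow> K \<notin> cell_chart \<sigma>)"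
    unfolding earlier_def by blast
  then show ?thesis by (simp add: cells_def ball_Un del: cell_key.simps)
qed

lemma earlier_Inl:
  "K \<notin> earlier (Inl (i, k)) \<longleftrightarrow>
    (\<forall>i' k'. er i' < er k' \<longrightarrow> er i' < er i \<or> i' = i \<and> er k' < er k \<longrightarrow> K \<notin> chart (vec_chart i' k'))"
proof -
  have "cell_key (Inr (i', j')) < cell_key (Inl (i, k)) \<longleftrightarrow> False" for i' j'
    using lex_less_square[of i k] by simp
  moreover have "cell_key (Inl (i', k')) < cell_key (Inl (i, k)) \<longleftrightarrow> er i' < er i \<or> i' = i \<and> er k' < er k" for i' k'
    using lex_less_iff less_B by (simp add: er_inj)
  ultimately show ?thesis unfolding not_in_earlier_iff by (simp del: cell_key.simps)
qed

lemma earlier_Inr: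
  "K \<notin> earlier (Inr (i, j)) \<longleftrightarrow>
    (\<forall>i' k'. er i' < er k' \<longrightarrow> K \<notin> chart (vec_chart i' k')) \<and>
    (\<forall>i' j'. er i' < er i \<or> i' = i \<and> en j' < en j \<longrightarrow> K \<notin> chart (cyc_chart i' j'))"
proof -
  have "cell_key (Inl (i', k')) < cell_key (Inr (i, j)) \<longleftrightarrow> True" for i' k'
    using lex_less_square[of i' k'] by simp
  moreover have "cell_key (Inr (i', j')) < cell_key (Inr (i, j)) \<longleftrightarrow> er i' < er i \<or> i' = i \<and> en j' < en j" for i' j'
    using lex_less_iff less_B by (simp add: er_inj)
  ultimately show ?thesis unfolding not_in_earlier_iff by (simp del: cell_key.simps)
qed

text \<open>Outside the earlier charts, a vector with index below \<open>i\<close> has zero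
  determinant with both basis vectors and so vanishes; a vector with index strictly between
  \<open>i\<close> and \<open>k\<close> has zero determinant with the first one, which kills its
  second component.\<close>

lemma relative_homology_cell_Inl:
  assumes ik: "er i < er k"
  shows "free_of_rank (relative_homology_group p (subtopology (quot_space 2) (cell_chart (Inl (i, k))))
    (earlier (Inl (i, k)))) (if p = 2 * int (cell_codim (Inl (i, k))) then 1 else 0)"
proof -
  let ?J = "{(Inl l :: 'r + 'n \<times> bool, s :: bool) | l s. er l < er i \<or> er i < er l \<and> er l < er k \<and> s}"
  have "?J = (\<lambda>l. (Inl l, False)) ` {l. er l < er i} \<union> (\<lambda>l. (Inl l, True)) ` ({l. er l < er k} - {i})"
    using ik by (auto simp: image_iff) (metis er_inj linorder_neqE_nat order_less_trans)+
  moreover have "card ((\<lambda>l. (Inl l :: 'r + 'n \<times> bool, False)) ` {l. er l < er i}) = er i"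
    using less_card(1)[of i] by (subst card_image) (auto simp: inj_on_def card_er_less)
  moreover have "card ((\<lambda>l. (Inl l :: 'r + 'n \<times> bool, True)) ` ({l. er l < er k} - {i})) = er k - 1"
    using less_card(1)[of k] ik by (subst card_image) (auto simp: inj_on_def card_er_less)
  ultimately have "card ?J = er i + (er k - 1)"
    by (simp only:) (subst card_Un_disjoint, auto)
  then have c: "card ?J = cell_codim (Inl (i, k))" using ik by simp
  have "free_of_rank (relative_homology_group p (subtopology (quot_space 2) (chart (vec_chart i k)))
    (earlier (Inl (i, k)))) (if p = 2 * int (card ?J) then 1 else 0)"
  proof (rule relative_homology_vec_chart)
    show "i \<noteq> k" "?J \<subseteq> {(Inl l, s) | l s. l \<noteq> i \<and> l \<noteq> k}" using ik by auto
    fix x :: "('n, 'r) qdata" assume x: "x \<in> chart_data (vec_chart i k)"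
    then have x0: "x (Inl i) = (1, 0)" "x (Inl k) = (0, 1)" by (simp_all add: vec_chart_data)
    have J: "(\<forall>(j, s)\<in>?J. component s (x j) = 0) \<longleftrightarrow>
        (\<forall>l. er l < er i \<longrightarrow> x (Inl l) = 0) \<and> (\<forall>l. er i < er l \<and> er l < er k \<longrightarrow> snd (x (Inl l)) = 0)"
      by (auto simp: prod_eq_iff split: if_splits)
    show "point x \<notin> earlier (Inl (i, k)) \<longleftrightarrow> (\<forall>(j, s)\<in>?J. component s (x j) = 0)"
      unfolding J earlier_Inl point_in_vec_chart[OF x]
    proof (intro iffI conjI allI impI)
      assume *: "\<forall>i' k'. er i' < er k' \<longrightarrow> er i' < er i \<or> i' = i \<and> er k' < er k \<longrightarrow>
          \<not> det2 (x (Inl i')) (x (Inl k')) \<noteq> 0"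
      show "x (Inl l) = 0" if "er l < er i" for l
        using *[rule_format, of l i] *[rule_format, of l k] that ik by (auto simp: x0 det2_simps prod_eq_iff)
      show "snd (x (Inl l)) = 0" if "er i < er l \<and> er l < er k" for l
        using *[rule_format, of i l] that by (auto simp: x0 det2_simps)
    next
      fix i' k'
      assume "(\<forall>l. er l < er i \<longrightarrow> x (Inl l) = 0) \<and> (\<forall>l. er i < er l \<and> er l < er k \<longrightarrow> snd (x (Inl l)) = 0)"
        "er i' < er k'" "er i' < er i \<or> i' = i \<and> er k' < er k"
      then show "\<not> det2 (x (Inl i')) (x (Inl k')) \<noteq> 0" by (auto simp: x0 det2_simps(1,4))
    qed
  qed
  then show ?thesis unfolding c by simp
qed

text \<open>Outside all charts of the first kind every vector is proportional to the
  \<open>i\<close>-th, hence of the form \<open>(a, 0)\<close>. For an index below \<open>i\<close>,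
  avoiding the chart given by that vector and \<open>j\<close> means \<open>a * a = 0\<close>; as
  only the zero set enters, this is the linear condition \<open>a = 0\<close>. Avoiding the chart of
  \<open>i\<close> and an earlier variable kills the second component of the first column of that
  variable.\<close>

lemma relative_homology_cell_Inr:
  "free_of_rank (relative_homology_group p (subtopology (quot_space 2) (cell_chart (Inr (i, j))))
    (earlier (Inr (i, j)))) (if p = 2 * int (cell_codim (Inr (i, j))) then 1 else 0)"
proof -
  let ?J = "{(Inl l :: 'r + 'n, s :: bool) | l s. l \<noteq> i \<and> (s \<or> er l < er i)} \<union> {(Inr k, True) | k. en k < en j}"
  have "?J = (\<lambda>l. (Inl l, False)) ` {l. er l < er i} \<union> (\<lambda>l. (Inl l, True)) ` (UNIV - {i}) \<union> (\<lambda>k. (Inr k, True)) ` {k. en k < en j}"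
    by (auto simp: image_iff)
  moreover have "card ((\<lambda>l. (Inl l :: 'r + 'n, False)) ` {l. er l < er i}) = er i"
    using less_card(1)[of i] by (subst card_image) (auto simp: inj_on_def card_er_less)
  moreover have "card ((\<lambda>l. (Inl l :: 'r + 'n, True)) ` (UNIV - {i})) = CARD('r) - 1"
    by (subst card_image) (auto simp: inj_on_def card_Diff_singleton)
  moreover have "card ((\<lambda>k. (Inr k :: 'r + 'n, True)) ` {k. en k < en j}) = en j"
    using less_card(2)[of j] by (subst card_image) (auto simp: inj_on_def card_en_less)
  ultimately have "card ?J = er i + (CARD('r) - 1) + en j"
    by (simp only:) (subst card_Un_disjoint, simp, simp, force, subst card_Un_disjoint, auto)
  then have c: "card ?J = cell_codim (Inr (i, j))" by simp
  have "free_of_rank (relative_homology_group p (subtopology (quot_space 2) (chart (cyc_chart i j)))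
    (earlier (Inr (i, j)))) (if p = 2 * int (card ?J) then 1 else 0)"
  proof (rule relative_homology_cyc_chart)
    show "?J \<subseteq> {(a, s). a \<noteq> Inl i}" by auto
    fix x :: "('n, 'r) qdata" assume x: "x \<in> chart_data (cyc_chart i j)"
    then have x0: "x (Inl i) = (1, 0)" "x (Inr (j, False)) = (0, 1)" by (simp_all add: cyc_chart_data)
    have J: "(\<forall>(a, s)\<in>?J. component s (case a of Inl l \<Rightarrow> x (Inl l) | Inr k \<Rightarrow> x (Inr (k, k = j))) = 0) \<longleftrightarrow>
        (\<forall>l. l \<noteq> i \<longrightarrow> snd (x (Inl l)) = 0) \<and> (\<forall>l. er l < er i \<longrightarrow> fst (x (Inl l)) = 0) \<and>
        (\<forall>k. en k < en j \<longrightarrow> snd (x (Inr (k, False))) = 0)" (is "?L \<longleftrightarrow> ?R")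
    proof
      assume L: ?L
      have "snd (x (Inl l)) = 0" if "l \<noteq> i" for l
        using bspec[OF L, of "(Inl l, True)"] that by auto
      moreover have "fst (x (Inl l)) = 0" if "er l < er i" for l
        using bspec[OF L, of "(Inl l, False)"] that by auto
      moreover have "snd (x (Inr (k, False))) = 0" if "en k < en j" for k
      proof -
        have "k \<noteq> j" using that by auto
        then show ?thesis using bspec[OF L, of "(Inr k, True)"] that by simp
      qed
      ultimately show ?R by blast
    next
      assume R: ?R
      have "(k = j) = False" if "en k < en j" for k using that by auto
      with R show ?L by auto
    qed
    show "point x \<notin> earlier (Inr (i, j)) \<longleftrightarrow>
        (\<forall>(a, s)\<in>?J. component s (case a of Inl l \<Rightarrow> x (Inl l) | Inr k \<Rightarrow> x (Inr (k, k = j))) = 0)"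
      unfolding J earlier_Inr point_in_vec_chart[OF x] point_in_cyc_chart[OF x]
    proof (intro iffI conjI allI impI)
      assume "(\<forall>i' k'. er i' < er k' \<longrightarrow> \<not> det2 (x (Inl i')) (x (Inl k')) \<noteq> 0) \<and>
          (\<forall>i' j'. er i' < er i \<or> i' = i \<and> en j' < en j \<longrightarrow> \<not> det2 (x (Inl i')) (act x j' (x (Inl i'))) \<noteq> 0)"
      then have 1: "\<And>i' k'. er i' < er k' \<Longrightarrow> det2 (x (Inl i')) (x (Inl k')) = 0"
        and 2: "\<And>i' j'. er i' < er i \<or> i' = i \<and> en j' < en j \<Longrightarrow> det2 (x (Inl i')) (act x j' (x (Inl i'))) = 0"
        by auto
      show snd0: "snd (x (Inl l)) = 0" if "l \<noteq> i" for l
      proof -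
        have "er l < er i \<or> er i < er l" using that by (metis er_inj linorder_neqE_nat)
        then show ?thesis using 1[of l i] 1[of i l] by (auto simp: x0 det2_simps(1,2))
      qed
      show "fst (x (Inl l)) = 0" if "er l < er i" for l
      proof -
        have "l \<noteq> i" using that by auto
        then obtain a where a: "x (Inl l) = (a, 0)" using snd0[of l] by (cases "x (Inl l)") auto
        have "act x j (a, 0) = (0, a)" by (simp add: act_def x0 cmul_def)
        then show ?thesis using 2[of l j] that by (simp add: a det2_def)
      qed
      show "snd (x (Inr (k, False))) = 0" if "en k < en j" for k
        using 2[of i k] that by (simp add: x0 act_basis det2_simps(1))
    next
      assume R: "(\<forall>l. l \<noteq> i \<longrightarrow> snd (x (Inl l)) = 0) \<and> (\<forall>l. er l < er i \<longrightarrow> fst (x (Inl l)) = 0) \<and>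
        (\<forall>k. en k < en j \<longrightarrow> snd (x (Inr (k, False))) = 0)"
      then have "snd (x (Inl l)) = 0" for l by (cases "l = i") (auto simp: x0)
      then show "\<not> det2 (x (Inl i')) (x (Inl k')) \<noteq> 0" for i' k' by (simp add: det2_def)
      show "\<not> det2 (x (Inl i')) (act x j' (x (Inl i'))) \<noteq> 0" if "er i' < er i \<or> i' = i \<and> en j' < en j" for i' j'
        using that
      proof
        assume "er i' < er i"
        then have "x (Inl i') = 0" using R by (auto simp: prod_eq_iff)
        then show ?thesis by (simp add: det2_simps(4))
      next
        assume "i' = i \<and> en j' < en j"
        then show ?thesis using R by (simp add: x0 act_basis det2_simps(1))
      qed
    qed
  qed
  then show ?thesis unfolding c by simp
qed

theorem homology_quot_space:
  "free_of_rank (homology_group p (quot_space 2 :: (('n, complex) mpoly ^ 'r) set topology))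
     (card {\<tau> \<in> cells. p = 2 * int (cell_codim \<tau>)})"
proof -
  let ?Q = "quot_space 2 :: (('n, complex) mpoly ^ 'r) set topology"
  have "free_of_rank (homology_group p (subtopology ?Q (\<Union>\<tau>\<in>cells. cell_chart \<tau>)))
     (card {\<tau> \<in> cells. p = 2 * int (cell_codim \<tau>)})"
  proof (rule homology_cell_filtration[OF _ cell_key_inj])
    show "finite cells" by (rule finite)
    show "openin ?Q (cell_chart \<tau>)" for \<tau>
      by (cases \<tau> rule: cell_chart.cases) (simp_all add: openin_chart)
    show "free_of_rank (relative_homology_group p (subtopology ?Q (cell_chart \<tau>))
        (\<Union>\<sigma>\<in>{\<sigma> \<in> cells. cell_key \<sigma> < cell_key \<tau>}. cell_chart \<sigma>)) (if p = 2 * int (cell_codim \<tau>) then 1 else 0)"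
      if "\<tau> \<in> cells" for \<tau> p
    proof (cases \<tau> rule: cell_chart.cases)
      case (1 i k)
      then have "er i < er k" using that by (auto simp: cells_def)
      then show ?thesis unfolding 1 earlier_def[symmetric] by (rule relative_homology_cell_Inl)
    next
      case (2 i j)
      show ?thesis unfolding 2 earlier_def[symmetric] by (rule relative_homology_cell_Inr)
    qed
  qed
  moreover have "(\<Union>\<tau>\<in>cells. cell_chart \<tau>) = topspace ?Q"
  proof
    show "(\<Union>\<tau>\<in>cells. cell_chart \<tau>) \<subseteq> topspace ?Q"
    proof
      fix K assume "K \<in> (\<Union>\<tau>\<in>cells. cell_chart \<tau>)"
      then obtain \<tau> where "K \<in> cell_chart \<tau>" by blast
      then show "K \<in> topspace ?Q"
        unfolding topspace_quot_space quot_points_2_iff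
        by (cases \<tau> rule: cell_chart.cases) (auto simp del: split_paired_Ex)
    qed
    show "topspace ?Q \<subseteq> (\<Union>\<tau>\<in>cells. cell_chart \<tau>)"
    proof
      fix K assume "K \<in> topspace ?Q"
      then have K: "K \<in> quot_points 2" by (simp add: topspace_quot_space)
      from quot_points_covered[OF K] show "K \<in> (\<Union>\<tau>\<in>cells. cell_chart \<tau>)"
      proof (elim disjE exE)
        fix i k assume ik: "K \<in> chart (vec_chart i k)"
        then have x: "to_data (vec_chart i k) K \<in> chart_data (vec_chart i k)" "point (to_data (vec_chart i k) K) = K"
          by (simp_all add: to_data_in_chart point_to_data)
        let ?x = "to_data (vec_chart i k) K"
        \<comment> \<open>Swapping the vectors only changes the sign of the determinant, which
          allows the pair to be taken increasing.\<close>
        have "det2 (?x (Inl i)) (?x (Inl k)) \<noteq> 0" using point_in_vec_chart[OF x(1), of i k] x(2) ik by simp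
        then have "i \<noteq> k" and "det2 (?x (Inl k)) (?x (Inl i)) \<noteq> 0"
          using det2_commute[of "?x (Inl k)" "?x (Inl i)"] by (auto simp: det2_simps(6))
        then have "K \<in> chart (vec_chart k i)" using point_in_vec_chart[OF x(1), of k i] x(2) by simp
        moreover have "er i < er k \<or> er k < er i" using \<open>i \<noteq> k\<close> er_inj by (metis linorder_neqE_nat)
        ultimately show ?thesis
          using ik by (auto simp: cells_def)
      next
        fix i j assume "K \<in> chart (cyc_chart i j)"
        then show ?thesis by (intro UN_I[of "Inr (i, j)"]) (auto simp: cells_def)
      qed
    qed
  qed
  ultimately show ?thesis by simp
qed

end

section \<open>Counting\<close>

context enumeration
begin

text \<open>Fix the first index \<open>b\<close>. Raising the second index runs through the cells of
  the first kind and then on through those of the second kind, and the codimension takes each value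
  from \<open>2 * b\<close> on exactly once, until the variables run out. The bound on
  \<open>q\<close> keeps this end out of reach.\<close>

lemma card_cells:
  assumes q: "q \<le> CARD('n) + CARD('r) - 2"
  shows "card {\<tau> \<in> cells. cell_codim \<tau> = q} = card {b. 2 * b \<le> q \<and> b < CARD('r)}"
proof -
  let ?r = "CARD('r)" and ?n = "CARD('n)"
  have pos: "0 < ?r" "0 < ?n" by simp_all
  define \<beta> :: "('n, 'r) cell \<Rightarrow> nat" where "\<beta> \<tau> = (case \<tau> of Inl ik \<Rightarrow> er (fst ik) | Inr ij \<Rightarrow> er (fst ij))" for \<tau>
  have ex_er: "\<exists>i. er i = t" if "t < ?r" for t
    using er that unfolding bij_betw_def by (metis (no_types, lifting) imageE lessThan_iff)
  have ex_en: "\<exists>j. en j = t" if "t < ?n" for t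
    using en that unfolding bij_betw_def by (metis (no_types, lifting) imageE lessThan_iff)
  have "bij_betw \<beta> {\<tau> \<in> cells. cell_codim \<tau> = q} {b. 2 * b \<le> q \<and> b < ?r}"
    unfolding bij_betw_def
  proof
    show "inj_on \<beta> {\<tau> \<in> cells. cell_codim \<tau> = q}"
    proof (rule inj_onI)
      fix \<sigma> \<tau> assume s: "\<sigma> \<in> {\<tau> \<in> cells. cell_codim \<tau> = q}" "\<tau> \<in> {\<tau> \<in> cells. cell_codim \<tau> = q}" "\<beta> \<sigma> = \<beta> \<tau>"
      show "\<sigma> = \<tau>"
      proof (cases \<sigma> rule: cell_chart.cases; cases \<tau> rule: cell_chart.cases)
        fix i k i' k' assume eq: "\<sigma> = Inl (i, k)" "\<tau> = Inl (i', k')"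
        then have "i = i'" "er i < er k" "er i' < er k'" "er i + er k - 1 = er i' + er k' - 1"
          using s by (auto simp: \<beta>_def cells_def er_inj)
        then have "er k = er k'" by simp
        with eq \<open>i = i'\<close> show ?thesis by (simp add: er_inj)
      next
        fix i j i' j' assume eq: "\<sigma> = Inr (i, j)" "\<tau> = Inr (i', j')"
        then show ?thesis using s by (auto simp: \<beta>_def er_inj en_inj)
      next
        fix i k i' j assume eq: "\<sigma> = Inl (i, k)" "\<tau> = Inr (i', j)"
        then show ?thesis using s less_card(1)[of k] pos by (auto simp: \<beta>_def cells_def er_inj)
      next
        fix i k i' j assume eq: "\<sigma> = Inr (i', j)" "\<tau> = Inl (i, k)"
        then show ?thesis using s less_card(1)[of k] pos by (auto simp: \<beta>_def cells_def er_inj)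
      qed
    qed
    show "\<beta> ` {\<tau> \<in> cells. cell_codim \<tau> = q} = {b. 2 * b \<le> q \<and> b < ?r}"
    proof (intro equalityI subsetI)
      fix b assume "b \<in> \<beta> ` {\<tau> \<in> cells. cell_codim \<tau> = q}"
      then obtain \<tau> where \<tau>: "\<tau> \<in> cells" "cell_codim \<tau> = q" "b = \<beta> \<tau>" by blast
      show "b \<in> {b. 2 * b \<le> q \<and> b < ?r}"
      proof (cases \<tau> rule: cell_chart.cases)
        case (1 i k)
        then show ?thesis using \<tau> less_card(1)[of i] by (auto simp: \<beta>_def cells_def)
      next
        case (2 i j)
        then show ?thesis using \<tau> less_card(1)[of i] by (auto simp: \<beta>_def)
      qed
    next
      fix b assume b: "b \<in> {b. 2 * b \<le> q \<and> b < ?r}"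
      then obtain i where i: "er i = b" using ex_er by auto
      show "b \<in> \<beta> ` {\<tau> \<in> cells. cell_codim \<tau> = q}"
      \<comment> \<open>Solving \<open>b + er k - 1 = q\<close> gives this index; beyond the range
        of \<open>er\<close> a cell of the second kind takes over.\<close>
      proof (cases "q + 1 - b < ?r")
        case True
        then obtain k where k: "er k = q + 1 - b" using ex_er by auto
        have "er i < er k" "er i + er k - 1 = q" using b i k by auto
        then show ?thesis
          by (intro image_eqI[of _ _ "Inl (i, k)"]) (auto simp: \<beta>_def cells_def i)
      next
        case False
        \<comment> \<open>The last variable allows \<open>q\<close> up to
          \<open>CARD('n) + CARD('r) - 2 + b\<close>; here the bound on \<open>q\<close>
          enters.\<close>
        have "q - (?r - 1) - b < ?n" using q pos by linarith
        then obtain j where j: "en j = q - (?r - 1) - b" using ex_en by auto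
        have "?r - 1 + er i + en j = q" using False b i j by auto
        then show ?thesis
          by (intro image_eqI[of _ _ "Inr (i, j)"]) (auto simp: \<beta>_def cells_def i)
      qed
    qed
  qed
  then show ?thesis by (rule bij_betw_same_card)
qed

end

lemma abelian_rank_cohomology_quot_space:
  fixes i :: nat
  assumes "i \<le> 2 * (CARD('n::finite) + CARD('r::finite) - 2)"
  shows "abelian_rank (singular_cohomology_group i (quot_space 2 :: (('n, complex) mpoly ^ 'r) set topology)) =
    (if even i then enat (card {b. 2 * b \<le> i div 2 \<and> b < CARD('r)}) else 0)"
proof -
  let ?Q = "quot_space 2 :: (('n, complex) mpoly ^ 'r) set topology"
  obtain er :: "'r \<Rightarrow> nat" and en :: "'n \<Rightarrow> nat" where "bij_betw er UNIV {..<CARD('r)}" "bij_betw en UNIV {..<CARD('n)}"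
    using ex_bij_betw_finite_nat[OF finite] by (metis atLeast0LessThan)
  then interpret enumeration er en by unfold_locales
  let ?c = "\<lambda>q :: nat. card {\<tau> \<in> cells. int q = 2 * int (cell_codim \<tau>)}"
  have basis: "\<exists>z. homology_basis q ?Q {..<?c q} z" for q
    by (rule homology_basis_exists[OF homology_quot_space])
  then obtain z where z: "homology_basis i ?Q {..<?c i} z" by blast
  have "abelian_rank (singular_cohomology_group i ?Q) = card {..<?c i}"
    by (rule abelian_rank_cohomology[OF _ z]) (use basis in blast)
  moreover have "?c i = (if even i then card {b. 2 * b \<le> i div 2 \<and> b < CARD('r)} else 0)"
  proof (cases "even i")
    case True
    then obtain q where i: "i = 2 * q" by blast
    have "{\<tau> \<in> cells. int i = 2 * int (cell_codim \<tau>)} = {\<tau> \<in> cells. cell_codim \<tau> = q}"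
      by (auto simp: i)
    then show ?thesis using card_cells[of q] assms by (simp add: i)
  next
    case False
    have "int i \<noteq> 2 * int (cell_codim \<tau>)" for \<tau> using False by presburger
    then show ?thesis using False by simp
  qed
  ultimately show ?thesis by (simp add: zero_enat_def)
qed

section \<open>The truncated polynomial ring\<close>

lemma UNIV_gen: "UNIV = {X1, X2}"
  using gen.exhaust by auto

lemma weight_eq: "weight m = 2 * Poly_Mapping.lookup m X1 + 4 * Poly_Mapping.lookup m X2"
proof -
  have "weight m = (\<Sum>g\<in>{X1, X2}. gen_degree g * Poly_Mapping.lookup m g)"
    unfolding weight_def
  proof (rule sum.mono_neutral_left)
    show "Poly_Mapping.keys m \<subseteq> {X1, X2}" using UNIV_gen by blast
  qed (auto simp: in_keys_iff)
  then show ?thesis by simp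
qed

lemma ring_of_type_simps:
  "x \<oplus>\<^bsub>ring_of_type_algebra\<^esub> y = x + y" "x \<otimes>\<^bsub>ring_of_type_algebra\<^esub> y = x * y"
  "\<zero>\<^bsub>ring_of_type_algebra\<^esub> = 0" "\<one>\<^bsub>ring_of_type_algebra\<^esub> = 1"
  "carrier ring_of_type_algebra = UNIV"
  by (auto simp: ring_of_type_algebra_def)

lemma mvar_power: "mvar g ^ r = Poly_Mapping.single (Poly_Mapping.single g r) (1 :: int)"
  by (induction r) (simp_all add: mvar_def mult_single flip: single_add)

text \<open>The generator is a monomial: exponents add under multiplication, so the right-hand side
  is an ideal, and each of its monomials is a multiple of the generator.\<close>

lemma x2_power_ideal_eq:
  "x2_power_ideal r = {f. \<forall>m\<in>Poly_Mapping.keys f. r \<le> Poly_Mapping.lookup m X2}"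
proof -
  let ?J = "{f :: (gen, int) mpoly. \<forall>m\<in>Poly_Mapping.keys f. r \<le> Poly_Mapping.lookup m X2}"
  have "ideal ?J ring_of_type_algebra"
  proof (rule ideal_typeI)
    show "a + b \<in> ?J" if "a \<in> ?J" "b \<in> ?J" for a b
      using that Poly_Mapping.keys_add[of a b] by blast
    show "b * a \<in> ?J" if "a \<in> ?J" for a b
    proof -
      have "r \<le> Poly_Mapping.lookup m X2" if m: "m \<in> Poly_Mapping.keys (b * a)" for m
      proof -
        obtain k l where "m = k + l" "l \<in> Poly_Mapping.keys a"
          using m keys_mult[of b a] by blast
        then show ?thesis using \<open>a \<in> ?J\<close> by (auto simp: lookup_add intro: trans_le_add2)
      qed
      then show ?thesis by blast
    qed
  qed simp
  moreover have "mvar X2 ^ r \<in> ?J" by (simp add: mvar_power)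
  ultimately have "x2_power_ideal r \<subseteq> ?J"
    unfolding x2_power_ideal_def genideal_def by blast
  moreover have "f \<in> x2_power_ideal r" if f: "f \<in> ?J" for f
    unfolding x2_power_ideal_def genideal_def
  proof (intro InterI, clarify)
    fix J :: "(gen, int) mpoly set"
    assume J: "ideal J ring_of_type_algebra" "{mvar X2 ^ r} \<subseteq> J"
    interpret ideal J ring_of_type_algebra by (rule J)
    have add: "a + b \<in> J" if "a \<in> J" "b \<in> J" for a b
      using additive_subgroup.a_closed[OF additive_subgroup_axioms that] by (simp add: ring_of_type_simps)
    have zero: "0 \<in> J" using additive_subgroup.zero_closed[OF additive_subgroup_axioms] by (simp add: ring_of_type_simps)
    have mul: "b * a \<in> J" if "a \<in> J" for a b
      using I_l_closed[OF that, of b] by (simp add: ring_of_type_simps)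
    have mono: "Poly_Mapping.single m (Poly_Mapping.lookup f m) \<in> J" if "m \<in> Poly_Mapping.keys f" for m
    proof -
      have le: "r \<le> Poly_Mapping.lookup m X2" using f that by blast
      have "m = (m - Poly_Mapping.single X2 r) + Poly_Mapping.single X2 r"
        by (rule poly_mapping_eqI) (use le in \<open>auto simp: lookup_add lookup_minus lookup_single when_def\<close>)
      then have "Poly_Mapping.single m (Poly_Mapping.lookup f m) =
          Poly_Mapping.single (m - Poly_Mapping.single X2 r) (Poly_Mapping.lookup f m) * mvar X2 ^ r"
        by (simp add: mvar_power mult_single)
      then show ?thesis using mul J(2) by auto
    qed
    have sumJ: "sum c S \<in> J" if "\<And>m. m \<in> S \<Longrightarrow> c m \<in> J"
      for c :: "(gen \<Rightarrow>\<^sub>0 nat) \<Rightarrow> (gen, int) mpoly" and S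
      using that by (induction S rule: infinite_finite_induct) (auto intro: add zero)
    have "(\<Sum>m\<in>Poly_Mapping.keys f. Poly_Mapping.single m (Poly_Mapping.lookup f m)) \<in> J"
      by (rule sumJ) (rule mono)
    then show "f \<in> J" using poly_mapping_sum_single[of f] by simp
  qed
  ultimately show ?thesis by blast
qed

text \<open>Elements of the ideal have no monomial with \<open>X2\<close>-exponent below
  \<open>r\<close>, so the coefficients at such monomials of weight \<open>i\<close> are well
  defined on cosets and serve as coordinates.\<close>

lemma abelian_rank_truncated_ring_piece:
  "abelian_rank (truncated_ring_piece r i) = (if even i then enat (card {b. 2 * b \<le> i div 2 \<and> b < r}) else 0)"
proof -
  let ?R = "ring_of_type_algebra :: (gen, int) mpoly ring" and ?I = "x2_power_ideal r"
  let ?A = "add_monoid (truncated_ring r)" and ?cs = "\<lambda>f. ?I +>\<^bsub>?R\<^esub> f"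
  let ?S = "{m. weight m = i \<and> Poly_Mapping.lookup m X2 < r}"
  have "cring ?R" by (rule cring_from_type_algebra)
  then interpret R: cring ?R .
  have I: "ideal ?I ?R"
    unfolding x2_power_ideal_def by (rule R.genideal_ideal) (simp add: ring_of_type_simps)
  interpret I: ideal ?I ?R by (rule I)
  have Q: "ring (truncated_ring r)" unfolding truncated_ring_def by (rule I.quotient_is_ring)
  then interpret Q: ring "truncated_ring r" .
  have A: "comm_group ?A" by (rule Q.a_comm_group)
  have cs: "?cs f = {g + f | g. g \<in> ?I}" for f
    by (auto simp: a_r_coset_def r_coset_def ring_of_type_algebra_def)
  have zero: "\<one>\<^bsub>?A\<^esub> = ?I" by (simp add: truncated_ring_def FactRing_def)
  have add: "?cs f \<otimes>\<^bsub>?A\<^esub> ?cs g = ?cs (f + g)" for f g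
    using I.a_rcos_sum[of f g] by (simp add: truncated_ring_def FactRing_def ring_of_type_simps)
  have car: "?cs f \<in> carrier ?A" for f
    by (auto simp: truncated_ring_def FactRing_def A_RCOSETS_def RCOSETS_def ring_of_type_algebra_def a_r_coset_def)
  have cs0: "?cs f = ?I \<longleftrightarrow> f \<in> ?I" for f
  proof
    have "0 \<in> ?I" by (simp add: x2_power_ideal_eq)
    then show "?cs f = ?I \<Longrightarrow> f \<in> ?I" unfolding cs by force
    show "f \<in> ?I \<Longrightarrow> ?cs f = ?I"
      using I.a_rcos_const by blast
  qed
  have hom0: "0 \<in> homogeneous i" by (simp add: homogeneous_def)
  have hom_add: "f + g \<in> homogeneous i" if "f \<in> homogeneous i" "g \<in> homogeneous i" for f g
    using that Poly_Mapping.keys_add[of f g] unfolding homogeneous_def by blast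
  have hom_minus: "- f \<in> homogeneous i" if "f \<in> homogeneous i" for f
    using that by (simp add: homogeneous_def)
  have grp: "group ?A" using A by (rule comm_group.axioms(2))
  have sub: "subgroup (?cs ` homogeneous i) ?A"
  proof (rule group.subgroupI[OF grp])
    show "?cs ` homogeneous i \<subseteq> carrier ?A" using car by blast
    show "?cs ` homogeneous i \<noteq> {}" using hom0 by blast
    show "a \<otimes>\<^bsub>?A\<^esub> b \<in> ?cs ` homogeneous i" if "a \<in> ?cs ` homogeneous i" "b \<in> ?cs ` homogeneous i" for a b
      using that add hom_add by force
    show "inv\<^bsub>?A\<^esub> a \<in> ?cs ` homogeneous i" if a: "a \<in> ?cs ` homogeneous i" for a
    proof -
      obtain f where f: "f \<in> homogeneous i" "a = ?cs f" using a by blast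
      have "?cs (- f) \<otimes>\<^bsub>?A\<^esub> ?cs f = \<one>\<^bsub>?A\<^esub>"
        unfolding add zero using cs0[of 0] by (simp add: x2_power_ideal_eq)
      then have "inv\<^bsub>?A\<^esub> a = ?cs (- f)" unfolding f(2) by (rule group.inv_equality[OF grp]) (rule car)+
      then show ?thesis using hom_minus[OF f(1)] by blast
    qed
  qed
  let ?G = "truncated_ring_piece r i"
  have carG: "carrier ?G = ?cs ` homogeneous i"
    unfolding truncated_ring_piece_def by (rule subgroup.carrier_subgroup_generated_subgroup[OF sub])
  have G: "comm_group ?G" "x \<otimes>\<^bsub>?G\<^esub> y = x \<otimes>\<^bsub>?A\<^esub> y" "\<one>\<^bsub>?G\<^esub> = \<one>\<^bsub>?A\<^esub>" for x y
    unfolding truncated_ring_piece_def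
    by (rule group.abelian_subgroup_generated[OF grp A]) (simp_all add: subgroup_generated_def)
  define h where "h C m = Poly_Mapping.lookup (SOME f. f \<in> C) m" for C :: "(gen, int) mpoly set" and m
  have h: "h (?cs f) m = Poly_Mapping.lookup f m" if "m \<in> ?S" for f m
  proof -
    have "f \<in> ?cs f" unfolding cs by (auto simp: x2_power_ideal_eq intro!: exI[of _ 0])
    then have "(SOME g. g \<in> ?cs f) \<in> ?cs f" by (rule someI)
    then obtain g where g: "(SOME g. g \<in> ?cs f) = g + f" "g \<in> ?I" unfolding cs by blast
    then have "m \<notin> Poly_Mapping.keys g" using that by (auto simp: x2_power_ideal_eq)
    then show ?thesis by (simp add: h_def g(1) lookup_add in_keys_iff)
  qed
  have bij: "if even i then bij_betw (\<lambda>m. Poly_Mapping.lookup m X2) ?S {b. 2 * b \<le> i div 2 \<and> b < r} else ?S = {}"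
  proof (cases "even i")
    case True
    then obtain q where i: "i = 2 * q" by blast
    \<comment> \<open>A monomial of weight \<open>2 * q\<close> is determined by its
      \<open>X2\<close>-exponent \<open>b\<close>: the weights 2 and 4 force the
      \<open>X1\<close>-exponent \<open>q - 2 * b\<close>.\<close>
    have "bij_betw (\<lambda>m. Poly_Mapping.lookup m X2) ?S {b. 2 * b \<le> q \<and> b < r}"
    proof (rule bij_betw_byWitness[where f' = "\<lambda>b. Poly_Mapping.single X1 (q - 2 * b) + Poly_Mapping.single X2 b"])
      show "\<forall>m\<in>?S. Poly_Mapping.single X1 (q - 2 * Poly_Mapping.lookup m X2) + Poly_Mapping.single X2 (Poly_Mapping.lookup m X2) = m"
      proof
        fix m assume "m \<in> ?S"
        then have "Poly_Mapping.lookup m X1 = q - 2 * Poly_Mapping.lookup m X2" unfolding weight_eq i mem_Collect_eq by arith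
        then have "Poly_Mapping.lookup (Poly_Mapping.single X1 (q - 2 * Poly_Mapping.lookup m X2) + Poly_Mapping.single X2 (Poly_Mapping.lookup m X2)) g = Poly_Mapping.lookup m g" for g
          by (cases g) (simp_all add: lookup_add lookup_single)
        then show "Poly_Mapping.single X1 (q - 2 * Poly_Mapping.lookup m X2) + Poly_Mapping.single X2 (Poly_Mapping.lookup m X2) = m"
          by (intro poly_mapping_eqI)
      qed
    qed (auto simp: weight_eq i lookup_add lookup_single)
    then show ?thesis by (simp add: i)
  next
    case False
    then show ?thesis unfolding weight_eq by auto
  qed
  have fin: "finite {b. 2 * b \<le> i div 2 \<and> b < r}" by simp
  have "finite ?S"
    using bij bij_betw_finite[of _ ?S] fin by (metis (no_types, lifting) finite.emptyI)
  then have "abelian_rank ?G = card ?S"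
  proof (rule abelian_rank_eqI[where h = h, OF G(1)])
    show "h (x \<otimes>\<^bsub>?G\<^esub> y) m = h x m + h y m" if xy: "x \<in> carrier ?G" "y \<in> carrier ?G" "m \<in> ?S" for x y m
    proof -
      obtain f g where "x = ?cs f" "y = ?cs g" using xy unfolding carG by blast
      then show ?thesis using xy(3) by (simp only: G(2) add h lookup_add)
    qed
    show "x = \<one>\<^bsub>?G\<^esub>" if x: "x \<in> carrier ?G" "\<And>m. m \<in> ?S \<Longrightarrow> h x m = 0" for x
    proof -
      obtain f where f: "x = ?cs f" "f \<in> homogeneous i" using x unfolding carG by blast
      have "r \<le> Poly_Mapping.lookup m X2" if "m \<in> Poly_Mapping.keys f" for m
      proof (rule ccontr)
        assume "\<not> ?thesis"
        then have "m \<in> ?S" using f(2) that by (simp add: homogeneous_def)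
        then show False using x(2)[of m] h[of m f] that f(1) by (simp add: in_keys_iff)
      qed
      then have "f \<in> ?I" by (simp add: x2_power_ideal_eq)
      then show ?thesis using cs0 f(1) by (simp only: G(3) zero)
    qed
    show "\<exists>x\<in>carrier ?G. \<forall>t\<in>?S. h x t = (if t = s then 1 else 0)" if "s \<in> ?S" for s
    proof
      have "Poly_Mapping.single s 1 \<in> homogeneous i" using that by (simp add: homogeneous_def)
      then show "?cs (Poly_Mapping.single s 1) \<in> carrier ?G" unfolding carG by blast
      show "\<forall>t\<in>?S. h (?cs (Poly_Mapping.single s 1)) t = (if t = s then 1 else 0)"
        using h by (simp add: lookup_single when_def)
    qed
  qed
  then show ?thesis
    using bij bij_betw_same_card by (auto simp: zero_enat_def split: if_splits)
qed

theorem theorem6p10: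
  fixes i :: nat
  assumes "i \<le> 2 * (CARD('n::finite) + CARD('r::finite) - 2)"
  shows "fps_nth (hilbert_poincare_series
            (\<lambda>k. singular_cohomology_group k
              (quot_space 2 :: (('n, complex) mpoly ^ 'r) set topology))) i =
         fps_nth (hilbert_poincare_series (truncated_ring_piece CARD('r))) i"
  unfolding hilbert_poincare_series_def fps_nth_Abs_fps
  using abelian_rank_cohomology_quot_space[OF assms] abelian_rank_truncated_ring_piece by simp

end
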